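(* Let $A^0,A^1,L,B$ be real symmetric $n\times n$ matrices with $A^0$ positive definite and $L,B$ positive semi-definite, and suppose there exists a compensating function $K$ for the linear system $A^0U_t+A^1U_x+LU=BU_{xx}$, $x\in\mathbb{R}$, $t>0$. Suppose $U_0\in H^s(\mathbb{R})\cap L^1(\mathbb{R})$ (with values in $\mathbb{R}^n$), with $s\ge2$. Then the solution $U$ of the Cauchy problem for this system with $U(x,0)=U_0(x)$ satisfies the decay rate $$\|\partial_x^lU(\cdot,t)\|_{L^2}^2\le C\Big(e^{-kt}\|\partial_x^lU_0\|_{L^2}^2+(1+t)^{-(l+1/2)}\|U_0\|_{L^1}^2\Big),\qquad t\ge0,$$ for all integers $0\le l\le s-1$ and some uniform constants $C,k>0$.
   Context: Definition: a real matrix $K$ is a compensating function for the system if (a) $KA^0$ is skew-symmetric, and (b) $\tfrac12\big(KA^1+(KA^1)^\top\big)+B+L$ is positive definite. The constants $C,k$ are uniform in the sense that they do not depend on $t$ or on $U_0$. Norms are those of $L^2(\mathbb{R})$ and $L^1(\mathbb{R})$. *)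

theory Defs
  imports "HOL-Analysis.Analysis"
begin

section \<open>Matrices and compensating functions\<close>

definition symmetric_matrix :: "real^'n^'n \<Rightarrow> bool" where
  "symmetric_matrix M \<longleftrightarrow> transpose M = M"

definition skew_symmetric_matrix :: "real^'n^'n \<Rightarrow> bool" where
  "skew_symmetric_matrix M \<longleftrightarrow> transpose M = - M"

definition pos_def :: "real^'n^'n \<Rightarrow> bool" where
  "pos_def M \<longleftrightarrow> symmetric_matrix M \<and> (\<forall>x. x \<noteq> 0 \<longrightarrow> x \<bullet> (M *v x) > 0)"

definition pos_semidef :: "real^'n^'n \<Rightarrow> bool" where
  "pos_semidef M \<longleftrightarrow> symmetric_matrix M \<and> (\<forall>x. x \<bullet> (M *v x) \<ge> 0)"

definition compensating_function ::
    "real^'n^'n \<Rightarrow> real^'n^'n \<Rightarrow> real^'n^'n \<Rightarrow> real^'n^'n \<Rightarrow> real^'n^'n \<Rightarrow> bool" where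
  "compensating_function A0 A1 L B K \<longleftrightarrow>
     skew_symmetric_matrix (K ** A0) \<and>
     pos_def ((1/2) *\<^sub>R (K ** A1 + transpose (K ** A1)) + B + L)"


section \<open>Lebesgue norms\<close>

text \<open>Elements of Lebesgue and Sobolev spaces are represented by Borel measurable functions;
  all notions below are invariant under changes on null sets.  Both norms are Bochner integrals,
  hence only meaningful for functions in the respective space.\<close>

definition sq_integrable :: "(real \<Rightarrow> 'a::euclidean_space) \<Rightarrow> bool" where
  "sq_integrable u \<longleftrightarrow> u \<in> borel_measurable lborel \<and> integrable lborel (\<lambda>x. (norm (u x))\<^sup>2)"

definition L2_norm :: "(real \<Rightarrow> 'a::euclidean_space) \<Rightarrow> real" where
  "L2_norm u = sqrt (LINT x|lborel. (norm (u x))\<^sup>2)"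

definition L1_norm :: "(real \<Rightarrow> 'a::euclidean_space) \<Rightarrow> real" where
  "L1_norm u = (LINT x|lborel. norm (u x))"


section \<open>Weak derivatives\<close>

definition test_function :: "(real \<Rightarrow> real) \<Rightarrow> bool" where
  "test_function \<phi> \<longleftrightarrow>
     (\<forall>k x. (deriv ^^ k) \<phi> differentiable (at x)) \<and> (\<exists>R. \<forall>x. \<bar>x\<bar> > R \<longrightarrow> \<phi> x = 0)"

definition locally_integrable :: "(real \<Rightarrow> 'a::euclidean_space) \<Rightarrow> bool" where
  "locally_integrable u \<longleftrightarrow> (\<forall>R. set_integrable lborel {-R..R} u)"

definition has_weak_deriv ::
    "nat \<Rightarrow> (real \<Rightarrow> 'a::euclidean_space) \<Rightarrow> (real \<Rightarrow> 'a) \<Rightarrow> bool" where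
  "has_weak_deriv l u v \<longleftrightarrow>
     locally_integrable u \<and> locally_integrable v \<and>
     (\<forall>\<phi>. test_function \<phi> \<longrightarrow>
        (LINT x|lborel. (deriv ^^ l) \<phi> x *\<^sub>R u x) = (- 1) ^ l *\<^sub>R (LINT x|lborel. \<phi> x *\<^sub>R v x))"

text \<open>A representative; weak derivatives are unique up to null sets.\<close>

definition weak_deriv :: "nat \<Rightarrow> (real \<Rightarrow> 'a::euclidean_space) \<Rightarrow> real \<Rightarrow> 'a" where
  "weak_deriv l u = (SOME v. has_weak_deriv l u v)"


section \<open>Fourier transform and Sobolev spaces of real order\<close>

definition fourier_L1 :: "(real \<Rightarrow> real^'n) \<Rightarrow> real \<Rightarrow> complex^'n" where
  "fourier_L1 u \<xi> =
     (\<chi> i. (LINT x|lborel. exp (- (\<i> * of_real (\<xi> * x))) * of_real (u x $ i)) / of_real (sqrt (2 * pi)))"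

text \<open>The Fourier-Plancherel transform of a square-integrable function is the limit in \<open>L\<^sup>2\<close>
  of the transforms of its truncations (the truncations are integrable, \<open>u\<close> itself need not be).
  It is unique up to null sets.\<close>

definition is_fourier_L2 :: "(real \<Rightarrow> real^'n) \<Rightarrow> (real \<Rightarrow> complex^'n) \<Rightarrow> bool" where
  "is_fourier_L2 u g \<longleftrightarrow> sq_integrable u \<and> sq_integrable g \<and>
     ((\<lambda>R. L2_norm (\<lambda>\<xi>. fourier_L1 (\<lambda>x. indicator {-R..R} x *\<^sub>R u x) \<xi> - g \<xi>)) \<longlongrightarrow> 0) at_top"

definition fourier_L2 :: "(real \<Rightarrow> real^'n) \<Rightarrow> real \<Rightarrow> complex^'n" where
  "fourier_L2 u = (SOME g. is_fourier_L2 u g)"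

text \<open>\<open>H\<^sup>s(\<real>; \<real>\<^sup>n)\<close> for \<open>s \<ge> 0\<close>.  For integer \<open>s\<close> it consists of the functions all of whose weak
  derivatives up to order \<open>s\<close> are square-integrable, with an equivalent norm.\<close>

definition sobolev :: "real \<Rightarrow> (real \<Rightarrow> real^'n) set" where
  "sobolev s = {u. \<exists>g. is_fourier_L2 u g \<and>
                       integrable lborel (\<lambda>\<xi>. (1 + \<xi>\<^sup>2) powr s * (norm (g \<xi>))\<^sup>2)}"

definition sobolev_norm :: "real \<Rightarrow> (real \<Rightarrow> real^'n) \<Rightarrow> real" where
  "sobolev_norm s u = sqrt (LINT \<xi>|lborel. (1 + \<xi>\<^sup>2) powr s * (norm (fourier_L2 u \<xi>))\<^sup>2)"


section \<open>Solutions of the Cauchy problem\<close>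

text \<open>Curves \<open>t \<mapsto> U t\<close> in \<open>H\<^sup>s\<close>, for \<open>t \<in> [0,\<infinity>)\<close>; \<open>U t x\<close> is the value at time \<open>t\<close> and position \<open>x\<close>.
  At \<open>t = 0\<close> limits are one-sided.\<close>

definition sobolev_continuous :: "real \<Rightarrow> (real \<Rightarrow> real \<Rightarrow> real^'n) \<Rightarrow> bool" where
  "sobolev_continuous s U \<longleftrightarrow>
     (\<forall>t\<ge>0. U t \<in> sobolev s \<and>
        ((\<lambda>\<tau>. sobolev_norm s (\<lambda>x. U \<tau> x - U t x)) \<longlongrightarrow> 0) (at t within {0..}))"

definition sobolev_has_deriv ::
    "real \<Rightarrow> (real \<Rightarrow> real \<Rightarrow> real^'n) \<Rightarrow> (real \<Rightarrow> real \<Rightarrow> real^'n) \<Rightarrow> bool" where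
  "sobolev_has_deriv s U V \<longleftrightarrow>
     (\<forall>t\<ge>0. U t \<in> sobolev s \<and> V t \<in> sobolev s \<and>
        ((\<lambda>\<tau>. sobolev_norm s (\<lambda>x. (U \<tau> x - U t x) /\<^sub>R (\<tau> - t) - V t x)) \<longlongrightarrow> 0) (at t within {0..}))"

text \<open>Solutions in \<open>C([0,\<infinity>); H\<^sup>s) \<inter> C\<^sup>1([0,\<infinity>); H\<^sup>s\<^sup>-\<^sup>2)\<close>, the class in which the problem is well-posed
  for \<open>U0 \<in> H\<^sup>s\<close>.  Since \<open>s \<ge> 2\<close>, every term of the equation is a function in \<open>L\<^sup>2\<close>.\<close>

definition cauchy_solution ::
    "real^'n^'n \<Rightarrow> real^'n^'n \<Rightarrow> real^'n^'n \<Rightarrow> real^'n^'n \<Rightarrow> real \<Rightarrow>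
     (real \<Rightarrow> real^'n) \<Rightarrow> (real \<Rightarrow> real \<Rightarrow> real^'n) \<Rightarrow> bool" where
  "cauchy_solution A0 A1 L B s U0 U \<longleftrightarrow>
     sobolev_continuous s U \<and>
     (\<exists>Ut Ux Uxx.
        sobolev_has_deriv (s - 2) U Ut \<and> sobolev_continuous (s - 2) Ut \<and>
        (\<forall>t>0. has_weak_deriv 1 (U t) (Ux t) \<and> has_weak_deriv 2 (U t) (Uxx t) \<and>
           (AE x in lborel.
              A0 *v Ut t x + A1 *v Ux t x + L *v U t x = B *v Uxx t x))) \<and>
     (AE x in lborel. U 0 x = U0 x)"

end

theory Submission
  imports
    Defs
    "HOL-Probability.Probability"
    "HOL-Real_Asymp.Real_Asymp"
begin

text \<open>
  On the Fourier side the system is a linear ordinary differential equation in \<open>t\<close> for each frequency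
  \<open>\<xi>\<close>.  Adding a small multiple of the compensator \<open>\<xi> / (1 + \<xi>\<^sup>2) * (p \<bullet> K A\<^sup>0 q)\<close> to the energy
  \<open>p \<bullet> A\<^sup>0 p + q \<bullet> A\<^sup>0 q\<close> of \<open>p + \<i> q\<close> gives an equivalent energy that decays at rate
  \<open>k \<xi>\<^sup>2 / (1 + \<xi>\<^sup>2)\<close>, hence the same decay of the squared modulus of the transform of \<open>U(t)\<close>.  For \<open>\<bar>\<xi>\<bar> \<ge> 1\<close> the rate is
  at least \<open>k / 2\<close>, which yields the exponential term; for \<open>\<bar>\<xi>\<bar> \<le> 1\<close> the transform of the datum is bounded by
  its \<open>L\<^sup>1\<close> norm, and the Gaussian integral of \<open>\<xi>\<^sup>2\<^sup>l exp (- k \<xi>\<^sup>2 t / 2)\<close> yields the algebraic term.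
  The transfer between the two sides rests on the Plancherel theorem, proved by Gaussian
  regularisation, and on the du Bois-Reymond lemma.
\<close>

section \<open>Square-integrable functions\<close>

text \<open>The plain energy dissipates only the quadratic forms of L and, with a factor \<xi>^2, of
  B at p and q; this gives nothing on the common kernel of L and B. The compensator couples p and q
  to repair that. Since K A0 is skew-symmetric, the time derivative of p . K A0 q can be written
  with both A0 p' and A0 q' directly behind K, so the equation can be inserted, and the transport
  term contributes -\<xi> (p . K A1 p + q . K A1 q). These quadratic forms see only the symmetric
  part of K A1, which condition (b) makes definite in every direction once L and B are added. All
  remaining terms are absorbed by the plain dissipation if the multiple of the compensator is small.

  The obstacle is one of meaning: for each t the transform of U(t) is a class modulo null sets, and
  the weak space derivatives are only known to be locally integrable. So the equation reaches the
  Fourier side through pairings with test functions, and time derivatives are taken of energies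
  integrated over sets of frequencies.\<close>

lemma sq_integrable_measurable [measurable_dest]:
  "sq_integrable f \<Longrightarrow> f \<in> borel_measurable lborel"
  by (simp add: sq_integrable_def)

lemma L2_norm_nonneg [simp]: "0 \<le> L2_norm f"
  by (simp add: L2_norm_def)

lemma L2_norm_sq: "(L2_norm f)\<^sup>2 = (LBINT x. (norm (f x))\<^sup>2)"
  by (simp add: L2_norm_def integral_nonneg_AE)

lemma L2_norm_cong_AE:
  assumes "AE x in lborel. norm (f x) = norm (g x)"
    and [measurable]: "f \<in> borel_measurable lborel" "g \<in> borel_measurable lborel"
  shows "L2_norm f = L2_norm g"
  unfolding L2_norm_def by (rule arg_cong[where f=sqrt], rule integral_cong_AE) (use assms in auto)

lemma L2_norm_minus_commute: "L2_norm (\<lambda>x. f x - g x) = L2_norm (\<lambda>x. g x - f x)"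
  by (simp add: L2_norm_def norm_minus_commute)

lemma norm_add_sq_le: "(norm (a + b))\<^sup>2 \<le> 2 * (norm a)\<^sup>2 + 2 * (norm (b::'a::real_normed_vector))\<^sup>2"
proof -
  have "(norm (a + b))\<^sup>2 \<le> (norm a + norm b)\<^sup>2"
    by (intro power_mono norm_triangle_ineq) auto
  also have "\<dots> \<le> 2 * (norm a)\<^sup>2 + 2 * (norm b)\<^sup>2"
    using sum_squares_bound[of "norm a" "norm b"] by (simp add: power2_sum)
  finally show ?thesis .
qed

lemma sq_integrable_bound:
  assumes "sq_integrable g" and [measurable]: "f \<in> borel_measurable lborel"
    and "AE x in lborel. norm (f x) \<le> norm (g x)"
  shows "sq_integrable f"
proof -
  have "integrable lborel (\<lambda>x. (norm (f x))\<^sup>2)"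
  proof (rule Bochner_Integration.integrable_bound)
    show "integrable lborel (\<lambda>x. (norm (g x))\<^sup>2)" using assms by (simp add: sq_integrable_def)
    show "AE x in lborel. norm ((norm (f x))\<^sup>2) \<le> norm ((norm (g x))\<^sup>2)"
      using assms(3) by eventually_elim (simp add: power_mono)
  qed measurable
  then show ?thesis by (simp add: sq_integrable_def)
qed

lemma sq_integrable_add:
  assumes "sq_integrable f" "sq_integrable g"
  shows "sq_integrable (\<lambda>x. f x + g x)"
proof -
  note [measurable] = assms[THEN sq_integrable_measurable]
  have "integrable lborel (\<lambda>x. (norm (f x + g x))\<^sup>2)"
  proof (rule Bochner_Integration.integrable_bound)
    show "integrable lborel (\<lambda>x. 2 * (norm (f x))\<^sup>2 + 2 * (norm (g x))\<^sup>2)"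
      using assms by (simp add: sq_integrable_def)
    show "AE x in lborel. norm ((norm (f x + g x))\<^sup>2) \<le> norm (2 * (norm (f x))\<^sup>2 + 2 * (norm (g x))\<^sup>2)"
      using norm_add_sq_le[of "f _" "g _"] by (auto intro!: AE_I2)
  qed measurable
  then show ?thesis by (simp add: sq_integrable_def)
qed

lemma sq_integrable_bounded_mult:
  fixes f :: "real \<Rightarrow> 'a::euclidean_space"
  assumes "sq_integrable f" and [measurable]: "g \<in> borel_measurable lborel"
    and le: "\<And>x. norm (g x) \<le> C * norm (f x)"
  shows "sq_integrable g"
proof -
  have "sq_integrable (\<lambda>x. C *\<^sub>R f x)"
    using assms(1) by (auto simp: sq_integrable_def power_mult_distrib)
  then show ?thesis
    by (rule sq_integrable_bound)
       (auto intro!: AE_I2 order_trans[OF le] mult_right_mono)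
qed

lemma sq_integrable_scaleR:
  "sq_integrable f \<Longrightarrow> sq_integrable (\<lambda>x. c *\<^sub>R f x)"
  by (auto simp: sq_integrable_def power_mult_distrib)

lemma sq_integrable_uminus: "sq_integrable f \<Longrightarrow> sq_integrable (\<lambda>x. - f x)"
  by (simp add: sq_integrable_def)

lemma sq_integrable_diff:
  "sq_integrable f \<Longrightarrow> sq_integrable g \<Longrightarrow> sq_integrable (\<lambda>x. f x - g x)"
  using sq_integrable_add[of f "\<lambda>x. - g x"] by (simp add: sq_integrable_uminus)

lemma sq_integrable_cmult:
  fixes f :: "real \<Rightarrow> complex"
  shows "sq_integrable f \<Longrightarrow> sq_integrable (\<lambda>x. c * f x)"
  by (auto simp: sq_integrable_def power_mult_distrib norm_mult)

lemma sq_integrable_indicator: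
  "sq_integrable f \<Longrightarrow> A \<in> sets borel \<Longrightarrow> sq_integrable (\<lambda>x. indicator A x *\<^sub>R f x)"
  by (rule sq_integrable_bound)
     (auto intro!: borel_measurable_scaleR AE_I2 simp: indicator_def dest: sq_integrable_measurable)

lemma integrable_norm_mult_norm:
  assumes "sq_integrable f" "sq_integrable g"
  shows "integrable lborel (\<lambda>x. norm (f x) * norm (g x))"
proof (rule Bochner_Integration.integrable_bound)
  note [measurable] = assms[THEN sq_integrable_measurable]
  show "integrable lborel (\<lambda>x. (norm (f x))\<^sup>2 + (norm (g x))\<^sup>2)"
    using assms by (simp add: sq_integrable_def)
  have "norm (f x) * norm (g x) \<le> (norm (f x))\<^sup>2 + (norm (g x))\<^sup>2" for x
    using sum_squares_bound[of "norm (f x)" "norm (g x)"] mult_nonneg_nonneg[OF norm_ge_zero norm_ge_zero, of "f x" "g x"]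
    by linarith
  then show "AE x in lborel. norm (norm (f x) * norm (g x)) \<le> norm ((norm (f x))\<^sup>2 + (norm (g x))\<^sup>2)"
    by (auto intro!: AE_I2)
qed (use assms[THEN sq_integrable_measurable] in measurable)

lemma L2_Cauchy_Schwarz:
  assumes f: "sq_integrable f" and g: "sq_integrable g"
  shows "(LBINT x. norm (f x) * norm (g x)) \<le> L2_norm f * L2_norm g"
proof -
  note [measurable] = f[THEN sq_integrable_measurable] g[THEN sq_integrable_measurable]
  define I where "I = (LBINT x. norm (f x) * norm (g x))"
  have I0: "0 \<le> I" by (simp add: I_def)
  have "(\<integral>\<^sup>+x. ennreal (norm (f x)) * ennreal (norm (g x)) \<partial>lborel)\<^sup>2
     \<le> (\<integral>\<^sup>+x. ennreal (norm (f x))^2 \<partial>lborel) * (\<integral>\<^sup>+x. ennreal (norm (g x))^2 \<partial>lborel)"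
    by (rule Cauchy_Schwarz_nn_integral) measurable
  also have "(\<integral>\<^sup>+x. ennreal (norm (f x)) * ennreal (norm (g x)) \<partial>lborel) = ennreal I"
    unfolding I_def using integrable_norm_mult_norm[OF f g]
    by (subst nn_integral_eq_integral[symmetric]) (auto simp: ennreal_mult)
  also have "(\<integral>\<^sup>+x. ennreal (norm (f x))^2 \<partial>lborel) = ennreal ((L2_norm f)\<^sup>2)"
    unfolding L2_norm_sq using f
    by (subst nn_integral_eq_integral[symmetric]) (auto simp: ennreal_power sq_integrable_def)
  also have "(\<integral>\<^sup>+x. ennreal (norm (g x))^2 \<partial>lborel) = ennreal ((L2_norm g)\<^sup>2)"
    unfolding L2_norm_sq using g
    by (subst nn_integral_eq_integral[symmetric]) (auto simp: ennreal_power sq_integrable_def)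
  finally have "I\<^sup>2 \<le> (L2_norm f * L2_norm g)\<^sup>2"
    using I0 by (simp add: ennreal_power ennreal_mult[symmetric] power_mult_distrib)
  then show ?thesis unfolding I_def[symmetric] by (rule power2_le_imp_le) simp
qed

lemma L2_norm_triangle:
  assumes f: "sq_integrable f" and g: "sq_integrable g"
  shows "L2_norm (\<lambda>x. f x + g x) \<le> L2_norm f + L2_norm g"
proof (rule power2_le_imp_le)
  note [measurable] = f[THEN sq_integrable_measurable] g[THEN sq_integrable_measurable]
  have i: "integrable lborel (\<lambda>x. (norm (f x))\<^sup>2)" "integrable lborel (\<lambda>x. (norm (g x))\<^sup>2)"
    using f g by (auto simp: sq_integrable_def)
  have "(L2_norm (\<lambda>x. f x + g x))\<^sup>2 \<le> (LBINT x. (norm (f x))\<^sup>2 + 2 * (norm (f x) * norm (g x)) + (norm (g x))\<^sup>2)"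
    unfolding L2_norm_sq
  proof (rule integral_mono)
    show "integrable lborel (\<lambda>x. (norm (f x + g x))\<^sup>2)"
      using sq_integrable_add[OF f g] by (simp add: sq_integrable_def)
    show "integrable lborel (\<lambda>x. (norm (f x))\<^sup>2 + 2 * (norm (f x) * norm (g x)) + (norm (g x))\<^sup>2)"
      using i integrable_norm_mult_norm[OF f g] by simp
    fix x
    have "(norm (f x + g x))\<^sup>2 \<le> (norm (f x) + norm (g x))\<^sup>2"
      by (intro power_mono norm_triangle_ineq) auto
    then show "(norm (f x + g x))\<^sup>2 \<le> (norm (f x))\<^sup>2 + 2 * (norm (f x) * norm (g x)) + (norm (g x))\<^sup>2"
      by (simp add: power2_sum)
  qed
  also have "\<dots> = (L2_norm f)\<^sup>2 + 2 * (LBINT x. norm (f x) * norm (g x)) + (L2_norm g)\<^sup>2"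
    using i integrable_norm_mult_norm[OF f g] by (simp add: L2_norm_sq)
  also have "\<dots> \<le> (L2_norm f + L2_norm g)\<^sup>2"
    using L2_Cauchy_Schwarz[OF f g] by (simp add: power2_sum)
  finally show "(L2_norm (\<lambda>x. f x + g x))\<^sup>2 \<le> (L2_norm f + L2_norm g)\<^sup>2" .
qed simp

lemma L2_norm_triangle_diff:
  assumes "sq_integrable f" "sq_integrable g" "sq_integrable h"
  shows "L2_norm (\<lambda>x. f x - h x) \<le> L2_norm (\<lambda>x. f x - g x) + L2_norm (\<lambda>x. g x - h x)"
  using L2_norm_triangle[of "\<lambda>x. f x - g x" "\<lambda>x. g x - h x"] assms by (simp add: sq_integrable_diff)

lemma L2_norm_eq_0_imp_AE:
  assumes "sq_integrable f" "L2_norm f = 0"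
  shows "AE x in lborel. f x = 0"
proof -
  have "(LBINT x. (norm (f x))\<^sup>2) = 0" using assms(2) by (simp add: L2_norm_sq[symmetric])
  then show ?thesis
    using assms(1) by (subst (asm) integral_nonneg_eq_0_iff_AE) (auto simp: sq_integrable_def)
qed

text \<open>Cauchy-Schwarz bounds the difference of the pairings. No conjugate is built in: callers
  pass a conjugated \<open>g\<close>. This is the tool for taking limits in the autocorrelation and
  in Parseval's identity.\<close>

lemma L2_tendsto_inner:
  fixes f :: "'b \<Rightarrow> real \<Rightarrow> complex"
  assumes f: "\<And>n. sq_integrable (f n)" and h: "sq_integrable h" and g: "sq_integrable g"
    and lim: "((\<lambda>n. L2_norm (\<lambda>x. f n x - h x)) \<longlongrightarrow> 0) F"
  shows "((\<lambda>n. LBINT x. f n x * g x) \<longlongrightarrow> (LBINT x. h x * g x)) F"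
proof -
  have int: "integrable lborel (\<lambda>x. u x * g x)" if "sq_integrable u" for u :: "real \<Rightarrow> complex"
    using integrable_norm_mult_norm[OF that g] sq_integrable_measurable[OF that] sq_integrable_measurable[OF g]
    by (subst integrable_norm_iff[symmetric]) (auto simp: norm_mult)
  have "((\<lambda>n. (LBINT x. f n x * g x) - (LBINT x. h x * g x)) \<longlongrightarrow> 0) F"
  proof (rule Lim_null_comparison)
    have "norm ((LBINT x. f n x * g x) - (LBINT x. h x * g x))
        \<le> L2_norm (\<lambda>x. f n x - h x) * L2_norm g" for n
    proof -
      have "(LBINT x. f n x * g x) - (LBINT x. h x * g x) = (LBINT x. (f n x - h x) * g x)"
        using int[OF f] int[OF h] by (simp add: left_diff_distrib)
      also have "norm \<dots> \<le> (LBINT x. norm (f n x - h x) * norm (g x))"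
        using integral_norm_bound[of lborel "\<lambda>x. (f n x - h x) * g x"] by (simp add: norm_mult)
      also have "\<dots> \<le> L2_norm (\<lambda>x. f n x - h x) * L2_norm g"
        by (rule L2_Cauchy_Schwarz) (auto intro: sq_integrable_diff f h g)
      finally show ?thesis .
    qed
    then show "\<forall>\<^sub>F n in F. norm ((LBINT x. f n x * g x) - (LBINT x. h x * g x))
        \<le> L2_norm (\<lambda>x. f n x - h x) * L2_norm g" by simp
    show "((\<lambda>n. L2_norm (\<lambda>x. f n x - h x) * L2_norm g) \<longlongrightarrow> 0) F"
      using tendsto_mult_right[OF lim, of "L2_norm g"] by simp
  qed
  then show ?thesis by (simp add: LIM_zero_iff)
qed

lemma L2_tendsto_dominated:
  assumes f: "\<And>n::nat. f n \<in> borel_measurable lborel" and h: "h \<in> borel_measurable lborel"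
    and D: "sq_integrable D" and le: "\<And>n. AE x in lborel. norm (f n x - h x) \<le> norm (D x)"
    and lim: "AE x in lborel. (\<lambda>n. f n x) \<longlonglongrightarrow> h x"
  shows "(\<lambda>n. L2_norm (\<lambda>x. f n x - h x)) \<longlonglongrightarrow> 0"
proof -
  note [measurable] = f h
  have "(\<lambda>n. LBINT x. (norm (f n x - h x))\<^sup>2) \<longlonglongrightarrow> (LBINT x::real. 0)"
  proof (rule integral_dominated_convergence)
    show "integrable lborel (\<lambda>x. (norm (D x))\<^sup>2)" using D by (simp add: sq_integrable_def)
    show "AE x in lborel. (\<lambda>n. (norm (f n x - h x))\<^sup>2) \<longlonglongrightarrow> 0"
      using lim
    proof eventually_elim
      case (elim x)
      then have "(\<lambda>n. (norm (f n x - h x))\<^sup>2) \<longlonglongrightarrow> (norm (h x - h x))\<^sup>2" by (intro tendsto_intros)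
      then show ?case by simp
    qed
    show "AE x in lborel. norm ((norm (f n x - h x))\<^sup>2) \<le> (norm (D x))\<^sup>2" for n
      using le[of n] by eventually_elim (simp add: power_mono)
  qed measurable
  then have "(\<lambda>n. sqrt (LBINT x. (norm (f n x - h x))\<^sup>2)) \<longlonglongrightarrow> sqrt 0"
    by (intro tendsto_real_sqrt) simp
  then show ?thesis by (simp add: L2_norm_def)
qed

section \<open>Continuity of translations in L2\<close>

lemma L2_norm_shift: "L2_norm (\<lambda>x. f (x + h)) = L2_norm f"
  unfolding L2_norm_def
  using lborel_integral_real_affine[of 1 "\<lambda>x. (norm (f x))\<^sup>2" h] by (simp add: add.commute)

lemma sq_integrable_shift:
  assumes "sq_integrable f" shows "sq_integrable (\<lambda>x. f (x + h))"
proof -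
  have "integrable lborel (\<lambda>x. (norm (f (h + 1 * x)))\<^sup>2)"
    using assms by (intro lborel_integrable_real_affine[where f="\<lambda>x. (norm (f x))\<^sup>2"]) (auto simp: sq_integrable_def)
  moreover have "(\<lambda>x. f (x + h)) \<in> borel_measurable lborel"
    using assms[THEN sq_integrable_measurable] by measurable
  ultimately show ?thesis by (simp add: sq_integrable_def add.commute)
qed

text \<open>Sequences of shifts replace the limit h -> 0 because dominated convergence, used to
  verify the property, is available along sequences.\<close>

definition L2_shift_continuous :: "(real \<Rightarrow> 'a::euclidean_space) \<Rightarrow> bool" where
  "L2_shift_continuous f \<longleftrightarrow>
     (\<forall>h::nat \<Rightarrow> real. h \<longlonglongrightarrow> 0 \<longrightarrow> (\<lambda>n. L2_norm (\<lambda>x. f (x + h n) - f x)) \<longlonglongrightarrow> 0)"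

text \<open>An epsilon/3 argument: by translation invariance of the norm, the approximation error of
  the shifted functions equals that of the unshifted ones, uniformly in the shift.\<close>

lemma L2_shift_continuous_limit:
  assumes f: "\<And>k. sq_integrable (f k)" "\<And>k. L2_shift_continuous (f k)" and g: "sq_integrable g"
    and lim: "(\<lambda>k::nat. L2_norm (\<lambda>x. f k x - g x)) \<longlonglongrightarrow> 0"
  shows "L2_shift_continuous g"
  unfolding L2_shift_continuous_def
proof (intro allI impI)
  fix h :: "nat \<Rightarrow> real" assume h: "h \<longlonglongrightarrow> 0"
  show "(\<lambda>n. L2_norm (\<lambda>x. g (x + h n) - g x)) \<longlonglongrightarrow> 0"
  proof (rule LIMSEQ_I)
    fix e :: real assume e: "0 < e"
    obtain k where k: "L2_norm (\<lambda>x. f k x - g x) < e/3"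
      using LIMSEQ_D[OF lim, of "e/3"] e by fastforce
    have "(\<lambda>n. L2_norm (\<lambda>x. f k (x + h n) - f k x)) \<longlonglongrightarrow> 0"
      using f(2) h by (auto simp: L2_shift_continuous_def)
    from LIMSEQ_D[OF this, of "e/3"] e
    obtain N where N: "\<And>n. n \<ge> N \<Longrightarrow> L2_norm (\<lambda>x. f k (x + h n) - f k x) < e/3"
      by fastforce
    have "L2_norm (\<lambda>x. g (x + h n) - g x) < e" if "n \<ge> N" for n
    proof -
      note sh = sq_integrable_shift[OF g] sq_integrable_shift[OF f(1)]
      have "L2_norm (\<lambda>x. g (x + h n) - g x) \<le> L2_norm (\<lambda>x. g (x + h n) - f k (x + h n)) + L2_norm (\<lambda>x. f k (x + h n) - g x)"
        by (rule L2_norm_triangle_diff) (intro sh g f)+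
      also have "L2_norm (\<lambda>x. f k (x + h n) - g x) \<le> L2_norm (\<lambda>x. f k (x + h n) - f k x) + L2_norm (\<lambda>x. f k x - g x)"
        by (rule L2_norm_triangle_diff) (intro sh g f)+
      also have "L2_norm (\<lambda>x. g (x + h n) - f k (x + h n)) = L2_norm (\<lambda>x. f k x - g x)"
        using L2_norm_shift[of "\<lambda>x. g x - f k x" "h n"] L2_norm_minus_commute[of g "f k"] by simp
      finally show ?thesis using N[OF that] k by simp
    qed
    then show "\<exists>N. \<forall>n\<ge>N. norm (L2_norm (\<lambda>x. g (x + h n) - g x) - 0) < e" by auto
  qed
qed

lemma sq_integrable_bounded_support:
  assumes [measurable]: "f \<in> borel_measurable lborel" and "\<And>x. norm (f x) \<le> C"
    and "\<And>x. \<bar>x\<bar> > R \<Longrightarrow> f x = 0"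
  shows "sq_integrable f"
proof (rule sq_integrable_bound)
  have "integrable lborel (\<lambda>x. C\<^sup>2 * indicator {-R..R} x)"
    by (intro integrable_mult_right integrable_real_indicator) (auto simp: emeasure_lborel_Icc_eq)
  then show "sq_integrable (\<lambda>x. C * indicator {-R..R} x)"
    by (auto simp: sq_integrable_def power_mult_distrib power2_eq_square mult_ac simp flip: indicator_inter_arith)
  show "AE x in lborel. norm (f x) \<le> norm (C * indicator {-R..R} x)"
    using assms(2,3) by (auto intro!: AE_I2 simp: indicator_def abs_le_iff intro: order_trans[OF _ abs_ge_self])
qed measurable

text \<open>A convergent sequence of shifts is bounded by some \<open>H\<close>, so all differences
  are supported in [-(R+H), R+H], where a constant dominates them; continuity gives the pointwise
  limit.\<close>

lemma L2_shift_continuous_compact_support: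
  assumes cont: "continuous_on UNIV f" and b: "\<And>x. norm (f x) \<le> C"
    and supp: "\<And>x. \<bar>x\<bar> > R \<Longrightarrow> f x = 0"
  shows "L2_shift_continuous f"
  unfolding L2_shift_continuous_def
proof (intro allI impI)
  fix h :: "nat \<Rightarrow> real" assume h: "h \<longlonglongrightarrow> 0"
  from cont have m [measurable]: "f \<in> borel_measurable lborel"
    by (simp add: borel_measurable_continuous_onI)
  obtain H where H: "\<And>n. \<bar>h n\<bar> \<le> H"
    using convergent_imp_Bseq[of h] h by (auto simp: convergent_def Bseq_def)
  show "(\<lambda>n. L2_norm (\<lambda>x. f (x + h n) - f x)) \<longlonglongrightarrow> 0"
  proof (rule L2_tendsto_dominated)
    show "sq_integrable (\<lambda>x. 2 * C * indicator {-(R+H)..R+H} x :: real)"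
      by (rule sq_integrable_bounded_support[where C="\<bar>2*C\<bar>" and R="R+H"]) (auto simp: indicator_def)
    have "norm (f (x + h n) - f x) \<le> norm (2 * C * indicator {-(R+H)..R+H} x :: real)" for n x
    proof (cases "\<bar>x\<bar> \<le> R + H")
      case True
      have "norm (f (x + h n) - f x) \<le> C + C"
        by (rule order_trans[OF norm_triangle_ineq4 add_mono[OF b b]])
      then show ?thesis using True by (auto simp: indicator_def abs_le_iff)
    next
      case False
      then have "\<bar>x\<bar> > R" "\<bar>x + h n\<bar> > R" using H[of n] by linarith+
      then show ?thesis using supp by simp
    qed
    then show "AE x in lborel. norm (f (x + h n) - f x) \<le> norm (2 * C * indicator {-(R+H)..R+H} x :: real)" for n
      by (intro AE_I2)
    have "(\<lambda>n. f (x + h n)) \<longlonglongrightarrow> f x" for x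
    proof -
      have "isCont f x" using cont by (simp add: continuous_on_eq_continuous_at)
      moreover have "(\<lambda>n. x + h n) \<longlonglongrightarrow> x" using tendsto_add[OF tendsto_const h, of x] by simp
      ultimately show ?thesis by (rule isCont_tendsto_compose)
    qed
    then show "AE x in lborel. (\<lambda>n. f (x + h n)) \<longlonglongrightarrow> f x" by simp
  qed measurable
qed

text \<open>Density of continuous functions, in two stages. Measurability provides continuous
  functions converging almost everywhere, but with no bound; after cutting off in space and in
  height at level \<open>N\<close>, dominated convergence applies for fixed \<open>N\<close>. A
  second limit then removes the cutoffs.\<close>

lemma L2_shift_continuous_real:
  fixes f :: "real \<Rightarrow> real"
  assumes f: "sq_integrable f"
  shows "L2_shift_continuous f"
proof -
  note [measurable] = f[THEN sq_integrable_measurable]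
  \<comment> \<open>\<open>c N\<close> is a continuous plateau, 1 for |x| \<le> N - 1 and 0 for |x|
    \<ge> N; \<open>cl N\<close> clips values to [-N, N]. Continuity of both keeps the approximants
    continuous.\<close>
  define c :: "nat \<Rightarrow> real \<Rightarrow> real" where "c N x = max 0 (min 1 (real N - \<bar>x\<bar>))" for N x
  define cl :: "nat \<Rightarrow> real \<Rightarrow> real" where "cl N y = max (- real N) (min (real N) y)" for N y
  have [measurable]: "c N \<in> borel_measurable borel" "cl N \<in> borel_measurable borel" for N
    unfolding c_def cl_def by measurable
  have c_cont: "continuous_on UNIV (c N)" "continuous_on UNIV (cl N)" for N
    unfolding c_def cl_def by (intro continuous_intros)+
  have c1: "\<bar>c N x\<bar> \<le> 1" "\<bar>x\<bar> > real N \<Longrightarrow> c N x = 0" for N x by (auto simp: c_def)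
  have cl1: "\<bar>cl N y\<bar> \<le> real N" "\<bar>cl N y\<bar> \<le> \<bar>y\<bar>" for N y by (auto simp: cl_def)
  have bnd: "\<bar>c N x * cl N y\<bar> \<le> real N" "\<bar>c N x * cl N y\<bar> \<le> \<bar>y\<bar>" for N x y
    using mult_mono[OF c1(1) cl1(1), of N y N x] mult_mono[OF c1(1) cl1(2), of N y N x] by (auto simp: abs_mult)
  have "f \<in> borel_measurable lebesgue"
    using f[THEN sq_integrable_measurable] by (simp add: measurable_completion)
  then have "f measurable_on UNIV"
    by (simp add: measurable_on_iff_borel_measurable)
  then obtain Z g where Z: "negligible Z" and g: "\<And>n. continuous_on UNIV (g n)"
    and glim: "\<And>x. x \<notin> Z \<Longrightarrow> (\<lambda>n. g n x) \<longlonglongrightarrow> f x"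
    by (auto simp: measurable_on_def)
  have AEZ: "AE x in lborel. x \<notin> Z"
    using Z unfolding negligible_iff_null_sets
    by (metis AE_not_in AE_completion_iff)
  have [measurable]: "g n \<in> borel_measurable borel" for n
    using g by (simp add: borel_measurable_continuous_onI)
  have stage1: "L2_shift_continuous (\<lambda>x. c N x * cl N (f x))" for N
  proof (rule L2_shift_continuous_limit)
    show "sq_integrable (\<lambda>x. c N x * cl N (g k x))" for k
      by (rule sq_integrable_bounded_support[where C="real N" and R="real N"]) (use bnd c1 in auto)
    show "L2_shift_continuous (\<lambda>x. c N x * cl N (g k x))" for k
    proof (rule L2_shift_continuous_compact_support[where C="real N" and R="real N"])
      show "continuous_on UNIV (\<lambda>x. c N x * cl N (g k x))"
        by (intro continuous_intros c_cont continuous_on_compose2[OF c_cont(2) g]) auto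
    qed (use bnd c1 in auto)
    show "sq_integrable (\<lambda>x. c N x * cl N (f x))"
      by (rule sq_integrable_bounded_support[where C="real N" and R="real N"]) (use bnd c1 in auto)
    show "(\<lambda>k. L2_norm (\<lambda>x. c N x * cl N (g k x) - c N x * cl N (f x))) \<longlonglongrightarrow> 0"
    proof (rule L2_tendsto_dominated)
      show "sq_integrable (\<lambda>x. 2 * real N * indicator {-real N..real N} x :: real)"
        by (rule sq_integrable_bounded_support[where C="2*real N" and R="real N"]) (auto simp: indicator_def)
      have "norm (c N x * cl N y - c N x * cl N z) \<le> norm (2 * real N * indicator {-real N..real N} x :: real)" for x y z
      proof (cases "\<bar>x\<bar> \<le> real N")
        case True
        then show ?thesis using bnd(1)[of N x y] bnd(1)[of N x z] by (auto simp: indicator_def)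
      qed (use c1 in auto)
      then show "AE x in lborel. norm (c N x * cl N (g k x) - c N x * cl N (f x))
           \<le> norm (2 * real N * indicator {-real N..real N} x :: real)" for k by (intro AE_I2)
      show "AE x in lborel. (\<lambda>k. c N x * cl N (g k x)) \<longlonglongrightarrow> c N x * cl N (f x)"
        using AEZ
      proof eventually_elim
        case (elim x)
        show ?case
          by (intro tendsto_mult tendsto_const continuous_on_tendsto_compose[OF c_cont(2) glim[OF elim]]) auto
      qed
    qed measurable
  qed
  show ?thesis
  proof (rule L2_shift_continuous_limit[OF _ stage1 f])
    show "sq_integrable (\<lambda>x. c k x * cl k (f x))" for k
      by (rule sq_integrable_bounded_support[where C="real k" and R="real k"]) (use bnd c1 in auto)
    show "(\<lambda>k. L2_norm (\<lambda>x. c k x * cl k (f x) - f x)) \<longlonglongrightarrow> 0"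
    proof (rule L2_tendsto_dominated)
      show "sq_integrable (\<lambda>x. 2 *\<^sub>R f x)" using f by (rule sq_integrable_scaleR)
      show "AE x in lborel. norm (c k x * cl k (f x) - f x) \<le> norm (2 *\<^sub>R f x)" (is "AE x in _. ?P x") for k
      proof (rule AE_I2)
        fix x show "?P x"
          using bnd(2)[of k x "f x"] by auto
      qed
      have "(\<lambda>k. c k x * cl k (f x)) \<longlonglongrightarrow> f x" for x
      proof (rule tendsto_eventually)
        have "\<forall>\<^sub>F k in sequentially. real k \<ge> \<bar>x\<bar> + 1 + \<bar>f x\<bar>"
          using filterlim_real_sequentially unfolding filterlim_at_top by blast
        then show "\<forall>\<^sub>F k in sequentially. c k x * cl k (f x) = f x"
          by eventually_elim (auto simp: c_def cl_def min_def max_def)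
      qed
      then show "AE x in lborel. (\<lambda>k. c k x * cl k (f x)) \<longlonglongrightarrow> f x" by simp
    qed measurable
  qed
qed

lemma L2_shift_continuous_complex:
  fixes f :: "real \<Rightarrow> complex"
  assumes f: "sq_integrable f"
  shows "L2_shift_continuous f"
  unfolding L2_shift_continuous_def
proof (intro allI impI)
  fix h :: "nat \<Rightarrow> real" assume h: "h \<longlonglongrightarrow> 0"
  note [measurable] = f[THEN sq_integrable_measurable]
  have r: "sq_integrable (\<lambda>x. Re (f x))"
    by (rule sq_integrable_bound[OF f]) (auto intro: abs_Re_le_cmod)
  have i: "sq_integrable (\<lambda>x. Im (f x))"
    by (rule sq_integrable_bound[OF f]) (auto intro: abs_Im_le_cmod)
  have ri: "sq_integrable (\<lambda>x. Re (f (x + h n)) - Re (f x))" "sq_integrable (\<lambda>x. Im (f (x + h n)) - Im (f x))" for n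
    using r i by (auto intro: sq_integrable_diff sq_integrable_shift[where f="\<lambda>x. Re (f x)"] sq_integrable_shift[where f="\<lambda>x. Im (f x)"])
  have "(L2_norm (\<lambda>x. f (x + h n) - f x))\<^sup>2 =
      (L2_norm (\<lambda>x. Re (f (x + h n)) - Re (f x)))\<^sup>2 + (L2_norm (\<lambda>x. Im (f (x + h n)) - Im (f x)))\<^sup>2" for n
    unfolding L2_norm_sq cmod_power2
    using ri by (subst Bochner_Integration.integral_add[symmetric]) (auto simp: sq_integrable_def)
  then have eq: "L2_norm (\<lambda>x. f (x + h n) - f x) =
      sqrt ((L2_norm (\<lambda>x. Re (f (x + h n)) - Re (f x)))\<^sup>2 + (L2_norm (\<lambda>x. Im (f (x + h n)) - Im (f x)))\<^sup>2)" for n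
    by (metis L2_norm_nonneg real_sqrt_abs abs_of_nonneg)
  have l: "(\<lambda>n. L2_norm (\<lambda>x. Re (f (x + h n)) - Re (f x))) \<longlonglongrightarrow> 0"
    "(\<lambda>n. L2_norm (\<lambda>x. Im (f (x + h n)) - Im (f x))) \<longlonglongrightarrow> 0"
    using L2_shift_continuous_real[OF r] L2_shift_continuous_real[OF i] h by (auto simp: L2_shift_continuous_def)
  have "(\<lambda>n. sqrt ((L2_norm (\<lambda>x. Re (f (x + h n)) - Re (f x)))\<^sup>2 + (L2_norm (\<lambda>x. Im (f (x + h n)) - Im (f x)))\<^sup>2))
      \<longlonglongrightarrow> sqrt (0\<^sup>2 + 0\<^sup>2)"
    by (intro tendsto_intros l)
  then show "(\<lambda>n. L2_norm (\<lambda>x. f (x + h n) - f x)) \<longlonglongrightarrow> 0" by (simp add: eq)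
qed

text \<open>The scalar complex form of \<open>fourier_L1\<close>, with the unitary normalisation.
  Complex values are allowed so that polarisation with \<i> is possible and so that the transform
  can be applied again on the frequency side.\<close>

definition ft :: "(real \<Rightarrow> complex) \<Rightarrow> real \<Rightarrow> complex" where
  "ft f \<xi> = (LBINT x. exp (- (\<i> * of_real (\<xi> * x))) * f x) / of_real (sqrt (2 * pi))"

section \<open>Plancherel theorem for integrable square-integrable functions\<close>

lemma borel_measurable_cnj [measurable (raw)]:
  "f \<in> borel_measurable M \<Longrightarrow> (\<lambda>x. cnj (f x)) \<in> borel_measurable M"
  by (rule measurable_compose[where N=borel]) (auto intro: borel_measurable_continuous_onI continuous_intros)

lemma norm_exp_ii_minus [simp]: "norm (exp (- (\<i> * complex_of_real t))) = 1"
  using norm_exp_i_times[of "-t"] by simp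

lemma integrable_exp_mult:
  assumes "integrable lborel f"
  shows "integrable lborel (\<lambda>x. exp (- (\<i> * of_real (\<xi> * x))) * f x)"
  by (rule Bochner_Integration.integrable_bound[OF assms])
     (use borel_measurable_integrable[OF assms] in \<open>auto simp: norm_mult\<close>)

lemma borel_measurable_ft [measurable]:
  assumes [measurable]: "f \<in> borel_measurable lborel"
  shows "ft f \<in> borel_measurable borel"
  unfolding ft_def[abs_def] by measurable

lemma norm_ft_le:
  assumes "integrable lborel f"
  shows "norm (ft f \<xi>) \<le> L1_norm f / sqrt (2 * pi)"
proof -
  have "norm (LBINT x. exp (- (\<i> * of_real (\<xi> * x))) * f x) \<le> L1_norm f"
    unfolding L1_norm_def
    using integral_norm_bound[of lborel "\<lambda>x. exp (- (\<i> * of_real (\<xi> * x))) * f x"] by (simp add: norm_mult)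
  then show ?thesis by (simp add: ft_def norm_divide divide_right_mono)
qed

lemma ft_add:
  "integrable lborel f \<Longrightarrow> integrable lborel g \<Longrightarrow> ft (\<lambda>x. f x + g x) \<xi> = ft f \<xi> + ft g \<xi>"
  by (simp add: ft_def distrib_left integrable_exp_mult add_divide_distrib del: of_real_mult)

lemma ft_cmult: "ft (\<lambda>x. c * f x) \<xi> = c * ft f \<xi>"
  by (simp add: ft_def mult.left_commute[of _ c])

text \<open>The oscillating factors have modulus one, so absolute convergence of the double
  integrals reduces to that of the product \<open>f x * g y\<close>.\<close>

lemma integrable_pair_kernel:
  fixes k :: "real \<Rightarrow> real \<Rightarrow> complex"
  assumes f: "integrable lborel f" and g: "integrable lborel g"
    and k [measurable]: "(\<lambda>(x, y). k x y) \<in> borel_measurable (borel \<Otimes>\<^sub>M borel)"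
    and k1: "\<And>x y. norm (k x y) \<le> 1"
  shows "integrable (lborel \<Otimes>\<^sub>M lborel) (\<lambda>(x, y). k x y * (f x * g y))"
proof -
  note [measurable] = borel_measurable_integrable[OF f] borel_measurable_integrable[OF g]
  have "integrable (lborel \<Otimes>\<^sub>M lborel) (\<lambda>(x, y). f x * g y)"
  proof (rule lborel_pair.Fubini_integrable)
    show "integrable lborel (\<lambda>x. LBINT y. norm (case (x, y) of (x, y) \<Rightarrow> f x * g y))"
      using f by (simp add: norm_mult)
    show "AE x in lborel. integrable lborel (\<lambda>y. case (x, y) of (x, y) \<Rightarrow> f x * g y)"
      using g by simp
  qed measurable
  then show ?thesis
  proof (rule Bochner_Integration.integrable_bound)
    show "AE x in lborel \<Otimes>\<^sub>M lborel. norm (case x of (x, y) \<Rightarrow> k x y * (f x * g y)) \<le> norm (case x of (x, y) \<Rightarrow> f x * g y)"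
    proof (rule AE_I2, clarify)
      fix a b
      show "norm (k a b * (f a * g b)) \<le> norm (f a * g b)"
        using mult_right_mono[OF k1[of a b] norm_ge_zero[of "f a * g b"]] by (simp add: norm_mult)
    qed
    have "(\<lambda>(x, y). k x y) \<in> borel_measurable (lborel \<Otimes>\<^sub>M lborel)"
      using k by (simp cong: measurable_cong_sets)
    then show "(\<lambda>(x, y). k x y * (f x * g y)) \<in> borel_measurable (lborel \<Otimes>\<^sub>M lborel)"
      unfolding split_beta' by measurable
  qed
qed

lemma Fubini_kernel:
  fixes k :: "real \<Rightarrow> real \<Rightarrow> complex"
  assumes "integrable lborel f" "integrable lborel g"
    "(\<lambda>(x, y). k x y) \<in> borel_measurable (borel \<Otimes>\<^sub>M borel)" "\<And>x y. norm (k x y) \<le> 1"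
  shows "(LBINT y. LBINT x. k x y * (f x * g y)) = (LBINT x. LBINT y. k x y * (f x * g y))"
  by (rule lborel_pair.Fubini_integral) (rule integrable_pair_kernel[OF assms])

lemma ft_multiplication:
  assumes "integrable lborel f" "integrable lborel g"
  shows "(LBINT x. ft f x * g x) = (LBINT x. f x * ft g x)"
proof -
  have "(LBINT x. LBINT y. exp (- (\<i> * of_real (x * y))) * (g x * f y)) =
     (LBINT y. LBINT x. exp (- (\<i> * of_real (x * y))) * (g x * f y))"
    by (rule Fubini_kernel[symmetric]) (use assms in auto)
  then show ?thesis
    by (simp add: ft_def mult_ac flip: integral_mult_right_zero integral_mult_left_zero)
qed

text \<open>This is the characteristic function of the standard normal distribution, with the factor
  1 / sqrt (2 pi) of the density cleared.\<close>

lemma gaussian_fourier: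
  "(LBINT x. exp (\<i> * of_real (t * x)) * of_real (exp (- x\<^sup>2 / 2))) = of_real (sqrt (2 * pi) * exp (- t\<^sup>2 / 2))"
proof -
  have "char std_normal_distribution t = (LBINT x. std_normal_density x *\<^sub>R exp (\<i> * of_real (t * x)))"
    unfolding char_def by (subst integral_density) auto
  then have "(LBINT x. std_normal_density x *\<^sub>R exp (\<i> * of_real (t * x))) = of_real (exp (- t\<^sup>2 / 2))"
    by (simp add: char_std_normal_distribution)
  also have "(LBINT x. std_normal_density x *\<^sub>R exp (\<i> * of_real (t * x))) =
     (LBINT x. (exp (\<i> * of_real (t * x)) * of_real (exp (- x\<^sup>2 / 2))) / of_real (sqrt (2 * pi)))"
    by (intro Bochner_Integration.integral_cong) (auto simp: std_normal_density_def scaleR_conv_of_real)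
  finally show ?thesis by (simp add: field_simps)
qed

lemma gaussian_fourier_scaled:
  assumes "0 < (e::real)"
  shows "(LBINT x. exp (\<i> * of_real (t * x)) * of_real (exp (- (e * x)\<^sup>2 / 2)))
    = of_real (sqrt (2 * pi) / e * exp (- (t / e)\<^sup>2 / 2))"
proof -
  have "(LBINT x. exp (\<i> * of_real (t * x)) * of_real (exp (- (e * x)\<^sup>2 / 2)))
     = \<bar>1/e\<bar> *\<^sub>R (LBINT x. exp (\<i> * of_real (t * (0 + (1/e) * x))) * of_real (exp (- (e * (0 + (1/e) * x))\<^sup>2 / 2)))"
    by (rule lborel_integral_real_affine) (use assms in auto)
  also have "\<dots> = (1/e) *\<^sub>R (LBINT x. exp (\<i> * of_real ((t / e) * x)) * of_real (exp (- x\<^sup>2 / 2)))"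
    using assms by simp
  finally show ?thesis
    by (simp only: gaussian_fourier) (simp add: scaleR_conv_of_real)
qed

lemma integrable_gaussian: "integrable lborel (\<lambda>x::real. exp (- x\<^sup>2 / 2))"
  using integrable_mult_right[OF integrable_std_normal_moment[of 0], of "sqrt (2 * pi)"]
  by (simp add: std_normal_density_def)

lemma integrable_gaussian_scaled:
  assumes "0 < (e::real)" shows "integrable lborel (\<lambda>x::real. exp (- (e * x)\<^sup>2 / 2))"
  using lborel_integrable_real_affine[OF integrable_gaussian, of e 0] assms by simp

lemma integral_gaussian_normalized:
  "(LBINT z. exp (- z\<^sup>2 / 2) / sqrt (2 * pi)) = 1"
  using integral_std_normal_moment_even[of 0]
  by (simp add: std_normal_density_def del: Bochner_Integration.integral_divide_zero integral_divide_zero)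

text \<open>The Gaussian damping makes the frequency integral absolutely convergent, so the
  transforms can be unfolded and the order of integration exchanged. The integral over \<xi> is then
  a Gaussian in (y - x) / e, that is, an approximate identity, and what remains is a Gaussian
  average of the autocorrelation of \<open>f\<close> at the shifts \<open>e * z\<close>.\<close>

lemma Plancherel_regularized:
  assumes f: "integrable lborel f" and f2: "sq_integrable f" and e: "0 < (e::real)"
  shows "(LBINT \<xi>. of_real (exp (- (e * \<xi>)\<^sup>2 / 2)) * (ft f \<xi> * cnj (ft f \<xi>)))
    = (LBINT z. of_real (exp (- z\<^sup>2 / 2) / sqrt (2 * pi)) * (LBINT y. cnj (f y) * f (y + e * z)))"
    (is "?L = ?R")
proof -
  define G where "G \<xi> = complex_of_real (exp (- (e * \<xi>)\<^sup>2 / 2))" for \<xi>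
  define c where "c = complex_of_real (sqrt (2 * pi))"
  have c0: "c \<noteq> 0" by (simp add: c_def)
  note [measurable] = borel_measurable_integrable[OF f]
  have [measurable]: "G \<in> borel_measurable borel" unfolding G_def by measurable
  have G: "integrable lborel G" unfolding G_def
    using integrable_gaussian_scaled[OF e] by (rule integrable_of_real)
  have fc: "integrable lborel (\<lambda>x. cnj (f x))" using f by simp
  have Gf: "integrable lborel (\<lambda>\<xi>. G \<xi> * ft f \<xi>)"
  proof (rule Bochner_Integration.integrable_bound)
    show "integrable lborel (\<lambda>\<xi>. of_real (L1_norm f / sqrt (2 * pi)) * G \<xi>)" using G by simp
    show "AE x in lborel. norm (G x * ft f x) \<le> norm (of_real (L1_norm f / sqrt (2 * pi)) * G x)" (is "AE x in _. ?P x")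
    proof (rule AE_I2)
      fix x
      have "norm (ft f x) \<le> norm (complex_of_real (L1_norm f / sqrt (2 * pi)))"
        using norm_ft_le[OF f, of x] unfolding norm_of_real by linarith
      from mult_right_mono[OF this norm_ge_zero[of "G x"]]
      show "?P x"
        by (simp only: norm_mult mult.commute)
    qed
  qed measurable
  have cnjft: "cnj (ft f \<xi>) = (LBINT y. exp (\<i> * of_real (\<xi> * y)) * cnj (f y)) / c" for \<xi>
  proof -
    have "cnj (ft f \<xi>) = (LBINT y. cnj (exp (- (\<i> * of_real (\<xi> * y))) * f y)) / c"
      by (simp only: ft_def c_def complex_cnj_divide complex_cnj_complex_of_real
          Bochner_Integration.integral_cnj[where f="\<lambda>y. exp (- (\<i> * of_real (\<xi> * y))) * f y"])
    also have "(LBINT y. cnj (exp (- (\<i> * of_real (\<xi> * y))) * f y)) = (LBINT y. exp (\<i> * of_real (\<xi> * y)) * cnj (f y))"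
      by (intro Bochner_Integration.integral_cong) (simp_all add: exp_cnj)
    finally show ?thesis .
  qed
  have "?L = (LBINT \<xi>. LBINT y. exp (\<i> * of_real (\<xi> * y)) * ((G \<xi> * ft f \<xi>) * cnj (f y))) / c"
  proof -
    have "(LBINT y. exp (\<i> * of_real (\<xi> * y)) * ((G \<xi> * ft f \<xi>) * cnj (f y)))
      = (G \<xi> * ft f \<xi>) * (LBINT y. exp (\<i> * of_real (\<xi> * y)) * cnj (f y))" for \<xi>
      by (subst integral_mult_right_zero[symmetric]) (simp add: mult_ac)
    then show ?thesis by (simp add: cnjft G_def mult_ac)
  qed
  also have "(LBINT \<xi>. LBINT y. exp (\<i> * of_real (\<xi> * y)) * ((G \<xi> * ft f \<xi>) * cnj (f y)))
     = (LBINT y. LBINT \<xi>. exp (\<i> * of_real (\<xi> * y)) * ((G \<xi> * ft f \<xi>) * cnj (f y)))"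
    by (rule Fubini_kernel[symmetric]) (use Gf fc in auto)
  also have "\<dots> = (LBINT y. cnj (f y) * (LBINT \<xi>. exp (\<i> * of_real (\<xi> * y)) * (G \<xi> * ft f \<xi>)))"
    by (simp add: mult_ac flip: integral_mult_right_zero)
  also have "(\<lambda>y. LBINT \<xi>. exp (\<i> * of_real (\<xi> * y)) * (G \<xi> * ft f \<xi>))
      = (\<lambda>y. (LBINT z. of_real (exp (- z\<^sup>2 / 2)) * f (y + e * z)))"
  proof
    fix y
    have "(LBINT \<xi>. exp (\<i> * of_real (\<xi> * y)) * (G \<xi> * ft f \<xi>))
       = (LBINT \<xi>. LBINT x. exp (\<i> * of_real (\<xi> * (y - x))) * (G \<xi> * f x)) / c"
    proof -
      have ex: "exp (\<i> * of_real (\<xi> * (y - x))) = exp (\<i> * of_real (\<xi> * y)) * exp (- (\<i> * of_real (\<xi> * x)))" for \<xi> x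
        by (simp add: algebra_simps flip: exp_add)
      have "(LBINT x. exp (\<i> * of_real (\<xi> * (y - x))) * (G \<xi> * f x))
        = exp (\<i> * of_real (\<xi> * y)) * G \<xi> * (LBINT x. exp (- (\<i> * of_real (\<xi> * x))) * f x)" for \<xi>
        unfolding ex by (subst integral_mult_right_zero[symmetric]) (simp add: mult_ac)
      then show ?thesis by (simp only: ft_def c_def times_divide_eq_right integral_divide_zero mult.assoc)
    qed
    also have "(LBINT \<xi>. LBINT x. exp (\<i> * of_real (\<xi> * (y - x))) * (G \<xi> * f x))
       = (LBINT x. LBINT \<xi>. exp (\<i> * of_real (\<xi> * (y - x))) * (G \<xi> * f x))"
      by (rule Fubini_kernel[symmetric]) (use G f in auto)
    also have "\<dots> = (LBINT x. f x * (LBINT \<xi>. exp (\<i> * of_real ((y - x) * \<xi>)) * G \<xi>))"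
      by (simp add: mult_ac flip: integral_mult_right_zero)
    also have "\<dots> = (LBINT x. f x * (c * of_real (1 / e * exp (- ((y - x) / e)\<^sup>2 / 2))))"
      unfolding G_def gaussian_fourier_scaled[OF e] by (simp add: c_def)
    \<comment> \<open>Substituting x = y + e z, the Jacobian cancels the factor 1 / e and the
      Gaussian no longer depends on \<open>e\<close>.\<close>
    also have "\<dots> = \<bar>e\<bar> *\<^sub>R (LBINT z. f (y + e * z) * (c * of_real (1 / e * exp (- ((y - (y + e * z)) / e)\<^sup>2 / 2))))"
      by (rule lborel_integral_real_affine) (use e in simp)
    also have "\<dots> = (LBINT z. c * (of_real (exp (- z\<^sup>2 / 2)) * f (y + e * z)))"
      unfolding integral_scaleR_right[symmetric]
      by (intro Bochner_Integration.integral_cong) (use e in \<open>simp_all add: scaleR_conv_of_real\<close>)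
    also have "\<dots> = c * (LBINT z. of_real (exp (- z\<^sup>2 / 2)) * f (y + e * z))"
      by simp
    finally show "(LBINT \<xi>. exp (\<i> * of_real (\<xi> * y)) * (G \<xi> * ft f \<xi>))
       = (LBINT z. of_real (exp (- z\<^sup>2 / 2)) * f (y + e * z))"
      using c0 by simp
  qed
  also have "(LBINT y. cnj (f y) * (LBINT z. of_real (exp (- z\<^sup>2 / 2)) * f (y + e * z)))
     = (LBINT y. LBINT z. of_real (exp (- z\<^sup>2 / 2)) * (cnj (f y) * f (y + e * z)))"
    by (simp add: mult_ac flip: integral_mult_right_zero)
  \<comment> \<open>The integrand is not a bounded kernel times a product f(z) g(y), so absolute
    convergence is checked directly: Cauchy-Schwarz and translation invariance bound the integral
    over \<open>y\<close> by \<open>(L2_norm f)\<^sup>2\<close>, uniformly in \<open>z\<close>, and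
    the Gaussian is integrable.\<close>
  also have "\<dots> = (LBINT z. LBINT y. of_real (exp (- z\<^sup>2 / 2)) * (cnj (f y) * f (y + e * z)))"
  proof (rule lborel_pair.Fubini_integral, rule lborel_pair.Fubini_integrable)
    show m: "(\<lambda>(z, y). of_real (exp (- z\<^sup>2 / 2)) * (cnj (f y) * f (y + e * z))) \<in> borel_measurable (lborel \<Otimes>\<^sub>M lborel)"
      by measurable
    have ii: "integrable lborel (\<lambda>y. norm (f y) * norm (f (y + e * z)))" for z
      by (rule integrable_norm_mult_norm[OF f2 sq_integrable_shift[OF f2]])
    have i: "integrable lborel (\<lambda>y. cnj (f y) * f (y + e * z))" for z
      using ii[of z] by (rule Bochner_Integration.integrable_bound) (auto simp: norm_mult)
    show "AE z in lborel. integrable lborel (\<lambda>y. case (z, y) of (z, y) \<Rightarrow> of_real (exp (- z\<^sup>2 / 2)) * (cnj (f y) * f (y + e * z)))"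
      using i by simp
    show "integrable lborel (\<lambda>z. LBINT y. norm (case (z, y) of (z, y) \<Rightarrow> of_real (exp (- z\<^sup>2 / 2)) * (cnj (f y) * f (y + e * z))))"
    proof (rule Bochner_Integration.integrable_bound)
      show "integrable lborel (\<lambda>z. (L2_norm f)\<^sup>2 * exp (- z\<^sup>2 / 2))"
        using integrable_gaussian by simp
      show "AE z in lborel. norm (LBINT y. norm (case (z, y) of (z, y) \<Rightarrow> of_real (exp (- z\<^sup>2 / 2)) * (cnj (f y) * f (y + e * z))))
         \<le> norm ((L2_norm f)\<^sup>2 * exp (- z\<^sup>2 / 2))" (is "AE x in _. ?P x")
      proof (rule AE_I2)
        fix z
        have "(LBINT y. norm (f y) * norm (f (y + e * z))) \<le> (L2_norm f)\<^sup>2"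
          using L2_Cauchy_Schwarz[OF f2 sq_integrable_shift[OF f2]] by (simp add: L2_norm_shift power2_eq_square)
        from mult_left_mono[OF this, of "exp (- z\<^sup>2 / 2)"]
        show "?P z"
          by (simp add: norm_mult mult.commute)
      qed
    qed measurable
  qed
  also have "\<dots> / c = ?R"
    by (simp add: c_def)
  finally show ?thesis .
qed

text \<open>Continuity of translations enters here: the autocorrelation is continuous at shift 0,
  where its value is the squared norm.\<close>

lemma autocorrelation_tendsto:
  fixes f :: "real \<Rightarrow> complex"
  assumes f: "sq_integrable f" and h: "h \<longlonglongrightarrow> 0"
  shows "(\<lambda>n. LBINT y. cnj (f y) * f (y + h n)) \<longlonglongrightarrow> of_real ((L2_norm f)\<^sup>2)"
proof -
  have fc: "sq_integrable (\<lambda>y. cnj (f y))"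
    by (rule sq_integrable_bound[OF f])
       (use sq_integrable_measurable[OF f] in \<open>auto intro: borel_measurable_cnj\<close>)
  have "(\<lambda>n. LBINT y. f (y + h n) * cnj (f y)) \<longlonglongrightarrow> (LBINT y. f y * cnj (f y))"
    using L2_shift_continuous_complex[OF f] h
    by (intro L2_tendsto_inner sq_integrable_shift f fc) (simp add: L2_shift_continuous_def)
  also have "(LBINT y. f y * cnj (f y)) = of_real ((L2_norm f)\<^sup>2)"
    unfolding L2_norm_sq complex_norm_square by (simp add: complex_norm_square[symmetric] del: of_real_power)
  finally show ?thesis by (simp add: mult.commute)
qed

text \<open>The regularised identity is taken along e = 1 / (n + 1). The autocorrelation side
  converges by domination. The frequency side increases with \<open>n\<close>, so monotone
  convergence yields both the square-integrability of \<open>ft f\<close> and the value of its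
  norm.\<close>

theorem Plancherel_L1_L2:
  assumes f: "integrable lborel f" and f2: "sq_integrable f"
  shows "sq_integrable (ft f)" "L2_norm (ft f) = L2_norm f"
proof -
  define e where "e n = 1 / real (Suc n)" for n
  have [measurable]: "f \<in> borel_measurable borel"
    using borel_measurable_integrable[OF f] by simp
  have e0: "0 < e n" for n by (simp add: e_def)
  have elim: "e \<longlonglongrightarrow> 0" unfolding e_def using LIMSEQ_Suc[OF lim_1_over_n] by simp
  define u where "u n \<xi> = exp (- (e n * \<xi>)\<^sup>2 / 2) * (norm (ft f \<xi>))\<^sup>2" for n \<xi>
  have u_int: "integrable lborel (u n)" for n
  proof (rule Bochner_Integration.integrable_bound)
    show "integrable lborel (\<lambda>\<xi>. (L1_norm f / sqrt (2 * pi))\<^sup>2 * exp (- (e n * \<xi>)\<^sup>2 / 2))"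
      using integrable_gaussian_scaled[OF e0] by simp
    show "AE x in lborel. norm (u n x) \<le> norm ((L1_norm f / sqrt (2 * pi))\<^sup>2 * exp (- (e n * x)\<^sup>2 / 2))"
      using power_mono[OF norm_ft_le[OF f] norm_ge_zero, of _ 2]
      by (auto intro!: AE_I2 simp: u_def abs_mult mult.commute[of "exp _"] mult_right_mono)
  qed (unfold u_def, measurable)
  have u_val: "of_real (integral\<^sup>L lborel (u n)) =
    (LBINT z. of_real (exp (- z\<^sup>2 / 2) / sqrt (2 * pi)) * (LBINT y. cnj (f y) * f (y + e n * z)))" for n
    unfolding Plancherel_regularized[OF f f2 e0, symmetric] u_def
    by (simp add: complex_norm_square del: of_real_power flip: integral_complex_of_real)
  have "(\<lambda>n. LBINT z. of_real (exp (- z\<^sup>2 / 2) / sqrt (2 * pi)) * (LBINT y. cnj (f y) * f (y + e n * z)))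
    \<longlonglongrightarrow> (LBINT z. of_real (exp (- z\<^sup>2 / 2) / sqrt (2 * pi)) * of_real ((L2_norm f)\<^sup>2) :: complex)"
  proof (rule integral_dominated_convergence)
    show "integrable lborel (\<lambda>z. (exp (- z\<^sup>2 / 2) / sqrt (2 * pi)) * (L2_norm f)\<^sup>2)"
      using integrable_gaussian by simp
    show "AE z in lborel. (\<lambda>n. of_real (exp (- z\<^sup>2 / 2) / sqrt (2 * pi)) * (LBINT y. cnj (f y) * f (y + e n * z)))
      \<longlonglongrightarrow> (of_real (exp (- z\<^sup>2 / 2) / sqrt (2 * pi)) * of_real ((L2_norm f)\<^sup>2) :: complex)"
      by (intro AE_I2 tendsto_mult_left autocorrelation_tendsto[OF f2] tendsto_mult_left_zero elim)
    show "AE z in lborel. norm (of_real (exp (- z\<^sup>2 / 2) / sqrt (2 * pi)) * (LBINT y. cnj (f y) * f (y + e n * z)))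
      \<le> (exp (- z\<^sup>2 / 2) / sqrt (2 * pi)) * (L2_norm f)\<^sup>2" (is "AE x in _. ?P x") for n
    proof (rule AE_I2)
      fix z
      have "norm (LBINT y. cnj (f y) * f (y + e n * z)) \<le> (LBINT y. norm (f y) * norm (f (y + e n * z)))"
        using integral_norm_bound[of lborel "\<lambda>y. cnj (f y) * f (y + e n * z)"] by (simp add: norm_mult)
      also have "\<dots> \<le> (L2_norm f)\<^sup>2"
        using L2_Cauchy_Schwarz[OF f2 sq_integrable_shift[OF f2]] by (simp add: L2_norm_shift power2_eq_square)
      finally have "norm (LBINT y. cnj (f y) * f (y + e n * z)) \<le> (L2_norm f)\<^sup>2" .
      from mult_left_mono[OF this, of "exp (- z\<^sup>2 / 2) / sqrt (2 * pi)"]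
      show "?P z"
        unfolding norm_mult norm_of_real by simp
    qed
  qed measurable
  also have "(LBINT z. of_real (exp (- z\<^sup>2 / 2) / sqrt (2 * pi)) * of_real ((L2_norm f)\<^sup>2) :: complex)
     = of_real ((LBINT z. exp (- z\<^sup>2 / 2) / sqrt (2 * pi)) * (L2_norm f)\<^sup>2)"
    unfolding of_real_mult[symmetric] integral_complex_of_real integral_mult_left_zero ..
  finally have "(\<lambda>n. complex_of_real (integral\<^sup>L lborel (u n))) \<longlonglongrightarrow> of_real ((L2_norm f)\<^sup>2)"
    by (simp only: u_val integral_gaussian_normalized mult_1)
  then have lim: "(\<lambda>n. integral\<^sup>L lborel (u n)) \<longlonglongrightarrow> (L2_norm f)\<^sup>2"
    by (simp only: tendsto_of_real_iff)
  have mono: "mono (\<lambda>n. u n \<xi>)" for \<xi>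
  proof (rule monoI)
    fix m n :: nat assume "m \<le> n"
    then have "e n \<le> e m" by (auto simp: e_def field_simps)
    then have "(e n)\<^sup>2 * \<xi>\<^sup>2 \<le> (e m)\<^sup>2 * \<xi>\<^sup>2" using e0[of n] by (intro mult_right_mono power_mono) auto
    then show "u m \<xi> \<le> u n \<xi>"
      unfolding u_def by (intro mult_right_mono) (auto simp: power_mult_distrib)
  qed
  have ulim: "(\<lambda>n. u n \<xi>) \<longlonglongrightarrow> (norm (ft f \<xi>))\<^sup>2" for \<xi>
  proof -
    have "(\<lambda>n. u n \<xi>) \<longlonglongrightarrow> exp (- (0 * \<xi>)\<^sup>2 / 2) * (norm (ft f \<xi>))\<^sup>2"
      unfolding u_def by (intro tendsto_intros elim) auto
    then show ?thesis by simp
  qed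
  have u0: "0 \<le> u n \<xi>" for n \<xi> by (simp add: u_def)
  have "integrable lborel (\<lambda>\<xi>. (norm (ft f \<xi>))\<^sup>2)" and val: "(LBINT \<xi>. (norm (ft f \<xi>))\<^sup>2) = (L2_norm f)\<^sup>2"
    by (rule integral_monotone_convergence_nonneg[OF u_int AE_I2[OF mono] AE_I2[OF u0] AE_I2[OF ulim] lim], measurable)+
  then show "sq_integrable (ft f)" by (simp add: sq_integrable_def)
  show "L2_norm (ft f) = L2_norm f" unfolding L2_norm_def[of "ft f"] val by simp
qed

lemma integrable_mult_cnj:
  fixes f g :: "real \<Rightarrow> complex"
  assumes "sq_integrable f" "sq_integrable g"
  shows "integrable lborel (\<lambda>x. f x * cnj (g x))"
  using assms[THEN sq_integrable_measurable]
  by (intro Bochner_Integration.integrable_bound[OF integrable_norm_mult_norm[OF assms]]) (auto simp: norm_mult)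

lemma L2_polarization:
  fixes f g :: "real \<Rightarrow> complex"
  assumes f: "sq_integrable f" and g: "sq_integrable g"
  shows "4 * (LBINT x. f x * cnj (g x)) =
    of_real ((L2_norm (\<lambda>x. f x + g x))\<^sup>2) - of_real ((L2_norm (\<lambda>x. f x - g x))\<^sup>2)
    + \<i> * of_real ((L2_norm (\<lambda>x. f x + \<i> * g x))\<^sup>2) - \<i> * of_real ((L2_norm (\<lambda>x. f x - \<i> * g x))\<^sup>2)"
proof -
  have sq: "complex_of_real ((L2_norm u)\<^sup>2) = (LBINT x. u x * cnj (u x))" for u :: "real \<Rightarrow> complex"
    unfolding L2_norm_sq by (simp add: complex_norm_square[symmetric] del: of_real_power)
  note ints = integrable_mult_cnj[OF f f] integrable_mult_cnj[OF g g]
    integrable_mult_cnj[OF f g] integrable_mult_cnj[OF g f]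
  show ?thesis unfolding sq using ints by (simp add: algebra_simps)
qed

text \<open>Equality of norms for \<open>f + c * g\<close> with c = 1, -1, \<i>, -\<i> determines
  the inner product by polarisation.\<close>

theorem Parseval_L1_L2:
  assumes f: "integrable lborel f" "sq_integrable f" and g: "integrable lborel g" "sq_integrable g"
  shows "(LBINT x. ft f x * cnj (ft g x)) = (LBINT x. f x * cnj (g x))"
proof -
  have P: "L2_norm (\<lambda>x. ft f x + c * ft g x) = L2_norm (\<lambda>x. f x + c * g x)" for c
  proof -
    have "ft (\<lambda>x. f x + c * g x) = (\<lambda>x. ft f x + c * ft g x)"
      using f g by (simp add: fun_eq_iff ft_add ft_cmult)
    with Plancherel_L1_L2(2)[of "\<lambda>x. f x + c * g x"] f g show ?thesis
      by (simp add: sq_integrable_add sq_integrable_cmult)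
  qed
  have "4 * (LBINT x. ft f x * cnj (ft g x)) = 4 * (LBINT x. f x * cnj (g x))"
    unfolding L2_polarization[OF f(2) g(2)] L2_polarization[OF Plancherel_L1_L2(1)[OF f] Plancherel_L1_L2(1)[OF g]]
    using P[of 1] P[of "-1"] P[of \<i>] P[of "-\<i>"] by simp
  then show ?thesis by simp
qed

section \<open>Test functions\<close>

text \<open>The classical function exp (-c / x), extended by 0, with a polynomial in 1 / x in front:
  with this factor the family is closed under differentiation, so smoothness is an induction on a
  single derivative formula.\<close>

definition exp_recip :: "real \<Rightarrow> real poly \<Rightarrow> real \<Rightarrow> real" where
  "exp_recip c p x = (if 0 < x then poly p (1 / x) * exp (- c / x) else 0)"

text \<open>Half of the exponent absorbs the new factor \<open>y\<close>, the other half is left to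
  the remaining polynomial; hence the induction varies \<open>c\<close>.\<close>

lemma poly_exp_tendsto_0:
  assumes "0 < (c::real)"
  shows "((\<lambda>y. poly p y * exp (- c * y)) \<longlongrightarrow> 0) at_top"
  using assms
proof (induction p arbitrary: c)
  case 0
  then show ?case by simp
next
  case (pCons a p)
  then have c: "0 < c" by simp
  have "((\<lambda>y. a * exp (- c * y) + (y * exp (- (c/2) * y)) * (poly p y * exp (- (c/2) * y))) \<longlongrightarrow> a * 0 + 0 * 0) at_top"
  proof (intro tendsto_add tendsto_mult tendsto_const)
    show "((\<lambda>y. exp (- c * y)) \<longlongrightarrow> 0) at_top" using c by real_asymp
    show "((\<lambda>y. y * exp (- (c/2) * y)) \<longlongrightarrow> 0) at_top" using c by real_asymp
    show "((\<lambda>y. poly p y * exp (- (c/2) * y)) \<longlongrightarrow> 0) at_top" using c by (intro pCons.IH) simp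
  qed
  moreover have "exp (- c * y) = exp (- (c/2) * y) * exp (- (c/2) * y)" for y :: real
    by (simp flip: exp_add)
  ultimately show ?case by (simp add: algebra_simps)
qed

lemma exp_recip_tendsto_0:
  assumes "0 < c"
  shows "((\<lambda>x. exp_recip c p x) \<longlongrightarrow> 0) (at 0)"
proof -
  have "((\<lambda>x. poly p (inverse x) * exp (- c * inverse x)) \<longlongrightarrow> 0) (at_right 0)"
    using filterlim_compose[OF poly_exp_tendsto_0[OF assms] filterlim_inverse_at_top_right] .
  then have "((\<lambda>x. exp_recip c p x) \<longlongrightarrow> 0) (at_right 0)"
    by (rule Lim_transform_eventually)
       (auto simp: eventually_at_right_field exp_recip_def divide_inverse intro!: exI[of _ 1])
  moreover have "((\<lambda>x. exp_recip c p x) \<longlongrightarrow> 0) (at_left 0)"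
    by (rule Lim_transform_eventually[OF tendsto_const])
       (auto simp: eventually_at_left_field exp_recip_def intro!: exI[of _ "-1"])
  ultimately show ?thesis by (simp add: filterlim_at_split)
qed

text \<open>With y = 1 / x one has d/dx = -y^2 d/dy; applied to p(y) exp (-c y) this gives y^2 (c p
  - p') exp (-c y).\<close>

definition exp_recip_poly_deriv :: "real \<Rightarrow> real poly \<Rightarrow> real poly" where
  "exp_recip_poly_deriv c p = monom 1 2 * (smult c p - pderiv p)"

lemma exp_recip_has_deriv:
  assumes c: "0 < c"
  shows "(exp_recip c p has_real_derivative exp_recip c (exp_recip_poly_deriv c p) x) (at x)"
proof (cases x "0::real" rule: linorder_cases)
  case less
  then show ?thesis
    using has_field_derivative_transform_within_open[of "\<lambda>_. 0::real" 0 x "{..<0}" "exp_recip c p"]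
    by (simp add: exp_recip_def)
next
  case equal
  \<comment> \<open>At 0 the difference quotient is again a member of the family, with one more
    factor 1 / x, and so it tends to 0.\<close>
  have "((\<lambda>h. exp_recip c (monom 1 1 * p) h) \<longlongrightarrow> 0) (at 0)" by (rule exp_recip_tendsto_0[OF c])
  moreover have "exp_recip c (monom 1 1 * p) h = (exp_recip c p (0 + h) - exp_recip c p 0) / h" for h
    by (auto simp: exp_recip_def poly_monom)
  ultimately show ?thesis using equal
    by (simp add: DERIV_def exp_recip_def)
next
  case greater
  have "((\<lambda>x. poly p (1 / x) * exp (- c / x)) has_real_derivative exp_recip c (exp_recip_poly_deriv c p) x) (at x)"
    using greater
    by (auto intro!: derivative_eq_intros DERIV_chain'[where g="poly p"]
        simp: exp_recip_def exp_recip_poly_deriv_def poly_monom field_simps power2_eq_square)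
  then show ?thesis
    by (rule has_field_derivative_transform_within_open[where S="{0<..}"]) (use greater in \<open>auto simp: exp_recip_def\<close>)
qed

lemma exp_recip_uminus: "exp_recip c (- p) x = - exp_recip c p x"
  by (simp add: exp_recip_def)

text \<open>The invariant for iterated derivatives of \<open>bump\<close>: closed under
  differentiation by the product rule, with scalars and signs absorbed into the polynomials.\<close>

inductive_set bump_span :: "real \<Rightarrow> real \<Rightarrow> real \<Rightarrow> (real \<Rightarrow> real) set" for c a b where
  prod: "(\<lambda>x. exp_recip c p (x - a) * exp_recip c q (b - x)) \<in> bump_span c a b"
| sum: "f \<in> bump_span c a b \<Longrightarrow> g \<in> bump_span c a b \<Longrightarrow> (\<lambda>x. f x + g x) \<in> bump_span c a b"

lemma bump_span_deriv:
  assumes "0 < c" "f \<in> bump_span c a b"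
  shows "\<exists>f'\<in>bump_span c a b. \<forall>x. (f has_real_derivative f' x) (at x)"
  using assms(2)
proof induction
  case (prod p q)
  let ?D = "exp_recip_poly_deriv c"
  have d1: "((\<lambda>x. exp_recip c p (x - a)) has_real_derivative exp_recip c (?D p) (x - a)) (at x)" for x
  proof -
    have "((\<lambda>x. x - a) has_real_derivative 1 - 0) (at x)" by (intro derivative_intros)
    from DERIV_chain'[OF this exp_recip_has_deriv[OF assms(1)], of p] show ?thesis by simp
  qed
  have d2: "((\<lambda>x. exp_recip c q (b - x)) has_real_derivative exp_recip c (- ?D q) (b - x)) (at x)" for x
  proof -
    have "((\<lambda>x. b - x) has_real_derivative 0 - 1) (at x)" by (intro derivative_intros)
    from DERIV_chain'[OF this exp_recip_has_deriv[OF assms(1)], of q] show ?thesis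
      by (simp add: exp_recip_uminus)
  qed
  show ?case
    by (rule bexI[OF _ bump_span.sum[OF bump_span.prod[of c "?D p" a q b] bump_span.prod[of c p a "- ?D q" b]]])
       (auto intro!: derivative_eq_intros d1 d2)
next
  case (sum f g)
  then obtain f' g' where "f' \<in> bump_span c a b" "\<forall>x. (f has_real_derivative f' x) (at x)"
     "g' \<in> bump_span c a b" "\<forall>x. (g has_real_derivative g' x) (at x)" by blast
  then show ?case
    by (intro bexI[of _ "\<lambda>x. f' x + g' x"] bump_span.sum) (auto intro!: derivative_eq_intros)
qed

lemma bump_span_iterated_deriv:
  assumes "0 < c" "f \<in> bump_span c a b"
  shows "(deriv ^^ k) f \<in> bump_span c a b"
proof (induction k)
  case (Suc k)
  then obtain f' where "f' \<in> bump_span c a b" "\<forall>x. ((deriv ^^ k) f has_real_derivative f' x) (at x)"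
    using bump_span_deriv[OF assms(1)] by blast
  then have "(deriv ^^ Suc k) f = f'" by (auto simp: DERIV_imp_deriv)
  then show ?case using \<open>f' \<in> _\<close> by simp
qed (use assms in simp)

definition bump :: "real \<Rightarrow> real \<Rightarrow> real \<Rightarrow> real \<Rightarrow> real" where
  "bump c a b x = exp_recip c 1 (x - a) * exp_recip c 1 (b - x)"

lemma bump_eq: "bump c a b x = (if a < x \<and> x < b then exp (- c / (x - a)) * exp (- c / (b - x)) else 0)"
  by (auto simp: bump_def exp_recip_def)

lemma test_function_bump:
  assumes "0 < c" shows "test_function (bump c a b)"
  unfolding test_function_def
proof (intro conjI allI)
  fix k x
  have "bump c a b \<in> bump_span c a b"
    unfolding bump_def[abs_def] by (rule bump_span.prod)
  then have "(deriv ^^ k) (bump c a b) \<in> bump_span c a b"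
    by (rule bump_span_iterated_deriv[OF assms])
  then show "(deriv ^^ k) (bump c a b) differentiable at x"
    using bump_span_deriv[OF assms] real_differentiable_def by blast
next
  show "\<exists>R. \<forall>x. \<bar>x\<bar> > R \<longrightarrow> bump c a b x = 0"
    by (rule exI[of _ "max \<bar>a\<bar> \<bar>b\<bar>"]) (auto simp: bump_eq)
qed

lemma deriv_eq_0_outside:
  fixes \<phi> :: "real \<Rightarrow> real"
  assumes "\<And>x. \<bar>x\<bar> > R \<Longrightarrow> \<phi> x = 0" "\<bar>x\<bar> > R"
  shows "deriv \<phi> x = 0"
proof (rule DERIV_imp_deriv)
  have "open {y::real. \<bar>y\<bar> > R}" by (intro open_Collect_less continuous_intros)
  then show "(\<phi> has_real_derivative 0) (at x)"
    by (rule has_field_derivative_transform_within_open[of "\<lambda>_. 0::real" 0 x "{y. \<bar>y\<bar> > R}", rotated])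
       (use assms in auto)
qed

lemma test_function_deriv: 
  assumes "test_function \<phi>" shows "test_function (deriv \<phi>)"
  unfolding test_function_def
proof (intro conjI allI)
  fix k x show "(deriv ^^ k) (deriv \<phi>) differentiable at x"
    using assms unfolding test_function_def
    by (metis funpow_Suc_right o_apply)
next
  obtain R where R: "\<And>x. \<bar>x\<bar> > R \<Longrightarrow> \<phi> x = 0" using assms by (auto simp: test_function_def)
  have "deriv \<phi> x = 0" if "\<bar>x\<bar> > R" for x
    using deriv_eq_0_outside[of R \<phi> x] R that by blast
  then show "\<exists>R. \<forall>x. \<bar>x\<bar> > R \<longrightarrow> deriv \<phi> x = 0" by blast
qed

lemma test_function_iterated_deriv: "test_function \<phi> \<Longrightarrow> test_function ((deriv ^^ k) \<phi>)"
  by (induction k) (auto intro: test_function_deriv)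

lemma test_function_has_deriv: "test_function \<phi> \<Longrightarrow> (\<phi> has_real_derivative deriv \<phi> x) (at x)"
  unfolding test_function_def
  by (metis DERIV_deriv_iff_real_differentiable funpow_0)

lemma test_function_continuous: "test_function \<phi> \<Longrightarrow> continuous_on A \<phi>"
  by (meson DERIV_isCont continuous_at_imp_continuous_on test_function_has_deriv)

lemma test_function_measurable [measurable_dest]: "test_function \<phi> \<Longrightarrow> \<phi> \<in> borel_measurable borel"
  by (intro borel_measurable_continuous_onI test_function_continuous)

lemma test_function_bounds:
  assumes "test_function \<phi>"
  obtains R C where "0 < R" "\<And>x. \<bar>x\<bar> \<ge> R \<Longrightarrow> \<phi> x = 0" "\<And>x. \<bar>\<phi> x\<bar> \<le> C" "0 \<le> C"
proof -
  obtain R where R: "\<And>x. \<bar>x\<bar> > R \<Longrightarrow> \<phi> x = 0" using assms by (auto simp: test_function_def)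
  have "bounded (\<phi> ` {-R..R})"
    by (intro compact_imp_bounded compact_continuous_image test_function_continuous assms) simp
  then obtain C where C: "\<And>x. x \<in> {-R..R} \<Longrightarrow> \<bar>\<phi> x\<bar> \<le> C" unfolding bounded_iff real_norm_def by blast
  show ?thesis
  proof (rule that)
    \<comment> \<open>Enlarging the radius by one makes \<phi> vanish at the endpoints themselves,
      which kills the boundary terms in the later integration by parts.\<close>
    show "0 < \<bar>R\<bar> + 1" by simp
    show "\<phi> x = 0" if "\<bar>x\<bar> \<ge> \<bar>R\<bar> + 1" for x using R[of x] that by linarith
    show "\<bar>\<phi> x\<bar> \<le> max C 0" for x
      using R[of x] C[of x] by (cases "\<bar>x\<bar> \<le> R") (auto simp: abs_le_iff)
  qed simp
qed

lemma test_function_sq_integrable: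
  assumes "test_function \<phi>"
  shows "sq_integrable \<phi>" "integrable lborel \<phi>"
proof -
  obtain R C where R: "\<And>x. \<bar>x\<bar> \<ge> R \<Longrightarrow> \<phi> x = 0" and C: "\<And>x. \<bar>\<phi> x\<bar> \<le> C"
    using test_function_bounds[OF assms] by metis
  show "sq_integrable \<phi>"
    by (rule sq_integrable_bounded_support[where C=C and R=R]) (use assms R C in auto)
  show "integrable lborel \<phi>"
  proof (rule Bochner_Integration.integrable_bound)
    show "integrable lborel (\<lambda>x. C * indicator {-R..R} x)"
      by (intro integrable_mult_right integrable_real_indicator) (auto simp: emeasure_lborel_Icc_eq)
    show "AE x in lborel. norm (\<phi> x) \<le> norm (C * indicator {-R..R} x :: real)"
      using C R by (auto intro!: AE_I2 simp: indicator_def intro: order_trans[OF C abs_ge_self])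
  qed (use assms in auto)
qed

text \<open>The factor \<open>c\<close> in the exponent serves to approximate indicators: the bump increases to the indicator
  of the open interval as \<open>c\<close> tends to \<open>0\<close>, without any normalisation.\<close>

lemma bump_tendsto_indicator:
  "(\<lambda>n. bump (1 / real (Suc n)) a b x) \<longlonglongrightarrow> indicator {a<..<b} x"
proof (cases "a < x \<and> x < b")
  case True
  have L: "(\<lambda>n. - (1 / real (Suc n))) \<longlonglongrightarrow> - 0"
    by (intro tendsto_minus) (use LIMSEQ_Suc[OF lim_1_over_n] in simp)
  have "(\<lambda>n. exp (- (1 / real (Suc n)) / (x - a)) * exp (- (1 / real (Suc n)) / (b - x)))
     \<longlonglongrightarrow> exp (- 0 / (x - a)) * exp (- 0 / (b - x))"
    using True by (intro tendsto_mult tendsto_exp tendsto_divide tendsto_const L) auto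
  then show ?thesis using True by (simp add: bump_eq)
qed (auto simp: bump_eq)

lemma bump_le_indicator: "0 < c \<Longrightarrow> 0 \<le> bump c a b x \<and> bump c a b x \<le> indicator {a<..<b} x"
  by (auto simp: bump_eq mult_le_one divide_nonpos_pos)

section \<open>Functions annihilated by all test functions\<close>

lemma set_integrable_locally:
  assumes "locally_integrable v" "A \<in> sets borel" "A \<subseteq> {-R..R}"
  shows "set_integrable lborel A v"
  using set_integrable_subset[of lborel "{-R..R}" v A] assms by (simp add: locally_integrable_def)

text \<open>Open intervals are stable under intersection and generate the Borel sets, so vanishing
  integrals spread from them to all Borel sets by the pi-lambda argument, and then the density is
  zero.\<close>

lemma density_zero_lborel:
  fixes w :: "real \<Rightarrow> 'a::euclidean_space"
  assumes w: "integrable lborel w" and ivl: "\<And>a b. (LBINT x:{a<..<b}. w x) = 0"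
  shows "AE x in lborel. w x = 0"
proof (rule sigma_finite_measure.density_zero)
  show "sigma_finite_measure (lborel :: real measure)" ..
  show "integrable lborel w" by fact
  have seti: "set_integrable lborel A w" if "A \<in> sets borel" for A
    using w that by (simp add: set_integrable_def integrable_mult_indicator)
  define I :: "real set set" where "I = range (\<lambda>(a, b). {a<..<b})"
  have sets_I: "sigma_sets UNIV I = sets borel"
  proof -
    have "I = range (\<lambda>(a, b). box a b)" by (simp only: I_def box_real)
    then show ?thesis by (simp add: borel_eq_box del: box_real)
  qed
  \<comment> \<open>Needed for complements: the whole line is not an interval of the generator, so
    its integral is a limit over (-n, n).\<close>
  have UNIV0: "(LBINT x:UNIV. w x) = 0"
  proof -
    have "(\<lambda>n. LINT x:{- real n<..<real n}|lborel. w x) \<longlonglongrightarrow> (LINT x:(\<Union>n. {- real n<..<real n})|lborel. w x)"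
      by (rule set_integral_cont_up) (auto intro!: seti simp: incseq_def)
    moreover have "(\<Union>n. {- real n<..<real n}) = UNIV"
    proof -
      have "\<exists>n::nat. x \<in> {- real n<..<real n}" for x :: real
        using reals_Archimedean2[of "\<bar>x\<bar>"] by (metis abs_less_iff greaterThanLessThan_iff minus_less_iff)
      then show ?thesis by blast
    qed
    ultimately show ?thesis by (simp add: ivl LIMSEQ_const_iff)
  qed
  fix A :: "real set" assume "A \<in> sets lborel"
  then have "A \<in> sigma_sets UNIV I"
    by (simp add: sets_I)
  then show "(LBINT x:A. w x) = 0"
  proof (rule sigma_sets_induct_disjoint[rotated 2])
    show "Int_stable I"
    proof -
      have "{a<..<b} \<inter> {c<..<d} = {max a c<..<min b d}" for a b c d :: real by auto
      then show ?thesis unfolding Int_stable_def I_def by auto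
    qed
    show "I \<subseteq> Pow UNIV" by simp
  next
    fix A assume "A \<in> I" then show "(LBINT x:A. w x) = 0" by (auto simp: I_def ivl)
  next
    show "(LBINT x:{}. w x) = 0" by (simp add: set_lebesgue_integral_def)
  next
    fix A assume "A \<in> sigma_sets UNIV I" and A: "(LBINT x:A. w x) = 0"
    then have [measurable]: "A \<in> sets borel"
      by (simp add: sets_I)
    have "(LINT x:A \<union> (UNIV - A)|lborel. w x) = (LBINT x:A. w x) + (LINT x:UNIV - A|lborel. w x)"
      by (rule set_integral_Un) (auto intro!: seti)
    moreover have "A \<union> (UNIV - A) = UNIV" by auto
    ultimately show "(LINT x:UNIV - A|lborel. w x) = 0" using A UNIV0 by simp
  next
    fix A :: "nat \<Rightarrow> real set"
    assume dis: "disjoint_family A" and A: "range A \<subseteq> sigma_sets UNIV I" and 0: "\<And>i. (LINT x:A i|lborel. w x) = 0"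
    then have "A i \<in> sets borel" for i
      by (auto simp: sets_I)
    then show "(LINT x:\<Union>(range A)|lborel. w x) = 0"
      using dis 0 by (subst lebesgue_integral_countable_add) (auto simp: disjoint_family_on_def intro!: seti)
  qed
qed

text \<open>The bumps over (a, b) converge to its indicator as their parameter tends to 0, dominated
  by it, so the integral of \<open>v\<close> over every bounded open interval vanishes.\<close>

theorem du_Bois_Reymond:
  fixes v :: "real \<Rightarrow> 'a::euclidean_space"
  assumes v: "locally_integrable v" and zero: "\<And>\<phi>. test_function \<phi> \<Longrightarrow> (LBINT x. \<phi> x *\<^sub>R v x) = 0"
  shows "AE x in lborel. v x = 0"
proof -
  have ivl: "(LBINT x:{a<..<b}. v x) = 0" for a b
  proof -
    have int: "integrable lborel (\<lambda>x. indicator {a<..<b} x *\<^sub>R v x)"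
      unfolding set_integrable_def[symmetric]
      by (rule set_integrable_locally[OF v, of _ "max \<bar>a\<bar> \<bar>b\<bar>"]) auto
    have "(\<lambda>n. LBINT x. bump (1 / real (Suc n)) a b x *\<^sub>R (indicator {a<..<b} x *\<^sub>R v x))
        \<longlonglongrightarrow> (LBINT x. indicator {a<..<b} x *\<^sub>R (indicator {a<..<b} x *\<^sub>R v x))"
    proof (rule integral_dominated_convergence)
      show "integrable lborel (\<lambda>x. norm (indicator {a<..<b} x *\<^sub>R v x))" using int by (rule integrable_norm)
      show "AE x in lborel. (\<lambda>n. bump (1 / real (Suc n)) a b x *\<^sub>R (indicator {a<..<b} x *\<^sub>R v x)) \<longlonglongrightarrow>
          indicator {a<..<b} x *\<^sub>R (indicator {a<..<b} x *\<^sub>R v x)"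
        by (intro AE_I2 tendsto_scaleR bump_tendsto_indicator tendsto_const)
      show "AE x in lborel. norm (bump (1 / real (Suc n)) a b x *\<^sub>R (indicator {a<..<b} x *\<^sub>R v x))
          \<le> norm (indicator {a<..<b} x *\<^sub>R v x)" (is "AE x in _. ?P x") for n
      proof (rule AE_I2)
        fix x
        have "0 \<le> bump (1 / real (Suc n)) a b x" "bump (1 / real (Suc n)) a b x \<le> 1"
          using bump_le_indicator[of "1 / real (Suc n)" a b x] indicator_le_1[of "{a<..<b}" x]
            order_trans[of "bump (1 / real (Suc n)) a b x" "indicator {a<..<b} x" 1] by simp_all
        then show "?P x"
          using mult_right_mono[of "bump (1 / real (Suc n)) a b x" 1 "norm (indicator {a<..<b} x *\<^sub>R v x)"]
          unfolding norm_scaleR by simp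
      qed
      have [measurable]: "bump (1 / real (Suc n)) a b \<in> borel_measurable borel" for n
        by (intro test_function_measurable test_function_bump) simp
      note [measurable] = borel_measurable_integrable[OF int]
      show "(\<lambda>x. indicator {a<..<b} x *\<^sub>R (indicator {a<..<b} x *\<^sub>R v x)) \<in> borel_measurable lborel"
        by (intro borel_measurable_scaleR borel_measurable_integrable[OF int]) simp
      show "(\<lambda>x. bump (1 / real (Suc n)) a b x *\<^sub>R (indicator {a<..<b} x *\<^sub>R v x)) \<in> borel_measurable lborel" for n
        by (intro borel_measurable_scaleR borel_measurable_integrable[OF int]) measurable
    qed
    moreover have "bump (1 / real (Suc n)) a b x *\<^sub>R (indicator {a<..<b} x *\<^sub>R v x) = bump (1 / real (Suc n)) a b x *\<^sub>R v x" for n x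
      by (auto simp: bump_eq)
    moreover have "indicator {a<..<b} x *\<^sub>R (indicator {a<..<b} x *\<^sub>R v x) = indicator {a<..<b} x *\<^sub>R v x" for x
      by (auto simp: indicator_def)
    moreover have z: "(LBINT x. bump (1 / real (Suc n)) a b x *\<^sub>R v x) = 0" for n
      by (intro zero test_function_bump) simp
    ultimately have "(\<lambda>n. 0::'a) \<longlonglongrightarrow> (LBINT x. indicator {a<..<b} x *\<^sub>R v x)"
      by (simp only: z)
    then show ?thesis by (simp add: set_lebesgue_integral_def LIMSEQ_const_iff)
  qed
  \<comment> \<open>\<open>v\<close> is only locally integrable, whereas the interval criterion is
    stated for integrable functions; hence the localisation to (-N, N), whose intersections with
    open intervals are again open intervals.\<close>
  have "AE x in lborel. indicator {- real N<..<real N} x *\<^sub>R v x = 0" for N :: nat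
  proof (rule density_zero_lborel)
    let ?w = "\<lambda>x. indicator {- real N<..<real N} x *\<^sub>R v x"
    show int: "integrable lborel ?w"
      unfolding set_integrable_def[symmetric]
      by (rule set_integrable_locally[OF v, of _ "real N"]) auto
    show "(LBINT x:{a<..<b}. ?w x) = 0" for a b
    proof -
      have "indicator {a<..<b} x *\<^sub>R ?w x = indicator {max a (- real N)<..<min b (real N)} x *\<^sub>R v x" for x
        by (auto simp: indicator_def)
      then show ?thesis using ivl[of "max a (- real N)" "min b (real N)"]
        by (simp only: set_lebesgue_integral_def)
    qed
  qed
  then have "AE x in lborel. \<forall>N::nat. indicator {- real N<..<real N} x *\<^sub>R v x = 0"
    unfolding AE_all_countable by blast
  then show ?thesis
  proof eventually_elim
    case (elim x)
    obtain N :: nat where "\<bar>x\<bar> < real N" using reals_Archimedean2 by blast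
    then have "indicator {- real N<..<real N} x = (1::real)" by (auto simp: indicator_def)
    then show ?case using spec[OF elim, of N] by (metis scaleR_one)
  qed
qed

section \<open>Fourier transforms of test functions\<close>

abbreviation cft :: "(real \<Rightarrow> real) \<Rightarrow> real \<Rightarrow> complex" where
  "cft \<phi> \<equiv> ft (\<lambda>x. complex_of_real (\<phi> x))"

text \<open>Integration by parts, as the fundamental theorem for \<open>E x * \<phi> x\<close> on
  [-R, R]: its derivative \<open>?g\<close> has integral zero because \<phi> vanishes at both
  ends.\<close>

lemma ft_deriv:
  assumes \<phi>: "test_function \<phi>"
  shows "cft (deriv \<phi>) \<xi> = \<i> * of_real \<xi> * cft \<phi> \<xi>"
proof -
  define E where "E x = exp (- (\<i> * complex_of_real (\<xi> * x)))" for x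
  obtain R where R: "0 < R" "\<And>x. \<bar>x\<bar> \<ge> R \<Longrightarrow> \<phi> x = 0"
    using test_function_bounds[OF \<phi>] by metis
  have dR: "deriv \<phi> x = 0" if "\<bar>x\<bar> > R" for x
    using deriv_eq_0_outside[of R \<phi> x] R(2) that by simp
  have \<phi>': "test_function (deriv \<phi>)" by (rule test_function_deriv[OF \<phi>])
  let ?g = "\<lambda>x. E x * of_real (deriv \<phi> x) - \<i> * of_real \<xi> * (E x * of_real (\<phi> x))"
  have "(LBINT x. indicator {-R..R} x *\<^sub>R ?g x) = E R * of_real (\<phi> R) - E (-R) * of_real (\<phi> (-R))"
  proof (rule integral_FTC_Icc)
    show "-R \<le> R" using R by simp
    fix x
    have dE: "(E has_vector_derivative - (\<i> * of_real \<xi>) * E x) (at x within {-R..R})"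
      using exp_scaleR_has_vector_derivative_right[of "- (\<i> * complex_of_real \<xi>)" x "{-R..R}"]
      by (simp add: E_def[abs_def] scaleR_conv_of_real mult_ac)
    have d\<phi>: "((\<lambda>x. complex_of_real (\<phi> x)) has_vector_derivative of_real (deriv \<phi> x)) (at x within {-R..R})"
      using test_function_has_deriv[OF \<phi>, of x]
      by (intro has_vector_derivative_of_real) (auto simp: has_real_derivative_iff_has_vector_derivative intro: has_vector_derivative_at_within)
    show "((\<lambda>x. E x * of_real (\<phi> x)) has_vector_derivative ?g x) (at x within {-R..R})"
      by (rule has_vector_derivative_eq_rhs[OF has_vector_derivative_mult[OF dE d\<phi>]]) (simp add: algebra_simps)
    show "continuous_on {-R..R} ?g"
      unfolding E_def by (intro continuous_intros test_function_continuous \<phi> \<phi>')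
  qed
  moreover have "indicator {-R..R} x *\<^sub>R ?g x = ?g x" for x
    using R(2)[of x] dR[of x] by (cases "\<bar>x\<bar> \<le> R") (auto simp: indicator_def abs_le_iff)
  ultimately have 0: "(LBINT x. ?g x) = 0" using R by simp
  have i: "integrable lborel (\<lambda>x. E x * of_real (deriv \<phi> x))" "integrable lborel (\<lambda>x. E x * of_real (\<phi> x))"
    unfolding E_def
    by (intro integrable_exp_mult integrable_of_real test_function_sq_integrable \<phi> \<phi>')+
  then show ?thesis using 0 unfolding ft_def E_def[symmetric] by simp
qed

lemma ft_iterated_deriv:
  assumes "test_function \<phi>"
  shows "cft ((deriv ^^ k) \<phi>) \<xi> = (\<i> * of_real \<xi>) ^ k * cft \<phi> \<xi>"
  by (induction k) (simp_all add: ft_deriv test_function_iterated_deriv assms mult_ac)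

text \<open>The real part is, up to normalisation, the integral of cos (\<xi> x) times the bump, and
  on the support (0, e) the angle stays within [-1, 1], where the cosine is positive. Narrow bumps
  thus have transforms without zeros on large frequency ranges and can be divided out.\<close>

lemma ft_bump_nonzero:
  assumes e: "0 < e" and \<xi>: "\<bar>\<xi>\<bar> * e \<le> 1"
  shows "cft (bump 1 0 e) \<xi> \<noteq> 0"
proof
  assume 0: "cft (bump 1 0 e) \<xi> = 0"
  have tf: "test_function (bump 1 0 e)" by (rule test_function_bump) simp
  note [measurable] = test_function_measurable[OF tf]
  let ?g = "\<lambda>x. cos (\<xi> * x) * bump 1 0 e x"
  have int: "integrable lborel (\<lambda>x. exp (- (\<i> * of_real (\<xi> * x))) * complex_of_real (bump 1 0 e x))"
    by (intro integrable_exp_mult integrable_of_real test_function_sq_integrable tf)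
  have Re: "Re (exp (- (\<i> * of_real (\<xi> * x))) * complex_of_real (bump 1 0 e x)) = ?g x" for x
    by (simp add: Re_exp)
  have "(LBINT x. exp (- (\<i> * of_real (\<xi> * x))) * complex_of_real (bump 1 0 e x)) = 0"
    using 0 by (simp add: ft_def)
  then have "(LBINT x. ?g x) = 0"
    using integral_Re[OF int] unfolding Re by simp
  moreover have ig: "integrable lborel ?g"
    using integrable_Re[OF int] unfolding Re .
  moreover have cospos: "0 < cos (\<xi> * x)" if "0 < x" "x < e" for x
  proof (rule cos_gt_zero_pi)
    have "\<bar>\<xi> * x\<bar> \<le> \<bar>\<xi>\<bar> * e" using that by (simp add: abs_mult mult_left_mono)
    then have "\<bar>\<xi> * x\<bar> < pi / 2" using \<xi> pi_gt3 by linarith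
    then show "- (pi / 2) < \<xi> * x" "\<xi> * x < pi / 2" by linarith+
  qed
  have nonneg: "0 \<le> ?g x" for x
    using cospos[of x] by (auto simp: bump_eq)
  ultimately have "AE x in lborel. ?g x = 0"
    by (subst (asm) integral_nonneg_eq_0_iff_AE) auto
  then have "AE x in lborel. x \<notin> {0<..<e}"
  proof eventually_elim
    case (elim x)
    then show ?case using cospos[of x] by (auto simp: bump_eq)
  qed
  then have "emeasure lborel {0<..<e} = 0"
    by (subst (asm) AE_iff_measurable[of "{0<..<e}"]) auto
  then show False using e by simp
qed

section \<open>Fourier-Plancherel transform\<close>

lemma sq_integrable_borel: "sq_integrable f \<Longrightarrow> f \<in> borel_measurable borel"
  by (simp add: sq_integrable_def)

lemma borel_measurable_vec_nth [measurable (raw)]: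
  fixes f :: "'b \<Rightarrow> 'a::{euclidean_space}^'n"
  assumes "f \<in> borel_measurable M" shows "(\<lambda>x. f x $ i) \<in> borel_measurable M"
  by (rule measurable_compose[OF assms]) (intro borel_measurable_continuous_onI continuous_intros)

lemma borel_measurable_vec_lambda [measurable (raw)]:
  fixes f :: "'n::finite \<Rightarrow> 'b \<Rightarrow> 'a::{euclidean_space}"
  assumes "\<And>i. f i \<in> borel_measurable M" shows "(\<lambda>x. \<chi> i. f i x) \<in> borel_measurable M"
proof -
  have eq: "(\<chi> i. f i x) = (\<Sum>i\<in>UNIV. axis i (f i x))" for x
    by (simp add: vec_eq_iff axis_def)
  have "continuous_on UNIV (axis i :: 'a \<Rightarrow> 'a^'n)" for i
  proof -
    have "continuous_on UNIV (\<lambda>v::'a. (\<chi> j. if j = i then v else 0) :: 'a^'n)"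
    proof (rule continuous_on_vec_lambda)
      show "continuous_on UNIV (\<lambda>x::'a. if j = i then x else 0)" for j by (cases "j = i") auto
    qed
    then show ?thesis unfolding axis_def .
  qed
  then show ?thesis unfolding eq
    by (intro borel_measurable_sum measurable_compose[OF assms] borel_measurable_continuous_onI)
qed

lemma norm_vec_sq: "(norm (v :: 'a::real_normed_vector^'n))\<^sup>2 = (\<Sum>i\<in>UNIV. (norm (v $ i))\<^sup>2)"
  by (simp add: norm_vec_def L2_set_def sum_nonneg)

lemma sq_integrable_vec_nth:
  fixes g :: "real \<Rightarrow> 'a::euclidean_space^'n"
  assumes "sq_integrable g" shows "sq_integrable (\<lambda>x. g x $ i)"
  by (rule sq_integrable_bound[OF assms])
     (use assms[THEN sq_integrable_measurable] in \<open>auto simp: Finite_Cartesian_Product.norm_nth_le\<close>)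

lemma sq_integrable_vecI:
  fixes g :: "real \<Rightarrow> 'a::euclidean_space^'n"
  assumes "\<And>i. sq_integrable (\<lambda>x. g x $ i)" shows "sq_integrable g"
proof -
  have "(\<lambda>x. \<chi> i. g x $ i) \<in> borel_measurable lborel"
    by (intro borel_measurable_vec_lambda sq_integrable_measurable assms)
  then show ?thesis using assms by (simp add: sq_integrable_def norm_vec_sq)
qed

lemma L2_norm_vec_sq:
  fixes g :: "real \<Rightarrow> 'a::euclidean_space^'n"
  assumes "\<And>i. sq_integrable (\<lambda>x. g x $ i)"
  shows "(L2_norm g)\<^sup>2 = (\<Sum>i\<in>UNIV. (L2_norm (\<lambda>x. g x $ i))\<^sup>2)"
  unfolding L2_norm_sq norm_vec_sq
  by (rule Bochner_Integration.integral_sum) (use assms in \<open>auto simp: sq_integrable_def\<close>)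

lemma L2_norm_vec_nth_le:
  fixes g :: "real \<Rightarrow> 'a::euclidean_space^'n"
  assumes "sq_integrable g"
  shows "L2_norm (\<lambda>x. g x $ i) \<le> L2_norm g"
proof (rule power2_le_imp_le)
  show "(L2_norm (\<lambda>x. g x $ i))\<^sup>2 \<le> (L2_norm g)\<^sup>2"
    unfolding L2_norm_vec_sq[OF sq_integrable_vec_nth[OF assms]]
    by (rule member_le_sum) auto
qed simp

lemma integrable_vec_nth:
  fixes u :: "'b \<Rightarrow> 'a::euclidean_space^'n"
  assumes "integrable M u" shows "integrable M (\<lambda>x. u x $ i)"
  by (rule Bochner_Integration.integrable_bound[OF assms])
     (use borel_measurable_integrable[OF assms] in \<open>auto simp: Finite_Cartesian_Product.norm_nth_le\<close>)

lemma sq_integrable_of_real: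
  "sq_integrable f \<Longrightarrow> sq_integrable (\<lambda>x. complex_of_real (f x))"
  by (auto simp: sq_integrable_def)

lemma fourier_L1_nth: "fourier_L1 u \<xi> $ i = ft (\<lambda>x. of_real (u x $ i)) \<xi>"
  by (simp add: fourier_L1_def ft_def)

lemma sq_integrable_truncation:
  fixes u :: "real \<Rightarrow> 'a::euclidean_space"
  assumes "sq_integrable u"
  shows "sq_integrable (\<lambda>x. indicator {-R..R} x *\<^sub>R u x)" "integrable lborel (\<lambda>x. indicator {-R..R} x *\<^sub>R u x)"
proof -
  show "sq_integrable (\<lambda>x. indicator {-R..R} x *\<^sub>R u x)"
    using assms by (rule sq_integrable_indicator) simp
  have "integrable lborel (\<lambda>x. norm (indicator {-R..R} x :: real) * norm (u x))"
    by (rule integrable_norm_mult_norm[OF sq_integrable_bounded_support[where C=1 and R=R] assms])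
       (auto simp: indicator_def)
  then show "integrable lborel (\<lambda>x. indicator {-R..R} x *\<^sub>R u x)"
    by (rule Bochner_Integration.integrable_bound)
       (auto intro!: borel_measurable_scaleR simp: sq_integrable_borel[OF assms])
qed

lemma L2_truncation_tendsto:
  fixes u :: "real \<Rightarrow> 'a::euclidean_space"
  assumes u: "sq_integrable u"
  shows "(\<lambda>n. L2_norm (\<lambda>x. indicator {-real n..real n} x *\<^sub>R u x - u x)) \<longlonglongrightarrow> 0"
proof (rule L2_tendsto_dominated[OF _ _ u])
  note [measurable] = sq_integrable_measurable[OF u]
  show "(\<lambda>x. indicator {-real n..real n} x *\<^sub>R u x) \<in> borel_measurable lborel" for n
    using sq_integrable_truncation(1)[OF u] by (rule sq_integrable_measurable)
  show "AE x in lborel. norm (indicator {-real n..real n} x *\<^sub>R u x - u x) \<le> norm (u x)" for n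
    by (auto intro!: AE_I2 simp: indicator_def)
  show "AE x in lborel. (\<lambda>n. indicator {-real n..real n} x *\<^sub>R u x) \<longlonglongrightarrow> u x"
  proof (rule AE_I2, rule tendsto_eventually)
    fix x
    have "\<forall>\<^sub>F n in sequentially. real n \<ge> \<bar>x\<bar>"
      using filterlim_real_sequentially unfolding filterlim_at_top by blast
    then show "\<forall>\<^sub>F n in sequentially. indicator {-real n..real n} x *\<^sub>R u x = u x"
      by eventually_elim (auto simp: indicator_def)
  qed
qed (use u sq_integrable_borel in auto)

definition trunc_comp :: "real \<Rightarrow> (real \<Rightarrow> real^'n) \<Rightarrow> 'n \<Rightarrow> real \<Rightarrow> complex" where
  "trunc_comp R u i x = of_real ((indicator {-R..R} x *\<^sub>R u x) $ i)"

lemma trunc_comp: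
  assumes "sq_integrable u"
  shows "sq_integrable (trunc_comp R u i)" "integrable lborel (trunc_comp R u i)"
proof -
  show "sq_integrable (trunc_comp R u i)"
    unfolding trunc_comp_def
    by (intro sq_integrable_of_real sq_integrable_vec_nth sq_integrable_truncation assms)
  have "integrable lborel (\<lambda>x. (indicator {-R..R} x *\<^sub>R u x) $ i)"
    by (rule integrable_vec_nth[OF sq_integrable_truncation(2)[OF assms]])
  then show "integrable lborel (trunc_comp R u i)"
    unfolding trunc_comp_def by (rule integrable_of_real)
qed

lemma fourier_trunc_nth:
  "fourier_L1 (\<lambda>x. indicator {-R..R} x *\<^sub>R u x) \<xi> $ i = ft (trunc_comp R u i) \<xi>"
  unfolding fourier_L1_nth trunc_comp_def ..

lemma sq_integrable_fourier_trunc: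
  assumes "sq_integrable u"
  shows "sq_integrable (fourier_L1 (\<lambda>x. indicator {-R..R} x *\<^sub>R u x))"
  by (rule sq_integrable_vecI)
     (simp only: fourier_trunc_nth Plancherel_L1_L2(1) trunc_comp[OF assms] eta_contract_eq)

lemma is_fourier_L2_sequence:
  assumes "is_fourier_L2 u g"
  shows "(\<lambda>n. L2_norm (\<lambda>\<xi>. fourier_L1 (\<lambda>x. indicator {-real n..real n} x *\<^sub>R u x) \<xi> - g \<xi>)) \<longlonglongrightarrow> 0"
  using assms unfolding is_fourier_L2_def
  by (auto intro: filterlim_compose[OF _ filterlim_real_sequentially])

lemma is_fourier_L2_unique:
  assumes g: "is_fourier_L2 u g" and h: "is_fourier_L2 u h"
  shows "AE \<xi> in lborel. g \<xi> = h \<xi>"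
proof -
  let ?F = "\<lambda>R. fourier_L1 (\<lambda>x. indicator {-R..R} x *\<^sub>R u x)"
  have sq: "sq_integrable u" "sq_integrable g" "sq_integrable h"
    using g h by (auto simp: is_fourier_L2_def)
  have "(\<lambda>n. L2_norm (\<lambda>\<xi>. ?F (real n) \<xi> - g \<xi>) + L2_norm (\<lambda>\<xi>. ?F (real n) \<xi> - h \<xi>)) \<longlonglongrightarrow> 0 + 0"
    by (intro tendsto_add is_fourier_L2_sequence g h)
  moreover have "L2_norm (\<lambda>\<xi>. g \<xi> - h \<xi>) \<le> L2_norm (\<lambda>\<xi>. ?F (real n) \<xi> - g \<xi>) + L2_norm (\<lambda>\<xi>. ?F (real n) \<xi> - h \<xi>)" for n
    using L2_norm_triangle_diff[OF sq(2) sq_integrable_fourier_trunc[OF sq(1), of "real n"] sq(3)]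
    by (simp add: L2_norm_minus_commute[of g])
  ultimately have "L2_norm (\<lambda>\<xi>. g \<xi> - h \<xi>) \<le> 0"
    by (intro LIMSEQ_le_const[of _ "0::real"]) auto
  then have "L2_norm (\<lambda>\<xi>. g \<xi> - h \<xi>) = 0" by (simp add: antisym)
  from L2_norm_eq_0_imp_AE[OF sq_integrable_diff[OF sq(2,3)] this] show ?thesis by simp
qed

lemma fourier_L2_AE_eq:
  assumes "is_fourier_L2 u g"
  shows "AE \<xi> in lborel. fourier_L2 u \<xi> = g \<xi>"
  unfolding fourier_L2_def
  by (rule is_fourier_L2_unique[OF someI[of "is_fourier_L2 u", OF assms] assms])

lemma is_fourier_L2_fourier_L2:
  assumes "is_fourier_L2 u g" shows "is_fourier_L2 u (fourier_L2 u)"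
  unfolding fourier_L2_def by (rule someI[of "is_fourier_L2 u", OF assms])

lemma is_fourier_L2_linear:
  assumes g: "is_fourier_L2 u g" and h: "is_fourier_L2 v h"
  shows "is_fourier_L2 (\<lambda>x. a *\<^sub>R u x + b *\<^sub>R v x) (\<lambda>\<xi>. a *\<^sub>R g \<xi> + b *\<^sub>R h \<xi>)"
proof -
  let ?F = "\<lambda>u R. fourier_L1 (\<lambda>x. indicator {-R..R} x *\<^sub>R u x)"
  have sq: "sq_integrable u" "sq_integrable v" "sq_integrable g" "sq_integrable h"
    using g h by (auto simp: is_fourier_L2_def)
  have "?F (\<lambda>x. a *\<^sub>R u x + b *\<^sub>R v x) R \<xi> = a *\<^sub>R ?F u R \<xi> + b *\<^sub>R ?F v R \<xi>" for R \<xi>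
  proof (rule vec_eq_iff[THEN iffD2], rule allI)
    fix i
    have "trunc_comp R (\<lambda>x. a *\<^sub>R u x + b *\<^sub>R v x) i = (\<lambda>x. of_real a * trunc_comp R u i x + of_real b * trunc_comp R v i x)"
      by (auto simp: trunc_comp_def algebra_simps)
    then show "?F (\<lambda>x. a *\<^sub>R u x + b *\<^sub>R v x) R \<xi> $ i = (a *\<^sub>R ?F u R \<xi> + b *\<^sub>R ?F v R \<xi>) $ i"
      unfolding vector_add_component vector_scaleR_component fourier_trunc_nth
      using trunc_comp(2)[OF sq(1), of R i] trunc_comp(2)[OF sq(2), of R i]
      by (simp add: ft_add ft_cmult scaleR_conv_of_real)
  qed
  then have eq: "?F (\<lambda>x. a *\<^sub>R u x + b *\<^sub>R v x) R \<xi> - (a *\<^sub>R g \<xi> + b *\<^sub>R h \<xi>)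
      = a *\<^sub>R (?F u R \<xi> - g \<xi>) + b *\<^sub>R (?F v R \<xi> - h \<xi>)" for R \<xi>
    by (simp add: algebra_simps)
  have scale: "L2_norm (\<lambda>\<xi>. a *\<^sub>R f \<xi>) = \<bar>a\<bar> * L2_norm f" for a and f :: "real \<Rightarrow> complex^'n"
    by (simp add: L2_norm_def power_mult_distrib real_sqrt_mult)
  have "((\<lambda>R. L2_norm (\<lambda>\<xi>. a *\<^sub>R (?F u R \<xi> - g \<xi>) + b *\<^sub>R (?F v R \<xi> - h \<xi>))) \<longlongrightarrow> 0) at_top"
  proof (rule tendsto_sandwich[OF _ _ tendsto_const])
    show "((\<lambda>R. \<bar>a\<bar> * L2_norm (\<lambda>\<xi>. ?F u R \<xi> - g \<xi>) + \<bar>b\<bar> * L2_norm (\<lambda>\<xi>. ?F v R \<xi> - h \<xi>)) \<longlongrightarrow> 0) at_top"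
      using g h by (auto simp: is_fourier_L2_def intro!: tendsto_add_zero tendsto_mult_right_zero)
    show "\<forall>\<^sub>F R in at_top. L2_norm (\<lambda>\<xi>. a *\<^sub>R (?F u R \<xi> - g \<xi>) + b *\<^sub>R (?F v R \<xi> - h \<xi>))
       \<le> \<bar>a\<bar> * L2_norm (\<lambda>\<xi>. ?F u R \<xi> - g \<xi>) + \<bar>b\<bar> * L2_norm (\<lambda>\<xi>. ?F v R \<xi> - h \<xi>)"
      unfolding scale[symmetric]
      by (intro always_eventually allI L2_norm_triangle sq_integrable_scaleR sq_integrable_diff sq_integrable_fourier_trunc sq)
  qed simp
  then show ?thesis
    using sq by (simp add: is_fourier_L2_def eq sq_integrable_add sq_integrable_scaleR)
qed

text \<open>A solution attains its datum only almost everywhere, so the transform of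
  \<open>U 0\<close> has to be carried over to \<open>U0\<close>.\<close>

lemma is_fourier_L2_cong_AE:
  assumes g: "is_fourier_L2 u g" and [measurable]: "v \<in> borel_measurable lborel"
    and eq: "AE x in lborel. u x = v x"
  shows "is_fourier_L2 v g"
proof -
  have u: "sq_integrable u" using g by (simp add: is_fourier_L2_def)
  note [measurable] = sq_integrable_measurable[OF u]
  have v: "sq_integrable v"
    by (rule sq_integrable_bound[OF u]) (use eq in auto)
  have "ft (trunc_comp R u i) \<xi> = ft (trunc_comp R v i) \<xi>" for R i \<xi>
  proof -
    have [measurable]: "trunc_comp R u i \<in> borel_measurable lborel" "trunc_comp R v i \<in> borel_measurable lborel"
      by (intro sq_integrable_measurable trunc_comp u v)+
    show ?thesis unfolding ft_def
      by (rule arg_cong[where f="\<lambda>z. z / _"], rule integral_cong_AE)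
         (use eq in \<open>auto simp: trunc_comp_def\<close>)
  qed
  then have "fourier_L1 (\<lambda>x. indicator {-R..R} x *\<^sub>R u x) \<xi> = fourier_L1 (\<lambda>x. indicator {-R..R} x *\<^sub>R v x) \<xi>" for R \<xi>
    by (simp only: vec_eq_iff fourier_trunc_nth) simp
  then show ?thesis using g v by (simp add: is_fourier_L2_def)
qed

text \<open>Parseval's identity holds for the truncations of \<open>u\<close>, which are integrable;
  both sides converge because the truncations and their transforms converge in L2.\<close>

theorem Parseval_fourier_L2:
  assumes g: "is_fourier_L2 u g" and f: "integrable lborel f" "sq_integrable f"
  shows "(LBINT \<xi>. g \<xi> $ i * cnj (ft f \<xi>)) = (LBINT x. of_real (u x $ i) * cnj (f x))"
proof -
  let ?F = "\<lambda>n. fourier_L1 (\<lambda>x. indicator {-real n..real n} x *\<^sub>R u x)"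
  have sq: "sq_integrable u" "sq_integrable g" using g by (auto simp: is_fourier_L2_def)
  have cnj_sq: "sq_integrable (\<lambda>x. cnj (h x))" if "sq_integrable h" for h
    by (rule sq_integrable_bound[OF that]) (use sq_integrable_measurable[OF that] in auto)
  have "(\<lambda>n. LBINT \<xi>. ?F n \<xi> $ i * cnj (ft f \<xi>)) \<longlonglongrightarrow> (LBINT \<xi>. g \<xi> $ i * cnj (ft f \<xi>))"
  proof (rule L2_tendsto_inner)
    show "(\<lambda>n. L2_norm (\<lambda>\<xi>. ?F n \<xi> $ i - g \<xi> $ i)) \<longlonglongrightarrow> 0"
    proof (rule tendsto_sandwich[OF _ _ tendsto_const is_fourier_L2_sequence[OF g]])
      show "\<forall>\<^sub>F n in sequentially. L2_norm (\<lambda>\<xi>. ?F n \<xi> $ i - g \<xi> $ i) \<le> L2_norm (\<lambda>\<xi>. ?F n \<xi> - g \<xi>)"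
        using L2_norm_vec_nth_le[OF sq_integrable_diff[OF sq_integrable_fourier_trunc[OF sq(1)] sq(2)], of _ i]
        by simp
    qed simp
  qed (intro sq_integrable_vec_nth sq_integrable_fourier_trunc sq cnj_sq Plancherel_L1_L2 f)+
  moreover have "(LBINT \<xi>. ?F n \<xi> $ i * cnj (ft f \<xi>)) = (LBINT x. trunc_comp n u i x * cnj (f x))" for n
    unfolding fourier_trunc_nth by (rule Parseval_L1_L2) (intro trunc_comp sq f)+
  moreover have "(\<lambda>n. LBINT x. trunc_comp n u i x * cnj (f x)) \<longlonglongrightarrow> (LBINT x. of_real (u x $ i) * cnj (f x))"
  proof (rule L2_tendsto_inner)
    have "L2_norm (\<lambda>x. trunc_comp (real n) u i x - of_real (u x $ i)) \<le> L2_norm (\<lambda>x. indicator {-real n..real n} x *\<^sub>R u x - u x)" for n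
    proof -
      have "L2_norm (\<lambda>x. trunc_comp (real n) u i x - of_real (u x $ i)) = L2_norm (\<lambda>x. (indicator {-real n..real n} x *\<^sub>R u x - u x) $ i)"
        by (simp add: L2_norm_def trunc_comp_def flip: of_real_mult of_real_diff)
      also have "\<dots> \<le> L2_norm (\<lambda>x. indicator {-real n..real n} x *\<^sub>R u x - u x)"
        by (intro L2_norm_vec_nth_le sq_integrable_diff sq_integrable_truncation sq)
      finally show ?thesis .
    qed
    then show "(\<lambda>n. L2_norm (\<lambda>x. trunc_comp (real n) u i x - of_real (u x $ i))) \<longlonglongrightarrow> 0"
      by (intro tendsto_sandwich[OF _ _ tendsto_const L2_truncation_tendsto[OF sq(1)]]) auto
  qed (intro trunc_comp sq_integrable_of_real sq_integrable_vec_nth sq cnj_sq f)+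
  ultimately show ?thesis using LIMSEQ_unique by simp
qed

text \<open>Two limits of the same sequence are compared: the transforms of the truncations converge
  to \<open>g\<close> in L2, hence almost everywhere along a subsequence, and to
  \<open>fourier_L1 u\<close> at every frequency by dominated convergence.\<close>

lemma fourier_L2_eq_fourier_L1:
  assumes g: "is_fourier_L2 u g" and u: "integrable lborel u"
  shows "AE \<xi> in lborel. g \<xi> = fourier_L1 u \<xi>"
proof -
  let ?F = "\<lambda>n. fourier_L1 (\<lambda>x. indicator {-real n..real n} x *\<^sub>R u x)"
  have sq: "sq_integrable u" "sq_integrable g" using g by (auto simp: is_fourier_L2_def)
  have dsq: "sq_integrable (\<lambda>\<xi>. ?F n \<xi> - g \<xi>)" for n
    by (intro sq_integrable_diff sq_integrable_fourier_trunc sq)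
  have "(\<lambda>n. (L2_norm (\<lambda>\<xi>. ?F n \<xi> - g \<xi>))\<^sup>2) \<longlonglongrightarrow> 0\<^sup>2"
    by (intro tendsto_intros is_fourier_L2_sequence g)
  then have "(\<lambda>n. LBINT \<xi>. norm ((norm (?F n \<xi> - g \<xi>))\<^sup>2)) \<longlonglongrightarrow> 0"
    by (simp add: L2_norm_sq)
  then obtain r where r: "strict_mono r" and lim: "AE \<xi> in lborel. (\<lambda>n. (norm (?F (r n) \<xi> - g \<xi>))\<^sup>2) \<longlonglongrightarrow> 0"
    using tendsto_L1_AE_subseq[of lborel "\<lambda>n \<xi>. (norm (?F n \<xi> - g \<xi>))\<^sup>2"] dsq
    by (auto simp: sq_integrable_def)
  have pw: "(\<lambda>n. ?F n \<xi>) \<longlonglongrightarrow> fourier_L1 u \<xi>" for \<xi>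
  proof (rule vec_tendstoI)
    fix i
    have ui: "integrable lborel (\<lambda>x. u x $ i)"
      by (rule integrable_vec_nth[OF u])
    have "(\<lambda>n. LBINT x. exp (- (\<i> * of_real (\<xi> * x))) * trunc_comp (real n) u i x)
      \<longlonglongrightarrow> (LBINT x. exp (- (\<i> * of_real (\<xi> * x))) * of_real (u x $ i))"
    proof (rule integral_dominated_convergence)
      show "integrable lborel (\<lambda>x. norm (u x $ i))" using ui by (rule integrable_norm)
      show "(\<lambda>x. exp (- (\<i> * of_real (\<xi> * x))) * complex_of_real (u x $ i)) \<in> borel_measurable lborel"
        by (intro borel_measurable_integrable integrable_exp_mult integrable_of_real ui)
      show "(\<lambda>x. exp (- (\<i> * of_real (\<xi> * x))) * trunc_comp (real n) u i x) \<in> borel_measurable lborel" for n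
        by (intro borel_measurable_integrable integrable_exp_mult trunc_comp sq)
      show "AE x in lborel. norm (exp (- (\<i> * of_real (\<xi> * x))) * trunc_comp (real n) u i x) \<le> norm (u x $ i)" for n
        by (auto intro!: AE_I2 simp: norm_mult trunc_comp_def indicator_def simp del: of_real_mult)
      show "AE x in lborel. (\<lambda>n. exp (- (\<i> * of_real (\<xi> * x))) * trunc_comp (real n) u i x)
         \<longlonglongrightarrow> exp (- (\<i> * of_real (\<xi> * x))) * of_real (u x $ i)"
      proof (rule AE_I2, rule tendsto_eventually)
        fix x
        have "\<forall>\<^sub>F n in sequentially. real n \<ge> \<bar>x\<bar>"
          using filterlim_real_sequentially unfolding filterlim_at_top by blast
        then show "\<forall>\<^sub>F n in sequentially. exp (- (\<i> * of_real (\<xi> * x))) * trunc_comp (real n) u i x = exp (- (\<i> * of_real (\<xi> * x))) * of_real (u x $ i)"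
          by eventually_elim (auto simp: indicator_def trunc_comp_def)
      qed
    qed
    then show "(\<lambda>n. ?F n \<xi> $ i) \<longlonglongrightarrow> fourier_L1 u \<xi> $ i"
      unfolding fourier_trunc_nth fourier_L1_nth ft_def by (intro tendsto_divide tendsto_const) auto
  qed
  show ?thesis
    using lim
  proof eventually_elim
    case (elim \<xi>)
    have "(\<lambda>n. sqrt ((norm (?F (r n) \<xi> - g \<xi>))\<^sup>2)) \<longlonglongrightarrow> sqrt 0" by (intro tendsto_real_sqrt elim)
    then have "(\<lambda>n. norm (?F (r n) \<xi> - g \<xi>)) \<longlonglongrightarrow> 0" by simp
    then have "(\<lambda>n. ?F (r n) \<xi>) \<longlonglongrightarrow> g \<xi>" by (simp add: tendsto_norm_zero_iff LIM_zero_iff)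
    moreover have "(\<lambda>n. ?F (r n) \<xi>) \<longlonglongrightarrow> fourier_L1 u \<xi>"
      using LIMSEQ_subseq_LIMSEQ[OF pw r] by (simp add: o_def)
    ultimately show ?case by (rule LIMSEQ_unique)
  qed
qed

text \<open>A crude constant: every component is at most the L1 norm, as 1 / sqrt (2 pi) \<le> 1,
  and the squares of all components are summed.\<close>

lemma norm_fourier_L1_sq_le:
  fixes u :: "real \<Rightarrow> real^'n"
  assumes u: "integrable lborel u"
  shows "(norm (fourier_L1 u \<xi>))\<^sup>2 \<le> real CARD('n) * (L1_norm u)\<^sup>2"
proof -
  have "(norm (fourier_L1 u \<xi> $ i))\<^sup>2 \<le> (L1_norm u)\<^sup>2" for i
  proof (rule power_mono)
    have ui: "integrable lborel (\<lambda>x. u x $ i)"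
      by (rule integrable_vec_nth[OF u])
    have "norm (fourier_L1 u \<xi> $ i) \<le> L1_norm (\<lambda>x. complex_of_real (u x $ i)) / sqrt (2 * pi)"
      unfolding fourier_L1_nth by (rule norm_ft_le[OF integrable_of_real[OF ui]])
    also have "\<dots> \<le> L1_norm (\<lambda>x. complex_of_real (u x $ i)) / 1"
    proof (rule divide_left_mono)
      show "1 \<le> sqrt (2 * pi)" using pi_gt3 by simp
    qed (auto simp: L1_norm_def)
    also have "\<dots> \<le> L1_norm u"
      unfolding L1_norm_def div_by_1
      by (rule integral_mono) (use u ui in \<open>auto intro: component_le_norm_cart\<close>)
    finally show "norm (fourier_L1 u \<xi> $ i) \<le> L1_norm u" .
  qed simp
  then have "(\<Sum>i\<in>UNIV. (norm (fourier_L1 u \<xi> $ i))\<^sup>2) \<le> (\<Sum>i\<in>(UNIV::'n set). (L1_norm u)\<^sup>2)"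
    by (intro sum_mono)
  then show ?thesis by (simp add: norm_vec_sq)
qed

section \<open>Weak derivatives\<close>

lemma integrable_test_scaleR:
  fixes v :: "real \<Rightarrow> 'a::euclidean_space"
  assumes \<phi>: "test_function \<phi>" and v: "locally_integrable v"
  shows "integrable lborel (\<lambda>x. \<phi> x *\<^sub>R v x)"
proof -
  obtain R C where R: "\<And>x. \<bar>x\<bar> \<ge> R \<Longrightarrow> \<phi> x = 0" and C: "\<And>x. \<bar>\<phi> x\<bar> \<le> C" and C0: "0 \<le> C"
    using test_function_bounds[OF \<phi>] by metis
  have int: "integrable lborel (\<lambda>x. indicator {-R..R} x *\<^sub>R v x)"
    using v by (simp add: locally_integrable_def set_integrable_def)
  have eq: "\<phi> x *\<^sub>R v x = \<phi> x *\<^sub>R (indicator {-R..R} x *\<^sub>R v x)" for x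
    using R[of x] by (cases "\<bar>x\<bar> \<le> R") (auto simp: indicator_def abs_le_iff)
  show ?thesis unfolding eq
  proof (rule Bochner_Integration.integrable_bound)
    show "integrable lborel (\<lambda>x. C *\<^sub>R (indicator {-R..R} x *\<^sub>R v x))" by (intro integrable_scaleR_right int)
    show "(\<lambda>x. \<phi> x *\<^sub>R (indicator {-R..R} x *\<^sub>R v x)) \<in> borel_measurable lborel"
      by (rule borel_measurable_scaleR[OF _ borel_measurable_integrable[OF int]])
         (use test_function_measurable[OF \<phi>] in simp)
    show "AE x in lborel. norm (\<phi> x *\<^sub>R (indicator {-R..R} x *\<^sub>R v x)) \<le> norm (C *\<^sub>R (indicator {-R..R} x *\<^sub>R v x))" (is "AE x in _. ?P x")
    proof (rule AE_I2)
      fix x show "?P x"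
        unfolding norm_scaleR[of "\<phi> x"] norm_scaleR[of C] using C[of x] C0 by (intro mult_right_mono) auto
    qed
  qed
qed

lemma locally_integrable_diff:
  "locally_integrable v \<Longrightarrow> locally_integrable w \<Longrightarrow> locally_integrable (\<lambda>x. v x - w x)"
  by (simp add: locally_integrable_def)

lemma sq_integrable_imp_locally_integrable:
  "sq_integrable v \<Longrightarrow> locally_integrable v"
  by (simp add: locally_integrable_def set_integrable_def sq_integrable_truncation)

lemma has_weak_deriv_unique:
  assumes v: "has_weak_deriv l u v" and w: "has_weak_deriv l u w"
  shows "AE x in lborel. v x = w x"
proof -
  have loc: "locally_integrable v" "locally_integrable w" using v w by (auto simp: has_weak_deriv_def)
  have "AE x in lborel. v x - w x = 0"
  proof (rule du_Bois_Reymond)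
    show "locally_integrable (\<lambda>x. v x - w x)" by (intro locally_integrable_diff loc)
    fix \<phi> assume \<phi>: "test_function \<phi>"
    have "(- 1) ^ l *\<^sub>R (LBINT x. \<phi> x *\<^sub>R v x) = (- 1) ^ l *\<^sub>R (LBINT x. \<phi> x *\<^sub>R w x)"
      using v w \<phi> unfolding has_weak_deriv_def by metis
    then have "(LBINT x. \<phi> x *\<^sub>R v x) = (LBINT x. \<phi> x *\<^sub>R w x)" by simp
    then show "(LBINT x. \<phi> x *\<^sub>R (v x - w x)) = 0"
      using integrable_test_scaleR[OF \<phi> loc(1)] integrable_test_scaleR[OF \<phi> loc(2)]
      by (simp add: scaleR_diff_right)
  qed
  then show ?thesis by simp
qed

section \<open>Inverse transform and derivatives of Sobolev functions\<close>

lemma cnj_cft: "cnj (cft \<phi> \<xi>) = cft (\<lambda>x. \<phi> (- x)) \<xi>"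
proof -
  have "(LBINT x. exp (- (\<i> * of_real (\<xi> * x))) * complex_of_real (\<phi> (- x)))
    = \<bar>-1\<bar> *\<^sub>R (LBINT x. exp (- (\<i> * of_real (\<xi> * (0 + (-1) * x)))) * complex_of_real (\<phi> (- (0 + (-1) * x))))"
    by (rule lborel_integral_real_affine) simp
  also have "\<dots> = (LBINT x. cnj (exp (- (\<i> * of_real (\<xi> * x))) * complex_of_real (\<phi> x)))"
    by (simp add: exp_cnj)
  also have "\<dots> = cnj (LBINT x. exp (- (\<i> * of_real (\<xi> * x))) * complex_of_real (\<phi> x))"
    by (rule Bochner_Integration.integral_cnj)
  finally show ?thesis by (simp add: ft_def del: of_real_mult)
qed

lemma integrable_reflect:
  fixes f :: "real \<Rightarrow> 'a::{banach,second_countable_topology}"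
  assumes "integrable lborel f"
  shows "integrable lborel (\<lambda>x. f (- x))"
  using lborel_integrable_real_affine[OF assms, of "-1" 0] by simp

lemma integral_reflect:
  fixes f :: "real \<Rightarrow> 'a::{banach,second_countable_topology}"
  shows "(LBINT x. f (- x)) = (LBINT x. f x)"
  using lborel_integral_real_affine[of "-1" f 0] by simp

lemma sq_integrable_reflect:
  assumes "sq_integrable f" shows "sq_integrable (\<lambda>x. f (- x))"
proof -
  have "(\<lambda>x. f (- x)) \<in> borel_measurable lborel"
    using sq_integrable_borel[OF assms] by measurable
  then show ?thesis
    using assms integrable_reflect[of "\<lambda>x. (norm (f x))\<^sup>2"] by (auto simp: sq_integrable_def)
qed

lemma L2_norm_reflect: "L2_norm (\<lambda>x. f (- x)) = L2_norm f"
  using integral_reflect[of "\<lambda>x. (norm (f x))\<^sup>2"] by (simp add: L2_norm_def)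

text \<open>\<open>ft h (- x)\<close> is the inverse transform of \<open>h\<close> at
  \<open>x\<close>, so this is the multiplication formula after a reflection.\<close>

lemma inverse_ft_pairing:
  assumes h: "integrable lborel h" and \<phi>: "integrable lborel \<phi>"
  shows "(LBINT x. of_real (\<phi> x) * ft h (- x)) = (LBINT \<xi>. h \<xi> * cnj (cft \<phi> \<xi>))"
proof -
  have "(LBINT x. of_real (\<phi> x) * ft h (- x)) = (LBINT x. ft h x * complex_of_real (\<phi> (- x)))"
    using integral_reflect[of "\<lambda>x. ft h x * complex_of_real (\<phi> (- x))"] by (simp add: mult.commute)
  also have "\<dots> = (LBINT x. h x * cft (\<lambda>x. \<phi> (- x)) x)"
    using \<phi> by (intro ft_multiplication h integrable_of_real integrable_reflect)
  finally show ?thesis by (simp add: cnj_cft)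
qed

lemma integrable_inverse_1_plus_sq: "integrable lborel (\<lambda>x::real. 1 / (1 + x\<^sup>2))"
proof -
  have 1: "integrable lborel (\<lambda>x::real. indicator {0<..} x *\<^sub>R (1 / (1 + x\<^sup>2)))"
    using integrable_I0i_1_div_plus_square interval_integrable_to_infinity_eq[of lborel 0 "\<lambda>x. 1 / (1 + x\<^sup>2)"]
    by (simp add: set_integrable_def zero_ereal_def)
  have "integrable lborel (\<lambda>x::real. indicator {0<..} x *\<^sub>R (1 / (1 + x\<^sup>2)) + indicator {0<..} (- x) *\<^sub>R (1 / (1 + (- x)\<^sup>2)))"
    by (intro Bochner_Integration.integrable_add 1 integrable_reflect[OF 1])
  moreover have "AE x in lborel. x \<noteq> (0::real)" by (rule AE_lborel_singleton)
  then have "AE x::real in lborel. indicator {0<..} x *\<^sub>R (1 / (1 + x\<^sup>2)) + indicator {0<..} (- x) *\<^sub>R (1 / (1 + (- x)\<^sup>2)) = 1 / (1 + x\<^sup>2)"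
    by (rule AE_mp) (auto intro!: AE_I2 simp: indicator_def)
  ultimately show ?thesis
    by (subst (asm) integrable_cong_AE) auto
qed

lemma power_le_sobolev_weight:
  fixes \<xi> :: real assumes "real l \<le> s" shows "\<xi> ^ (2 * l) \<le> (1 + \<xi>\<^sup>2) powr s"
proof -
  have "\<xi> ^ (2 * l) = (\<xi>\<^sup>2) ^ l" by (simp add: power_mult)
  also have "\<dots> \<le> (1 + \<xi>\<^sup>2) ^ l" by (intro power_mono) auto
  also have "\<dots> = (1 + \<xi>\<^sup>2) powr real l" by (subst powr_realpow) (auto intro: add_pos_nonneg)
  also have "\<dots> \<le> (1 + \<xi>\<^sup>2) powr s" using assms by (intro powr_mono) auto
  finally show ?thesis .
qed

lemma sq_integrable_power_mult:
  fixes g :: "real \<Rightarrow> complex^'n"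
  assumes g: "sq_integrable g" and w: "integrable lborel (\<lambda>\<xi>. (1 + \<xi>\<^sup>2) powr s * (norm (g \<xi>))\<^sup>2)"
    and l: "real l \<le> s"
  shows "sq_integrable (\<lambda>\<xi>. (\<i> * of_real \<xi>) ^ l * g \<xi> $ i)"
proof -
  note [measurable] = sq_integrable_borel[OF g]
  have "integrable lborel (\<lambda>\<xi>. (norm ((\<i> * of_real \<xi>) ^ l * g \<xi> $ i))\<^sup>2)"
  proof (rule Bochner_Integration.integrable_bound[OF w])
    show "AE x in lborel. norm ((norm ((\<i> * of_real x) ^ l * g x $ i))\<^sup>2) \<le> norm ((1 + x\<^sup>2) powr s * (norm (g x))\<^sup>2)" (is "AE x in _. ?P x")
    proof (rule AE_I2)
      fix x
      have "(norm ((\<i> * complex_of_real x) ^ l * g x $ i))\<^sup>2 = x ^ (2 * l) * (norm (g x $ i))\<^sup>2"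
        by (simp add: norm_mult norm_power power_mult_distrib power_mult[symmetric] mult.commute[of l] power_even_abs)
      also have "\<dots> \<le> (1 + x\<^sup>2) powr s * (norm (g x))\<^sup>2"
        by (intro mult_mono power_le_sobolev_weight l power_mono Finite_Cartesian_Product.norm_nth_le) auto
      finally show "?P x"
        by simp
    qed
  qed measurable
  then show ?thesis by (simp add: sq_integrable_def)
qed

text \<open>Here \<open>l \<le> s - 1\<close> is essential: it makes the Fourier transform of the \<open>l\<close>-th derivative integrable,
  so that the derivative is given by an absolutely convergent inversion integral.\<close>

lemma integrable_power_mult:
  fixes g :: "real \<Rightarrow> complex^'n"
  assumes g: "sq_integrable g" and w: "integrable lborel (\<lambda>\<xi>. (1 + \<xi>\<^sup>2) powr s * (norm (g \<xi>))\<^sup>2)"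
    and l: "real l \<le> s - 1"
  shows "integrable lborel (\<lambda>\<xi>. (\<i> * of_real \<xi>) ^ l * g \<xi> $ i)"
proof -
  note [measurable] = sq_integrable_borel[OF g]
  show ?thesis
  proof (rule Bochner_Integration.integrable_bound)
    show "integrable lborel (\<lambda>\<xi>. 1 / (1 + \<xi>\<^sup>2) + (1 + \<xi>\<^sup>2) powr s * (norm (g \<xi>))\<^sup>2)"
      by (intro Bochner_Integration.integrable_add integrable_inverse_1_plus_sq w)
    show "AE x in lborel. norm ((\<i> * of_real x) ^ l * g x $ i) \<le> norm (1 / (1 + x\<^sup>2) + (1 + x\<^sup>2) powr s * (norm (g x))\<^sup>2)" (is "AE x in _. ?P x")
    proof (rule AE_I2)
      fix x :: real
      define a where "a = 1 + x\<^sup>2"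
      define b where "b = norm ((\<i> * complex_of_real x) ^ l * g x $ i)"
      have a: "1 \<le> a" by (simp add: a_def)
      have "a * b\<^sup>2 = a * x ^ (2 * l) * (norm (g x $ i))\<^sup>2" unfolding b_def
        by (simp add: norm_mult norm_power power_mult_distrib power_mult[symmetric] mult.commute[of l] power_even_abs)
      also have "\<dots> \<le> a powr s * (norm (g x))\<^sup>2"
      proof (intro mult_mono power_mono Finite_Cartesian_Product.norm_nth_le)
        have "a * x ^ (2 * l) \<le> a powr 1 * a powr (s - 1)"
          unfolding a_def using power_le_sobolev_weight[OF l, of x] by (intro mult_mono) auto
        also have "\<dots> = a powr s" by (subst powr_add[symmetric]) simp
        finally show "a * x ^ (2 * l) \<le> a powr s" .
      qed auto
      finally have ab: "a * b\<^sup>2 \<le> a powr s * (norm (g x))\<^sup>2" .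
      \<comment> \<open>The arithmetic-geometric mean inequality in the form 2 b \<le> 1/a + a b^2:
        it trades integrability of \<open>b\<close> for that of 1 / (1 + x^2) and of the weighted
        square.\<close>
      have "0 \<le> (1 - a * b)\<^sup>2 / a" using a by simp
      also have "\<dots> = 1 / a - 2 * b + a * b\<^sup>2"
        using a by (simp add: power2_diff field_simps power2_eq_square)
      finally have "2 * b \<le> 1 / a + a * b\<^sup>2" by simp
      moreover have "0 \<le> b" by (simp add: b_def)
      ultimately have "b \<le> 1 / a + a powr s * (norm (g x))\<^sup>2" using ab by linarith
      then show "?P x"
        unfolding b_def a_def real_norm_def by linarith
    qed
  qed measurable
qed

lemma integral_vec_nth:
  fixes f :: "'b \<Rightarrow> 'a::euclidean_space^'n"
  assumes "integrable M f" shows "(integral\<^sup>L M f) $ i = (LINT x|M. f x $ i)"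
  using integral_bounded_linear[OF bounded_linear_vec_nth assms, of i] by simp

text \<open>The candidate is the inverse transform \<open>W\<close> of (\<i> \<xi>)^l g, whose norm
  is known from Plancherel. It is complex-valued a priori, so its real part is taken as the
  derivative; that this loses no norm is a consequence of \<open>u\<close> being real.\<close>

theorem sobolev_has_weak_deriv:
  fixes u :: "real \<Rightarrow> real^'n"
  assumes g: "is_fourier_L2 u g" and w: "integrable lborel (\<lambda>\<xi>. (1 + \<xi>\<^sup>2) powr s * (norm (g \<xi>))\<^sup>2)"
    and l: "real l \<le> s - 1"
  obtains v where "has_weak_deriv l u v" "sq_integrable v"
    "(L2_norm v)\<^sup>2 = (LBINT \<xi>. \<xi> ^ (2 * l) * (norm (g \<xi>))\<^sup>2)"
proof -
  have sq: "sq_integrable u" "sq_integrable g" using g by (auto simp: is_fourier_L2_def)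
  define h where "h i \<xi> = (\<i> * of_real \<xi>) ^ l * g \<xi> $ i" for i \<xi>
  have h: "integrable lborel (h i)" "sq_integrable (h i)" for i
    unfolding h_def using integrable_power_mult[OF sq(2) w l] sq_integrable_power_mult[OF sq(2) w] l by auto
  define W where "W i x = ft (h i) (- x)" for i x
  have W: "sq_integrable (W i)" "L2_norm (W i) = L2_norm (h i)" for i
    unfolding W_def using Plancherel_L1_L2[OF h] by (simp_all add: sq_integrable_reflect L2_norm_reflect)
  note [measurable] = sq_integrable_borel[OF W(1)]
  have WR: "sq_integrable (\<lambda>x. Re (W i x))" and WI: "sq_integrable (\<lambda>x. Im (W i x))" for i
    by (rule sq_integrable_bound[OF W(1)[of i]]; auto intro!: AE_I2 simp: abs_Re_le_cmod abs_Im_le_cmod)+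
  define v :: "real \<Rightarrow> real^'n" where "v x = (\<chi> i. Re (W i x))" for x
  have v: "sq_integrable v" by (rule sq_integrable_vecI) (simp add: v_def WR)
  have key: "of_real (LBINT x. (deriv ^^ l) \<phi> x * u x $ i) = (- 1) ^ l * (LBINT x. of_real (\<phi> x) * W i x)"
    if \<phi>: "test_function \<phi>" for \<phi> i
  proof -
    note \<phi>l = test_function_iterated_deriv[OF \<phi>, of l]
    have "of_real (LBINT x. (deriv ^^ l) \<phi> x * u x $ i) =
       (LBINT x. of_real (u x $ i) * cnj (complex_of_real ((deriv ^^ l) \<phi> x)))"
      by (simp add: mult.commute flip: integral_complex_of_real)
    also have "\<dots> = (LBINT \<xi>. g \<xi> $ i * cnj (cft ((deriv ^^ l) \<phi>) \<xi>))"
      by (rule Parseval_fourier_L2[OF g, symmetric])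
         (intro integrable_of_real sq_integrable_of_real test_function_sq_integrable \<phi>l)+
    also have "\<dots> = (LBINT \<xi>. (- 1) ^ l * (h i \<xi> * cnj (cft \<phi> \<xi>)))"
    proof (rule Bochner_Integration.integral_cong[OF refl])
      fix \<xi>
      \<comment> \<open>Conjugating (\<i> \<xi>)^l produces exactly the sign (-1)^l that the
        definition of a weak derivative carries.\<close>
      have "cnj ((\<i> * complex_of_real \<xi>) ^ l) = (- 1) ^ l * (\<i> * complex_of_real \<xi>) ^ l"
        by (simp flip: power_mult_distrib)
      then show "g \<xi> $ i * cnj (cft ((deriv ^^ l) \<phi>) \<xi>) = (- 1) ^ l * (h i \<xi> * cnj (cft \<phi> \<xi>))"
        unfolding ft_iterated_deriv[OF \<phi>] h_def complex_cnj_mult[of "(\<i> * complex_of_real \<xi>) ^ l"] by simp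
    qed
    also have "\<dots> = (- 1) ^ l * (LBINT x. of_real (\<phi> x) * W i x)"
      unfolding W_def inverse_ft_pairing[OF h(1) test_function_sq_integrable(2)[OF \<phi>]] by simp
    finally show ?thesis .
  qed
  have int\<phi>W: "integrable lborel (\<lambda>x. of_real (\<phi> x) * W i x)" if "test_function \<phi>" for \<phi> i
    using integrable_test_scaleR[OF that sq_integrable_imp_locally_integrable[OF W(1)]]
    by (simp add: scaleR_conv_of_real)
  have reim: "(LBINT x. (deriv ^^ l) \<phi> x * u x $ i) = (- 1) ^ l * (LBINT x. \<phi> x * Re (W i x))"
     "(LBINT x. \<phi> x * Im (W i x)) = 0"
    if \<phi>: "test_function \<phi>" for \<phi> i
  proof -
    have m1: "(-1) ^ l = complex_of_real ((-1) ^ l)" by simp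
    have "Re (LBINT x. of_real (\<phi> x) * W i x) = (LBINT x. \<phi> x * Re (W i x))"
      "Im (LBINT x. of_real (\<phi> x) * W i x) = (LBINT x. \<phi> x * Im (W i x))"
      using integral_Re[OF int\<phi>W[OF \<phi>], of i] integral_Im[OF int\<phi>W[OF \<phi>], of i] by simp_all
    moreover have "(LBINT x. (deriv ^^ l) \<phi> x * u x $ i) = (- 1) ^ l * Re (LBINT x. of_real (\<phi> x) * W i x)"
      "0 = (- 1) ^ l * Im (LBINT x. of_real (\<phi> x) * W i x)"
      using arg_cong[OF key[OF \<phi>, of i], of Re] arg_cong[OF key[OF \<phi>, of i], of Im] unfolding m1
      by (simp_all del: of_real_power)
    ultimately show "(LBINT x. (deriv ^^ l) \<phi> x * u x $ i) = (- 1) ^ l * (LBINT x. \<phi> x * Re (W i x))"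
     "(LBINT x. \<phi> x * Im (W i x)) = 0" by simp_all
  qed
  \<comment> \<open>Real test functions paired with the real function \<open>u\<close> give real
    values, so the imaginary part of \<open>W\<close> is annihilated by all of them.\<close>
  have Im0: "AE x in lborel. Im (W i x) = 0" for i
    by (rule du_Bois_Reymond) (use reim(2) WI sq_integrable_imp_locally_integrable in auto)
  have "has_weak_deriv l u v"
    unfolding has_weak_deriv_def
  proof (intro conjI allI impI)
    show loc: "locally_integrable u" "locally_integrable v"
      using sq v by (auto intro: sq_integrable_imp_locally_integrable)
    fix \<phi> assume \<phi>: "test_function \<phi>"
    show "(LBINT x. (deriv ^^ l) \<phi> x *\<^sub>R u x) = (- 1) ^ l *\<^sub>R (LBINT x. \<phi> x *\<^sub>R v x)"
      unfolding vec_eq_iff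
      using reim(1)[OF \<phi>] integrable_test_scaleR[OF test_function_iterated_deriv[OF \<phi>] loc(1)] integrable_test_scaleR[OF \<phi> loc(2)]
      by (simp add: integral_vec_nth v_def)
  qed
  moreover have "(L2_norm v)\<^sup>2 = (LBINT \<xi>. \<xi> ^ (2 * l) * (norm (g \<xi>))\<^sup>2)"
  proof -
    have "(L2_norm v)\<^sup>2 = (\<Sum>i\<in>UNIV. (L2_norm (\<lambda>x. v x $ i))\<^sup>2)"
      by (rule L2_norm_vec_sq) (rule sq_integrable_vec_nth[OF v])
    also have "\<dots> = (\<Sum>i\<in>UNIV. (L2_norm (h i))\<^sup>2)"
    proof (rule sum.cong[OF refl])
      fix i
      have "L2_norm (\<lambda>x. v x $ i) = L2_norm (W i)"
      proof (rule L2_norm_cong_AE)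
        show "AE x in lborel. norm (v x $ i) = norm (W i x)"
          using Im0[of i] by eventually_elim (simp add: v_def cmod_def)
      qed (use sq_integrable_borel[OF v] in \<open>auto intro: borel_measurable_vec_nth\<close>)
      then show "(L2_norm (\<lambda>x. v x $ i))\<^sup>2 = (L2_norm (h i))\<^sup>2" by (simp add: W)
    qed
    also have "\<dots> = (LBINT \<xi>. (\<Sum>i\<in>UNIV. (norm (h i \<xi>))\<^sup>2))"
      unfolding L2_norm_sq using h(2)
      by (subst Bochner_Integration.integral_sum) (auto simp: sq_integrable_def)
    also have "\<dots> = (LBINT \<xi>. \<xi> ^ (2 * l) * (norm (g \<xi>))\<^sup>2)"
      by (simp add: h_def norm_mult norm_power power_mult_distrib power_mult[symmetric] mult.commute[of l]
          power_even_abs norm_vec_sq sum_distrib_left)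
    finally show ?thesis .
  qed
  ultimately show ?thesis using that v by blast
qed

lemma locally_integrable_measurable:
  fixes v :: "real \<Rightarrow> 'a::euclidean_space"
  assumes "locally_integrable v" shows "v \<in> borel_measurable borel"
proof (rule borel_measurable_LIMSEQ_metric)
  show "(\<lambda>x. indicator {-real n..real n} x *\<^sub>R v x) \<in> borel_measurable borel" for n
    using assms borel_measurable_integrable[of lborel "\<lambda>x. indicator {-real n..real n} x *\<^sub>R v x"]
    by (simp add: locally_integrable_def set_integrable_def)
  show "(\<lambda>n. indicator {-real n..real n} x *\<^sub>R v x) \<longlonglongrightarrow> v x" for x
  proof (rule tendsto_eventually)
    have "\<forall>\<^sub>F n in sequentially. real n \<ge> \<bar>x\<bar>"
      using filterlim_real_sequentially unfolding filterlim_at_top by blast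
    then show "\<forall>\<^sub>F n in sequentially. indicator {-real n..real n} x *\<^sub>R v x = v x"
      by eventually_elim (auto simp: indicator_def)
  qed
qed

theorem L2_norm_weak_deriv:
  fixes u :: "real \<Rightarrow> real^'n"
  assumes g: "is_fourier_L2 u g" and w: "integrable lborel (\<lambda>\<xi>. (1 + \<xi>\<^sup>2) powr s * (norm (g \<xi>))\<^sup>2)"
    and l: "real l \<le> s - 1"
  shows "(L2_norm (weak_deriv l u))\<^sup>2 = (LBINT \<xi>. \<xi> ^ (2 * l) * (norm (g \<xi>))\<^sup>2)"
proof -
  obtain v where v: "has_weak_deriv l u v" "sq_integrable v"
    and val: "(L2_norm v)\<^sup>2 = (LBINT \<xi>. \<xi> ^ (2 * l) * (norm (g \<xi>))\<^sup>2)"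
    using sobolev_has_weak_deriv[OF g w l] .
  have d: "has_weak_deriv l u (weak_deriv l u)"
    unfolding weak_deriv_def by (rule someI[of "has_weak_deriv l u", OF v(1)])
  have "L2_norm (weak_deriv l u) = L2_norm v"
  proof (rule L2_norm_cong_AE)
    show "AE x in lborel. norm (weak_deriv l u x) = norm (v x)"
      using has_weak_deriv_unique[OF d v(1)] by eventually_elim simp
    show "weak_deriv l u \<in> borel_measurable lborel"
      using d locally_integrable_measurable by (auto simp: has_weak_deriv_def)
    show "v \<in> borel_measurable lborel" using v(2) by (rule sq_integrable_measurable)
  qed
  then show ?thesis using val by simp
qed

section \<open>The system on the Fourier side\<close>

lemma ft_shift: "ft (\<lambda>x. f (x + a)) \<xi> = exp (\<i> * of_real (\<xi> * a)) * ft f \<xi>"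
proof -
  have "(LBINT x. exp (- (\<i> * of_real (\<xi> * x))) * f x)
     = \<bar>1\<bar> *\<^sub>R (LBINT x. exp (- (\<i> * of_real (\<xi> * (a + 1 * x)))) * f (a + 1 * x))"
    by (rule lborel_integral_real_affine) simp
  also have "\<dots> = (LBINT x. exp (- (\<i> * of_real (\<xi> * a))) * (exp (- (\<i> * of_real (\<xi> * x))) * f (x + a)))"
    by (simp add: algebra_simps exp_add exp_diff exp_minus divide_inverse)
  also have "\<dots> = exp (- (\<i> * of_real (\<xi> * a))) * (LBINT x. exp (- (\<i> * of_real (\<xi> * x))) * f (x + a))"
    by (rule integral_mult_right_zero)
  finally have "exp (\<i> * of_real (\<xi> * a)) * (LBINT x. exp (- (\<i> * of_real (\<xi> * x))) * f x)
     = (exp (\<i> * of_real (\<xi> * a)) * exp (- (\<i> * of_real (\<xi> * a)))) * (LBINT x. exp (- (\<i> * of_real (\<xi> * x))) * f (x + a))"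
    by (simp only: mult.assoc)
  also have "exp (\<i> * of_real (\<xi> * a)) * exp (- (\<i> * of_real (\<xi> * a))) = 1"
    by (simp flip: exp_add)
  finally show ?thesis by (simp add: ft_def del: of_real_mult)
qed

text \<open>The pairings with translates of a test function are the Fourier coefficients of
  \<open>H * cnj (cft \<phi>)\<close>, so that product vanishes by Plancherel.\<close>

lemma AE_zero_if_orthogonal_to_ft_test:
  assumes H: "sq_integrable H"
    and zero: "\<And>\<phi>. test_function \<phi> \<Longrightarrow> (LBINT \<xi>. H \<xi> * cnj (cft \<phi> \<xi>)) = 0"
  shows "AE \<xi> in lborel. H \<xi> = 0"
proof -
  have "AE \<xi> in lborel. H \<xi> * cnj (cft (bump 1 0 e) \<xi>) = 0" for e
  proof -
    define \<phi> where "\<phi> = bump 1 0 e"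
    define f where "f \<xi> = H \<xi> * cnj (cft \<phi> \<xi>)" for \<xi>
    have \<phi>: "test_function \<phi>" unfolding \<phi>_def by (rule test_function_bump) simp
    have i\<phi>: "integrable lborel (\<lambda>x. complex_of_real (\<phi> x))" "sq_integrable (\<lambda>x. complex_of_real (\<phi> x))"
      by (intro integrable_of_real sq_integrable_of_real test_function_sq_integrable \<phi>)+
    have [measurable]: "H \<in> borel_measurable borel" "cft \<phi> \<in> borel_measurable borel"
      using sq_integrable_borel[OF H] sq_integrable_borel[OF Plancherel_L1_L2(1)[OF i\<phi>]] by auto
    have f1: "integrable lborel f"
      unfolding f_def by (rule integrable_mult_cnj[OF H Plancherel_L1_L2(1)[OF i\<phi>]])
    have f2: "sq_integrable f"
    proof (rule sq_integrable_bounded_mult[OF H])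
      show "norm (f \<xi>) \<le> (L1_norm (\<lambda>x. complex_of_real (\<phi> x)) / sqrt (2 * pi)) * norm (H \<xi>)" for \<xi>
        using mult_left_mono[OF norm_ft_le[OF i\<phi>(1), of \<xi>] norm_ge_zero[of "H \<xi>"]]
        by (simp add: f_def norm_mult mult.commute)
    qed (unfold f_def, measurable)
    have "ft f a = 0" for a
    proof -
      have tf: "test_function (\<lambda>x. \<phi> (x + a))"
        using test_function_bump[of 1 "-a" "e - a"] by (simp add: \<phi>_def bump_def[abs_def] algebra_simps)
      have "exp (- (\<i> * of_real (a * \<xi>))) * f \<xi> = H \<xi> * cnj (cft (\<lambda>x. \<phi> (x + a)) \<xi>)" for \<xi>
        unfolding ft_shift[where f="\<lambda>x. complex_of_real (\<phi> x)"] f_def by (simp add: exp_cnj mult_ac)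
      then show ?thesis unfolding ft_def[of f a] using zero[OF tf] by simp
    qed
    then have "L2_norm f = 0"
      using Plancherel_L1_L2(2)[OF f1 f2] by (simp add: L2_norm_def)
    from L2_norm_eq_0_imp_AE[OF f2 this] show ?thesis by (simp add: f_def \<phi>_def)
  qed
  then have "AE \<xi> in lborel. \<forall>n. H \<xi> * cnj (cft (bump 1 0 (1 / real (Suc n))) \<xi>) = 0"
    unfolding AE_all_countable by blast
  then show ?thesis
  proof eventually_elim
    case (elim \<xi>)
    obtain n where n: "\<bar>\<xi>\<bar> \<le> real n" using real_arch_simple by blast
    \<comment> \<open>A single bump may have zeros in its transform, but width 1 / (n + 1) rules
      them out for |\<xi>| \<le> n + 1, and the chosen \<open>n\<close> bounds |\<xi>|.\<close>
    have "cft (bump 1 0 (1 / real (Suc n))) \<xi> \<noteq> 0"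
      by (rule ft_bump_nonzero) (use n in \<open>auto simp: field_simps\<close>)
    then show ?case using spec[OF elim, of n] by (simp del: of_nat_Suc)
  qed
qed

text \<open>\<open>v\<close> is only locally integrable, so no transform of it is at hand; the
  identity states in distributional form that its transform is (\<i> \<xi>)^l g. The case l = 0
  covers the undifferentiated terms of the equation.\<close>

lemma weak_deriv_pairing:
  assumes g: "is_fourier_L2 u g" and d: "has_weak_deriv l u v" and \<phi>: "test_function \<phi>"
  shows "complex_of_real (LBINT x. \<phi> x * v x $ i)
    = (LBINT \<xi>. ((\<i> * of_real \<xi>) ^ l * g \<xi> $ i) * cnj (cft \<phi> \<xi>))"
proof -
  have loc: "locally_integrable u" "locally_integrable v" using d by (auto simp: has_weak_deriv_def)
  note \<phi>l = test_function_iterated_deriv[OF \<phi>, of l]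
  have "(LBINT x. (deriv ^^ l) \<phi> x *\<^sub>R u x) = (- 1) ^ l *\<^sub>R (LBINT x. \<phi> x *\<^sub>R v x)"
    using d \<phi> by (simp add: has_weak_deriv_def)
  from arg_cong[OF this, of "\<lambda>z. z $ i"]
  have "(LBINT x. (deriv ^^ l) \<phi> x * u x $ i) = (- 1) ^ l * (LBINT x. \<phi> x * v x $ i)"
    by (simp add: integral_vec_nth integrable_test_scaleR[OF \<phi>l loc(1)] integrable_test_scaleR[OF \<phi> loc(2)])
  then have "(LBINT x. \<phi> x * v x $ i) = (- 1) ^ l * (LBINT x. (deriv ^^ l) \<phi> x * u x $ i)"
    by (simp flip: power_mult_distrib mult.assoc)
  then have "complex_of_real (LBINT x. \<phi> x * v x $ i)
      = (- 1) ^ l * (LBINT x. of_real (u x $ i) * cnj (complex_of_real ((deriv ^^ l) \<phi> x)))"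
    by (simp add: mult.commute flip: integral_complex_of_real)
  also have "(LBINT x. of_real (u x $ i) * cnj (complex_of_real ((deriv ^^ l) \<phi> x)))
     = (LBINT \<xi>. g \<xi> $ i * cnj (cft ((deriv ^^ l) \<phi>) \<xi>))"
    by (rule Parseval_fourier_L2[OF g, symmetric])
       (intro integrable_of_real sq_integrable_of_real test_function_sq_integrable \<phi>l)+
  also have "(- 1) ^ l * \<dots> = (LBINT \<xi>. (- 1) ^ l * (g \<xi> $ i * cnj (cft ((deriv ^^ l) \<phi>) \<xi>)))"
    by (rule integral_mult_right_zero[symmetric])
  also have "\<dots> = (LBINT \<xi>. ((\<i> * of_real \<xi>) ^ l * g \<xi> $ i) * cnj (cft \<phi> \<xi>))"
  proof (rule Bochner_Integration.integral_cong[OF refl])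
    fix \<xi>
    have "(- 1) ^ l * cnj ((\<i> * complex_of_real \<xi>) ^ l) = (\<i> * complex_of_real \<xi>) ^ l"
      by (simp flip: power_mult_distrib)
    then show "(- 1) ^ l * (g \<xi> $ i * cnj (cft ((deriv ^^ l) \<phi>) \<xi>)) = ((\<i> * of_real \<xi>) ^ l * g \<xi> $ i) * cnj (cft \<phi> \<xi>)"
      unfolding ft_iterated_deriv[OF \<phi>] complex_cnj_mult[of "(\<i> * complex_of_real \<xi>) ^ l"]
      by (simp add: mult_ac)
  qed
  finally show ?thesis .
qed

lemma has_weak_deriv_0: "sq_integrable u \<Longrightarrow> has_weak_deriv 0 u u"
  by (simp add: has_weak_deriv_def sq_integrable_imp_locally_integrable)

definition cmatvec :: "real^'n^'n \<Rightarrow> complex^'n \<Rightarrow> complex^'n" where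
  "cmatvec M z = (\<chi> j. \<Sum>k\<in>UNIV. of_real (M $ j $ k) * z $ k)"

text \<open>\<open>H j\<close> is the j-th component of the residual of the transformed equation. It
  is square-integrable since s \<ge> 2 controls \<xi>^2 g, and its pairing with the transform of a
  test function equals the tested equation in x, hence zero; the orthogonality criterion
  finishes.\<close>

theorem fourier_system:
  fixes A0 A1 L B :: "real^'n^'n"
  assumes g: "is_fourier_L2 u g" and m: "is_fourier_L2 ut m"
    and w: "integrable lborel (\<lambda>\<xi>. (1 + \<xi>\<^sup>2) powr s * (norm (g \<xi>))\<^sup>2)" and s: "2 \<le> s"
    and ux: "has_weak_deriv 1 u ux" and uxx: "has_weak_deriv 2 u uxx"
    and pde: "AE x in lborel. A0 *v ut x + A1 *v ux x + L *v u x = B *v uxx x"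
  shows "AE \<xi> in lborel. cmatvec A0 (m \<xi>) + cmatvec A1 (\<chi> k. \<i> * of_real \<xi> * g \<xi> $ k)
     + cmatvec L (g \<xi>) = cmatvec B (\<chi> k. (\<i> * of_real \<xi>)\<^sup>2 * g \<xi> $ k)"
proof -
  let ?f = "\<lambda>l (h :: real \<Rightarrow> complex^'n) k \<xi>. (\<i> * of_real \<xi>) ^ l * h \<xi> $ k"
    and ?c = "\<lambda>(M :: real^'n^'n) j k. complex_of_real (M $ j $ k)"
  have sq: "sq_integrable u" "sq_integrable g" "sq_integrable ut" "sq_integrable m"
    using g m by (auto simp: is_fourier_L2_def)
  have loc: "locally_integrable ut" "locally_integrable u" "locally_integrable ux" "locally_integrable uxx"
    using sq ux uxx by (auto simp: has_weak_deriv_def intro: sq_integrable_imp_locally_integrable)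
  define H where "H j \<xi> = (\<Sum>k\<in>UNIV. ?c A0 j k * (?f 0 m k \<xi>)
     + ?c A1 j k * (?f 1 g k \<xi>) + ?c L j k * (?f 0 g k \<xi>)
     - ?c B j k * (?f 2 g k \<xi>))" for j \<xi>
  have p: "sq_integrable (\<lambda>\<xi>. (\<i> * of_real \<xi>) ^ l * g \<xi> $ k)" if "l \<le> 2" for l k
    by (rule sq_integrable_power_mult[OF sq(2) w]) (use that s in linarith)
  have p0: "sq_integrable (\<lambda>\<xi>. ?f 0 m k \<xi>)" for k
    using sq_integrable_vec_nth[OF sq(4)] by simp
  have sum_sq: "sq_integrable (\<lambda>x. \<Sum>k\<in>S. f k x)" if "\<And>k. sq_integrable (f k)" for S :: "'n set" and f :: "'n \<Rightarrow> real \<Rightarrow> complex"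
    using finite[of S] that by induction (auto intro: sq_integrable_add simp: sq_integrable_def[of "\<lambda>x. 0"])
  have Hsq: "sq_integrable (H j)" for j
    unfolding H_def
    by (intro sum_sq sq_integrable_add sq_integrable_diff sq_integrable_cmult p p0) auto
  have H0: "AE \<xi> in lborel. H j \<xi> = 0" for j
  proof (rule AE_zero_if_orthogonal_to_ft_test[OF Hsq])
    fix \<phi> assume \<phi>: "test_function \<phi>"
    let ?I = "\<lambda>l (h :: real \<Rightarrow> complex^'n) k. LBINT \<xi>. ?f l h k \<xi> * cnj (cft \<phi> \<xi>)"
      and ?J = "\<lambda>(v :: real \<Rightarrow> real^'n) k. LBINT x. \<phi> x * v x $ k"
    have cft: "sq_integrable (cft \<phi>)"
      by (intro Plancherel_L1_L2 integrable_of_real sq_integrable_of_real test_function_sq_integrable \<phi>)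
    have int: "integrable lborel (\<lambda>x. \<phi> x * v x $ k)" if "locally_integrable v" for v :: "real \<Rightarrow> real^'n" and k
      using integrable_vec_nth[OF integrable_test_scaleR[OF \<phi> that], of k] by simp
    note ints = int[OF loc(1)] int[OF loc(2)] int[OF loc(3)] int[OF loc(4)]
    have "(LBINT x. \<phi> x * (\<Sum>k\<in>UNIV. A0 $ j $ k * ut x $ k + A1 $ j $ k * ux x $ k + L $ j $ k * u x $ k - B $ j $ k * uxx x $ k)) = 0"
    proof (rule integral_eq_zero_AE)
      show "AE x in lborel. \<phi> x * (\<Sum>k\<in>UNIV. A0 $ j $ k * ut x $ k + A1 $ j $ k * ux x $ k + L $ j $ k * u x $ k - B $ j $ k * uxx x $ k) = 0"
        using pde
      proof eventually_elim
        case (elim x)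
        then have "(A0 *v ut x + A1 *v ux x + L *v u x) $ j = (B *v uxx x) $ j" by simp
        then show ?case by (simp add: matrix_vector_mult_def sum.distrib sum_subtractf)
      qed
    qed
    then have "(\<Sum>k\<in>UNIV. A0 $ j $ k * (?J ut k) + A1 $ j $ k * (?J ux k)
        + L $ j $ k * (?J u k) - B $ j $ k * (?J uxx k)) = 0"
      using ints by (simp add: sum_distrib_left distrib_left right_diff_distrib mult.left_commute[of "\<phi> _"])
    then have "complex_of_real (\<Sum>k\<in>UNIV. A0 $ j $ k * (?J ut k) + A1 $ j $ k * (?J ux k)
        + L $ j $ k * (?J u k) - B $ j $ k * (?J uxx k)) = 0"
      by simp
    then have "(\<Sum>k\<in>UNIV. ?c A0 j k * (?I 0 m k)
        + ?c A1 j k * (?I 1 g k)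
        + ?c L j k * (?I 0 g k)
        - ?c B j k * (?I 2 g k)) = 0"
      unfolding of_real_sum of_real_add of_real_diff of_real_mult
        weak_deriv_pairing[OF m has_weak_deriv_0[OF sq(3)] \<phi>] weak_deriv_pairing[OF g has_weak_deriv_0[OF sq(1)] \<phi>]
        weak_deriv_pairing[OF g ux \<phi>] weak_deriv_pairing[OF g uxx \<phi>] .
    moreover have "(LBINT \<xi>. H j \<xi> * cnj (cft \<phi> \<xi>)) =
      (\<Sum>k\<in>UNIV. ?c A0 j k * (?I 0 m k)
        + ?c A1 j k * (?I 1 g k)
        + ?c L j k * (?I 0 g k)
        - ?c B j k * (?I 2 g k))"
    proof -
      note i = integrable_mult_cnj[OF p0 cft] integrable_mult_cnj[OF p[of 1] cft, simplified one_le_numeral]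
        integrable_mult_cnj[OF p[of 0] cft] integrable_mult_cnj[OF p[of 2] cft]
      have a: "H j \<xi> * cnj (cft \<phi> \<xi>) = (\<Sum>k\<in>UNIV. ?c A0 j k * ((?f 0 m k \<xi>) * cnj (cft \<phi> \<xi>))
        + ?c A1 j k * ((?f 1 g k \<xi>) * cnj (cft \<phi> \<xi>))
        + ?c L j k * ((?f 0 g k \<xi>) * cnj (cft \<phi> \<xi>))
        - ?c B j k * ((?f 2 g k \<xi>) * cnj (cft \<phi> \<xi>)))" for \<xi>
        unfolding H_def sum_distrib_right by (simp only: distrib_right left_diff_distrib mult.assoc)
      show ?thesis unfolding a
        using i(1) i(2) i(3) i(4)
        by (subst Bochner_Integration.integral_sum, (intro Bochner_Integration.integrable_diff Bochner_Integration.integrable_add integrable_mult_right; simp; fail))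
           (rule sum.cong[OF refl], subst Bochner_Integration.integral_diff,
            ((intro Bochner_Integration.integrable_add integrable_mult_right; simp; fail)+),
            subst Bochner_Integration.integral_add, ((intro Bochner_Integration.integrable_add integrable_mult_right; simp; fail)+),
            subst Bochner_Integration.integral_add, ((intro integrable_mult_right; simp; fail)+),
            simp only: integral_mult_right_zero)
    qed
    ultimately show "(LBINT \<xi>. H j \<xi> * cnj (cft \<phi> \<xi>)) = 0" by simp
  qed
  then have "AE \<xi> in lborel. \<forall>j. H j \<xi> = 0" by (simp add: AE_all_countable)
  then show ?thesis
  proof eventually_elim
    case (elim \<xi>)
    show ?case
      unfolding vec_eq_iff
    proof
      fix j
      have "H j \<xi> = 0" using elim by simp
      then show "(cmatvec A0 (m \<xi>) + cmatvec A1 (\<chi> k. \<i> * of_real \<xi> * g \<xi> $ k) + cmatvec L (g \<xi>)) $ j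
         = cmatvec B (\<chi> k. (\<i> * of_real \<xi>)\<^sup>2 * g \<xi> $ k) $ j"
        by (simp add: H_def cmatvec_def sum.distrib sum_subtractf)
    qed
  qed
qed

section \<open>Compensated energy\<close>

lemma inner_matrix_mult: "x \<bullet> (M *v y) = (transpose M *v x) \<bullet> (y :: real^'n)"
  by (metis dot_lmul_matrix transpose_matrix_vector)

lemma symmetric_inner: "symmetric_matrix M \<Longrightarrow> x \<bullet> (M *v y) = y \<bullet> (M *v x)"
  by (simp add: inner_matrix_mult[of x] symmetric_matrix_def inner_commute)

lemma matrix_vector_mult_uminus: "(- M) *v x = - (M *v (x :: real^'n))"
  by (simp add: matrix_vector_mult_def vec_eq_iff sum_negf)

lemma skew_inner: "skew_symmetric_matrix M \<Longrightarrow> x \<bullet> (M *v y) = - (y \<bullet> (M *v x))"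
  by (simp add: inner_matrix_mult[of x] skew_symmetric_matrix_def inner_commute matrix_vector_mult_uminus)

lemma matrix_bound:
  fixes M :: "real^'n^'n"
  obtains C where "0 < C" "\<And>x. norm (M *v x) \<le> C * norm x"
  using bounded_linear.pos_bounded[OF matrix_vector_mul_bounded_linear[of M]]
  by (metis mult.commute)

lemma pos_def_coercive:
  fixes M :: "real^'n^'n"
  assumes "pos_def M"
  obtains c where "0 < c" "\<And>x. c * (norm x)\<^sup>2 \<le> x \<bullet> (M *v x)"
proof -
  have "compact (sphere (0::real^'n) 1)" "sphere (0::real^'n) 1 \<noteq> {}" by auto
  moreover have "continuous_on (sphere (0::real^'n) 1) (\<lambda>x. x \<bullet> (M *v x))"
    by (intro continuous_intros linear_continuous_on matrix_vector_mul_bounded_linear)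
  ultimately obtain e where e: "e \<in> sphere 0 1" "\<And>x. x \<in> sphere 0 1 \<Longrightarrow> e \<bullet> (M *v e) \<le> x \<bullet> (M *v x)"
    using continuous_attains_inf by metis
  show ?thesis
  proof (rule that)
    have "e \<noteq> 0" using e(1) by auto
    then show "0 < e \<bullet> (M *v e)" using assms by (simp add: pos_def_def)
    fix x
    show "e \<bullet> (M *v e) * (norm x)\<^sup>2 \<le> x \<bullet> (M *v x)"
    proof (cases "x = 0")
      case False
      have "e \<bullet> (M *v e) \<le> (x /\<^sub>R norm x) \<bullet> (M *v (x /\<^sub>R norm x))"
        using False by (intro e(2)) simp
      also have "\<dots> = (x \<bullet> (M *v x)) / (norm x)\<^sup>2"
        by (simp add: matrix_vector_mult_scaleR power2_eq_square divide_inverse mult_ac)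
      finally show ?thesis using False by (simp add: field_simps)
    qed simp
  qed
qed

text \<open>Test semidefiniteness with \<open>x - L x / C\<close>, where \<open>C\<close> bounds the operator norm.\<close>

lemma pos_semidef_norm_sq_le:
  fixes M :: "real^'n^'n"
  assumes "pos_semidef M"
  obtains C where "0 < C" "\<And>x. (norm (M *v x))\<^sup>2 \<le> C * (x \<bullet> (M *v x))"
proof -
  obtain C where C: "0 < C" "\<And>x. norm (M *v x) \<le> C * norm x" using matrix_bound[of M] by blast
  have sym: "symmetric_matrix M" using assms by (simp add: pos_semidef_def)
  have "(norm (M *v x))\<^sup>2 \<le> C * (x \<bullet> (M *v x))" for x
  proof -
    define y where "y = M *v x"
    have yMy: "y \<bullet> (M *v y) \<le> C * (norm y)\<^sup>2"
    proof -
      have "y \<bullet> (M *v y) \<le> norm y * norm (M *v y)" by (rule norm_cauchy_schwarz)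
      also have "\<dots> \<le> norm y * (C * norm y)" by (intro mult_left_mono C) simp
      finally show ?thesis by (simp add: power2_eq_square mult_ac)
    qed
    have "0 \<le> (x - (1/C) *\<^sub>R y) \<bullet> (M *v (x - (1/C) *\<^sub>R y))"
      using assms by (simp add: pos_semidef_def)
    also have "\<dots> = x \<bullet> y - (2/C) * (norm y)\<^sup>2 + (1/C)\<^sup>2 * (y \<bullet> (M *v y))"
      using symmetric_inner[OF sym, of x y]
      by (simp add: y_def[symmetric] matrix_vector_mult_diff_distrib matrix_vector_mult_scaleR inner_diff_left inner_diff_right
          dot_square_norm algebra_simps inner_commute power2_eq_square[of "1 / C"])
    also have "\<dots> \<le> x \<bullet> y - (2/C) * (norm y)\<^sup>2 + (1/C)\<^sup>2 * (C * (norm y)\<^sup>2)"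
      by (intro add_left_mono mult_left_mono yMy) simp
    also have "\<dots> = x \<bullet> y - (norm y)\<^sup>2 / C" using C by (simp add: power2_eq_square field_simps)
    finally show ?thesis using C by (simp add: y_def field_simps)
  qed
  with C that show ?thesis by blast
qed

text \<open>The second term is the compensator; the weight \<open>\<xi> / (1 + \<xi>\<^sup>2)\<close> keeps it bounded for large \<open>\<xi>\<close>
  while its derivative still yields dissipation of order \<open>\<xi>\<^sup>2 / (1 + \<xi>\<^sup>2)\<close>.\<close>

definition energy_form :: "real^'n^'n \<Rightarrow> real^'n^'n \<Rightarrow> real \<Rightarrow> real \<Rightarrow>
    real^'n \<Rightarrow> real^'n \<Rightarrow> real^'n \<Rightarrow> real^'n \<Rightarrow> real" where
  "energy_form A0 K \<delta> \<xi> p q p' q' = p \<bullet> (A0 *v p') + q \<bullet> (A0 *v q')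
     + \<delta> * (\<xi> / (1 + \<xi>\<^sup>2)) / 2 * (p' \<bullet> ((K ** A0) *v q) + p \<bullet> ((K ** A0) *v q'))"

lemma young_inequality: "0 < e \<Longrightarrow> a * b \<le> e * a\<^sup>2 + b\<^sup>2 / (4 * (e::real))"
proof -
  assume e: "0 < e"
  have "0 \<le> (2 * e * a - b)\<^sup>2 / (4 * e)" using e by simp
  also have "\<dots> = e * a\<^sup>2 + b\<^sup>2 / (4 * e) - a * b" using e by (simp add: field_simps power2_eq_square)
  finally show ?thesis by simp
qed

text \<open>One estimate for both dissipative matrices: j = 1 serves L and j = \<xi>^2 serves B.
  Young's inequality produces j^2, and the weight 1 / (1 + \<xi>^2) brings it back to the factor j
  with which the matrix occurs in the dissipation. The share \<kappa> / 4 is chosen because p and q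
  each occur in two such terms, so that half of \<kappa> survives.\<close>

lemma compensated_cross_term:
  fixes x y :: "real^'n" and L K :: "real^'n^'n"
  assumes \<kappa>: "0 < \<kappa>" and k: "0 < k" "\<And>x. norm (K *v x) \<le> k * norm x"
    and L: "(norm (L *v x))\<^sup>2 \<le> C * (x \<bullet> (L *v x))" and C: "0 < C" "0 \<le> x \<bullet> (L *v x)"
    and j: "0 \<le> j" "j\<^sup>2 \<le> j * (1 + \<xi>\<^sup>2)"
  shows "\<bar>\<xi> / (1 + \<xi>\<^sup>2)\<bar> * (j * \<bar>y \<bullet> (K *v (L *v x))\<bar>)
    \<le> \<kappa> / 4 * (\<xi>\<^sup>2 / (1 + \<xi>\<^sup>2)) * (norm y)\<^sup>2 + (k\<^sup>2 * C / \<kappa>) * (j * (x \<bullet> (L *v x)))"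
proof -
  define D where "D = 1 + \<xi>\<^sup>2"
  have D: "1 \<le> D" by (simp add: D_def)
  have "\<bar>y \<bullet> (K *v (L *v x))\<bar> \<le> norm y * (k * norm (L *v x))"
    by (rule order_trans[OF Cauchy_Schwarz_ineq2 mult_left_mono[OF k(2)]]) simp
  then have "\<bar>\<xi>\<bar> * (j * \<bar>y \<bullet> (K *v (L *v x))\<bar>) \<le> \<bar>\<xi>\<bar> * (j * (norm y * (k * norm (L *v x))))"
    using j by (intro mult_left_mono) auto
  also have "\<dots> = (\<bar>\<xi>\<bar> * norm y) * (j * k * norm (L *v x))" by simp
  also have "\<dots> \<le> \<kappa> / 4 * (\<bar>\<xi>\<bar> * norm y)\<^sup>2 + (j * k * norm (L *v x))\<^sup>2 / (4 * (\<kappa> / 4))"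
    by (rule young_inequality) (use \<kappa> in simp)
  also have "\<dots> = \<kappa> / 4 * \<xi>\<^sup>2 * (norm y)\<^sup>2 + (k\<^sup>2 / \<kappa>) * (j\<^sup>2 * (norm (L *v x))\<^sup>2)"
    by (simp add: power_mult_distrib mult_ac)
  also have "\<dots> \<le> \<kappa> / 4 * \<xi>\<^sup>2 * (norm y)\<^sup>2 + (k\<^sup>2 / \<kappa>) * ((j * D) * (C * (x \<bullet> (L *v x))))"
    using \<kappa> j C D L unfolding D_def by (intro add_left_mono mult_left_mono mult_mono) auto
  finally have "\<bar>\<xi>\<bar> * (j * \<bar>y \<bullet> (K *v (L *v x))\<bar>) / D \<le> (\<kappa> / 4 * \<xi>\<^sup>2 * (norm y)\<^sup>2 + (k\<^sup>2 / \<kappa>) * ((j * D) * (C * (x \<bullet> (L *v x))))) / D"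
    using D by (intro divide_right_mono) auto
  then show ?thesis unfolding D_def[symmetric] using D by (simp add: add_divide_distrib mult_ac)
qed

lemma abs_xi_div_le_1: "\<bar>\<xi> / (1 + \<xi>\<^sup>2)\<bar> \<le> (1::real)"
proof -
  have "\<bar>\<xi>\<bar> \<le> 1 + \<xi>\<^sup>2" using sum_squares_bound[of "\<bar>\<xi>\<bar>" 1] by (simp; linarith)
  then show ?thesis by (simp add: abs_divide add_pos_nonneg)
qed

text \<open>The plain energy contributes -2 (l + \<xi>^2 b), where \<open>l\<close> and
  \<open>b\<close> are the forms of L and B. The compensator contributes \<delta> times a definite
  part -(\<kappa> / 2) \<rho> N and an error (M + 1) (l + \<xi>^2 b). A small \<delta> lets the
  former dissipation swallow the error.\<close>

theorem energy_estimates: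
  fixes A0 A1 L B K :: "real^'n^'n"
  assumes A0: "pos_def A0" and A1: "symmetric_matrix A1" and L: "pos_semidef L" and B: "pos_semidef B"
    and K: "compensating_function A0 A1 L B K"
  obtains \<delta> c1 c2 c3 where "0 < c1" "0 < c2" "0 < c3"
    "\<And>\<xi> p q. c1 * ((norm p)\<^sup>2 + (norm q)\<^sup>2) \<le> energy_form A0 K \<delta> \<xi> p q p q"
    "\<And>\<xi> p q. energy_form A0 K \<delta> \<xi> p q p q \<le> c2 * ((norm p)\<^sup>2 + (norm q)\<^sup>2)"
    "\<And>\<xi> p q p' q'. A0 *v p' = \<xi> *\<^sub>R (A1 *v q) - L *v p - \<xi>\<^sup>2 *\<^sub>R (B *v p) \<Longrightarrow>
       A0 *v q' = - \<xi> *\<^sub>R (A1 *v p) - L *v q - \<xi>\<^sup>2 *\<^sub>R (B *v q) \<Longrightarrow>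
       2 * energy_form A0 K \<delta> \<xi> p q p' q' \<le> - c3 * (\<xi>\<^sup>2 / (1 + \<xi>\<^sup>2)) * energy_form A0 K \<delta> \<xi> p q p q"
proof -
  let ?a = "\<lambda>x. x \<bullet> (K *v (A1 *v x))"
    and ?l = "\<lambda>x y. x \<bullet> (K *v (L *v y))"
    and ?b = "\<lambda>x y. x \<bullet> (K *v (B *v y))"
    and ?qL = "\<lambda>x. x \<bullet> (L *v x)"
    and ?qB = "\<lambda>x. x \<bullet> (B *v x)"
    and ?s = "\<lambda>x y. x \<bullet> ((K ** A0) *v y)"
    and ?n = "\<lambda>(p::real^'n) (q::real^'n). (norm p)\<^sup>2 + (norm q)\<^sup>2"
    and ?S = "(1/2) *\<^sub>R (K ** A1 + transpose (K ** A1)) + B + L"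
  have skew: "skew_symmetric_matrix (K ** A0)" using K by (simp add: compensating_function_def)
  obtain c0 where c0: "0 < c0" "\<And>x. c0 * (norm x)\<^sup>2 \<le> x \<bullet> (A0 *v x)" using pos_def_coercive[OF A0] by blast
  obtain C0 where C0: "0 < C0" "\<And>x. norm (A0 *v x) \<le> C0 * norm x" using matrix_bound[of A0] by blast
  obtain k0 where k0: "0 < k0" "\<And>x. norm ((K ** A0) *v x) \<le> k0 * norm x" using matrix_bound[of "K ** A0"] by blast
  obtain k where k: "0 < k" "\<And>x. norm (K *v x) \<le> k * norm x" using matrix_bound[of K] by blast
  obtain CL where CL: "0 < CL" "\<And>x. (norm (L *v x))\<^sup>2 \<le> CL * (?qL x)" using pos_semidef_norm_sq_le[OF L] by blast
  obtain CB where CB: "0 < CB" "\<And>x. (norm (B *v x))\<^sup>2 \<le> CB * (?qB x)" using pos_semidef_norm_sq_le[OF B] by blast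
  obtain \<kappa> where \<kappa>: "0 < \<kappa>" "\<And>x. \<kappa> * (norm x)\<^sup>2 \<le> x \<bullet> (?S *v x)"
    using pos_def_coercive K unfolding compensating_function_def by blast
  have \<kappa>': "\<kappa> * (norm x)\<^sup>2 \<le> ?a x + ?qB x + ?qL x" for x
  proof -
    have "x \<bullet> (transpose (K ** A1) *v x) = x \<bullet> ((K ** A1) *v x)"
      by (simp add: inner_matrix_mult[of x "K ** A1"] inner_commute)
    then have "x \<bullet> (?S *v x) = ?a x + ?qB x + ?qL x"
      by (simp add: matrix_vector_mult_add_rdistrib scaleR_matrix_vector_assoc[symmetric] inner_add_right matrix_vector_mul_assoc)
    then show ?thesis using \<kappa>(2)[of x] by simp
  qed
  \<comment> \<open>A common bound for the constants that the cross terms of L and of B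
    produce.\<close>
  define M where "M = max (k\<^sup>2 * CL / \<kappa>) (k\<^sup>2 * CB / \<kappa>)"
  have M: "0 \<le> M" using \<kappa>(1) CL(1) CB(1) by (simp add: M_def le_max_iff_disj)
  have Mb: "k\<^sup>2 * CL / \<kappa> \<le> M" "k\<^sup>2 * CB / \<kappa> \<le> M" by (simp_all add: M_def)
  \<comment> \<open>The bound c0 / k0 keeps the compensator below half of the coercive part of the
    energy, so the two energies are equivalent; the bound 2 / (M + 1) is what the absorption of the
    error requires.\<close>
  define \<delta> where "\<delta> = min (c0 / k0) (2 / (M + 1))"
  let ?E = "energy_form A0 K \<delta>"
  have \<delta>: "0 < \<delta>" "\<delta> * k0 \<le> c0" "\<delta> * (M + 1) \<le> 2"
  proof -
    have "\<delta> \<le> c0 / k0" "\<delta> \<le> 2 / (M + 1)" by (simp_all add: \<delta>_def)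
    then show "\<delta> * k0 \<le> c0" "\<delta> * (M + 1) \<le> 2" using k0 M by (simp_all add: pos_le_divide_eq)
    show "0 < \<delta>" using c0 k0 M by (simp add: \<delta>_def)
  qed
  have cross: "\<bar>\<delta> * r / 2 * (?s p q + ?s p q)\<bar> \<le> (c0 * (?n p q)) / 2"
    if r: "\<bar>r\<bar> \<le> 1" for r p q
  proof -
    have "\<bar>?s p q\<bar> \<le> norm p * (k0 * norm q)"
      by (rule order_trans[OF Cauchy_Schwarz_ineq2 mult_left_mono[OF k0(2)]]) simp
    then have "\<bar>r\<bar> * \<bar>?s p q\<bar> \<le> 1 * (norm p * (k0 * norm q))"
      using r by (intro mult_mono) auto
    then have "\<delta> * (\<bar>r\<bar> * \<bar>?s p q\<bar>) \<le> \<delta> * (1 * (norm p * (k0 * norm q)))"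
      using \<delta> by (intro mult_left_mono) auto
    also have "\<dots> = (\<delta> * k0) * (norm p * norm q)" by simp
    also have "\<dots> \<le> c0 * ((?n p q) / 2)"
      using \<delta> k0 c0 sum_squares_bound[of "norm p" "norm q"] by (intro mult_mono) auto
    finally show ?thesis using \<delta>(1) by (simp add: abs_mult)
  qed
  have upper: "x \<bullet> (A0 *v x) \<le> C0 * (norm x)\<^sup>2" for x
  proof -
    have "x \<bullet> (A0 *v x) \<le> norm x * norm (A0 *v x)" by (rule norm_cauchy_schwarz)
    also have "\<dots> \<le> norm x * (C0 * norm x)" by (intro mult_left_mono C0) simp
    finally show ?thesis by (simp add: power2_eq_square mult_ac)
  qed
  have lo: "c0 / 2 * (?n p q) \<le> ?E \<xi> p q p q" for \<xi> p q
  proof -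
    have "c0 * (?n p q) \<le> p \<bullet> (A0 *v p) + q \<bullet> (A0 *v q)"
      using add_mono[OF c0(2)[of p] c0(2)[of q]] by (simp add: distrib_left)
    moreover have "c0 / 2 * (?n p q) = (c0 * (?n p q)) / 2" by simp
    ultimately show ?thesis
      using abs_le_D2[OF cross[OF abs_xi_div_le_1[of \<xi>], of p q]] unfolding energy_form_def by linarith
  qed
  have hi: "?E \<xi> p q p q \<le> (C0 + c0 / 2) * (?n p q)" for \<xi> p q
  proof -
    have "p \<bullet> (A0 *v p) + q \<bullet> (A0 *v q) \<le> C0 * (?n p q)"
      using add_mono[OF upper[of p] upper[of q]] by (simp add: distrib_left)
    moreover have "(C0 + c0 / 2) * (?n p q) = C0 * (?n p q) + (c0 * (?n p q)) / 2"
      by (simp add: distrib_right)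
    ultimately show ?thesis
      using abs_le_D1[OF cross[OF abs_xi_div_le_1[of \<xi>], of p q]] unfolding energy_form_def by linarith
  qed
  have diss: "2 * ?E \<xi> p q p' q' \<le> - (\<delta> * \<kappa> / 2) * (\<xi>\<^sup>2 / (1 + \<xi>\<^sup>2)) * (?n p q)"
    if p': "A0 *v p' = \<xi> *\<^sub>R (A1 *v q) - L *v p - \<xi>\<^sup>2 *\<^sub>R (B *v p)"
      and q': "A0 *v q' = - \<xi> *\<^sub>R (A1 *v p) - L *v q - \<xi>\<^sup>2 *\<^sub>R (B *v q)" for \<xi> p q p' q'
  proof -
    define r where "r = \<xi> / (1 + \<xi>\<^sup>2)"
    define \<rho> where "\<rho> = \<xi>\<^sup>2 / (1 + \<xi>\<^sup>2)"
    define N where "N = ?n p q"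
    define l where "l = ?qL p + ?qL q"
    define b where "b = ?qB p + ?qB q"
    have Lnn: "0 \<le> ?qL x" "0 \<le> ?qB x" for x using L B by (auto simp: pos_semidef_def)
    have l0: "0 \<le> l" and b0: "0 \<le> b" using Lnn by (auto simp: l_def b_def)
    have \<rho>: "\<rho> = \<xi> * r" "0 \<le> \<rho>" "\<rho> \<le> 1" "\<rho> \<le> \<xi>\<^sup>2"
    proof -
      have D: "0 < 1 + \<xi>\<^sup>2" by (simp add: add_pos_nonneg)
      show "\<rho> = \<xi> * r" by (simp add: \<rho>_def r_def power2_eq_square)
      show "0 \<le> \<rho>" by (simp add: \<rho>_def)
      show "\<rho> \<le> 1" using D by (simp add: \<rho>_def)
      show "\<rho> \<le> \<xi>\<^sup>2" using D mult_left_mono[of 1 "1 + \<xi>\<^sup>2" "\<xi>\<^sup>2"] by (simp add: \<rho>_def pos_divide_le_eq)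
    qed
    have E0: "2 * (p \<bullet> (A0 *v p') + q \<bullet> (A0 *v q')) = - 2 * (l + \<xi>\<^sup>2 * b)"
    proof -
      have "p \<bullet> (A0 *v p') = \<xi> * (p \<bullet> (A1 *v q)) - ?qL p - \<xi>\<^sup>2 * (?qB p)"
        unfolding p' by (simp add: inner_diff_right)
      \<comment> \<open>Symmetry of A1 makes the two transport terms opposite, so they cancel in the
        plain energy.\<close>
      moreover have "q \<bullet> (A0 *v q') = - (\<xi> * (p \<bullet> (A1 *v q))) - ?qL q - \<xi>\<^sup>2 * (?qB q)"
        unfolding q' symmetric_inner[OF A1, of p q] by (simp add: inner_diff_right)
      ultimately show ?thesis by (simp add: l_def b_def distrib_left)
    qed
    \<comment> \<open>Skew-symmetry moves p' behind K A0; only then can the equation for A0 p' be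
      inserted, and both transport terms acquire the same sign.\<close>
    have "?s p' q + ?s p q' = - (q \<bullet> (K *v (A0 *v p'))) + p \<bullet> (K *v (A0 *v q'))"
      using skew_inner[OF skew, of p' q] by (simp add: matrix_vector_mul_assoc)
    also have "\<dots> = - \<xi> * (?a q + ?a p)
       + (?l q p + \<xi>\<^sup>2 * (?b q p) - ?l p q - \<xi>\<^sup>2 * (?b p q))"
    proof -
      have "q \<bullet> (K *v (A0 *v p')) = \<xi> * (?a q) - ?l q p - \<xi>\<^sup>2 * (?b q p)"
        unfolding p' by (simp add: matrix_vector_mult_diff_distrib matrix_vector_mult_scaleR inner_diff_right)
      moreover have "p \<bullet> (K *v (A0 *v q')) = - (\<xi> * (?a p)) - ?l p q - \<xi>\<^sup>2 * (?b p q)"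
        unfolding q' by (simp add: matrix_vector_mult_diff_distrib matrix_vector_mult_scaleR[of K "- \<xi>", simplified] matrix_vector_mult_scaleR inner_diff_right)
      ultimately show ?thesis by (simp add: distrib_left)
    qed
    finally have G: "?s p' q + ?s p q' = - \<xi> * (?a q + ?a p)
       + (?l q p + \<xi>\<^sup>2 * (?b q p) - ?l p q - \<xi>\<^sup>2 * (?b p q))" (is "?G = _ + ?X") .
    have "\<rho> * (\<kappa> * N) \<le> \<rho> * (?a q + ?a p + b + l)"
    proof (rule mult_left_mono)
      show "\<kappa> * N \<le> ?a q + ?a p + b + l"
        using add_mono[OF \<kappa>'[of p] \<kappa>'[of q]] by (simp add: N_def b_def l_def distrib_left)
    qed (rule \<rho>)
    \<comment> \<open>Coercivity of the compensated matrix bounds the forms of K A1 from below only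
      after adding those of L and B; these are subtracted again and reappear here with the factor
      \<rho>.\<close>
    then have main: "r * (- \<xi> * (?a q + ?a p)) \<le> - \<rho> * \<kappa> * N + \<rho> * b + \<rho> * l"
      unfolding \<rho>(1) by (simp add: algebra_simps)
    have j1: "(1::real)\<^sup>2 \<le> 1 * (1 + \<xi>\<^sup>2)" "(\<xi>\<^sup>2)\<^sup>2 \<le> \<xi>\<^sup>2 * (1 + \<xi>\<^sup>2)" by (auto simp: power2_eq_square algebra_simps)
    have XL: "\<bar>r\<bar> * (1 * \<bar>?l y x\<bar>) \<le> \<kappa> / 4 * \<rho> * (norm y)\<^sup>2 + M * (1 * (?qL x))" for x y
      unfolding r_def \<rho>_def
      by (rule order_trans[OF compensated_cross_term[OF \<kappa>(1) k CL(2) CL(1) Lnn(1) zero_le_one j1(1)]])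
         (intro add_left_mono mult_right_mono Mb; simp add: Lnn)
    have XB: "\<bar>r\<bar> * (\<xi>\<^sup>2 * \<bar>?b y x\<bar>) \<le> \<kappa> / 4 * \<rho> * (norm y)\<^sup>2 + M * (\<xi>\<^sup>2 * (?qB x))" for x y
      unfolding r_def \<rho>_def
      by (rule order_trans[OF compensated_cross_term[OF \<kappa>(1) k CB(2) CB(1) Lnn(2) zero_le_power2 j1(2)]])
         (intro add_left_mono mult_right_mono Mb; simp add: Lnn)
    have "\<bar>?X\<bar> \<le> \<bar>?l q p\<bar> + \<xi>\<^sup>2 * \<bar>?b q p\<bar> + \<bar>?l p q\<bar> + \<xi>\<^sup>2 * \<bar>?b p q\<bar>"
      using abs_mult[of "\<xi>\<^sup>2" "?b q p"] abs_mult[of "\<xi>\<^sup>2" "?b p q"] by simp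
    then have "\<bar>r\<bar> * \<bar>?X\<bar> \<le> \<bar>r\<bar> * (\<bar>?l q p\<bar> + \<xi>\<^sup>2 * \<bar>?b q p\<bar> + \<bar>?l p q\<bar> + \<xi>\<^sup>2 * \<bar>?b p q\<bar>)"
      by (rule mult_left_mono) simp
    also have "\<dots> \<le> \<kappa> / 2 * \<rho> * N + M * (l + \<xi>\<^sup>2 * b)"
      using XL[of q p] XL[of p q] XB[of q p] XB[of p q]
      unfolding N_def l_def b_def distrib_left mult_1 by linarith
    finally have rX: "r * ?X \<le> \<kappa> / 2 * \<rho> * N + M * (l + \<xi>\<^sup>2 * b)"
      using abs_ge_self[of "r * ?X"] by (simp only: abs_mult)
    \<comment> \<open>The L term uses \<rho> \<le> 1 and the B term \<rho> \<le> \<xi>^2, so both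
      fit into l + \<xi>^2 b. This accounts for the summand 1 in M + 1.\<close>
    have \<rho>lb: "\<rho> * b \<le> \<xi>\<^sup>2 * b" "\<rho> * l \<le> 1 * l" using \<rho> l0 b0 by (intro mult_right_mono; simp)+
    have rG: "r * ?G \<le> - (\<kappa> / 2) * \<rho> * N + (M + 1) * (l + \<xi>\<^sup>2 * b)"
    proof -
      define T where "T = \<kappa> * \<rho> * N"
      have e: "\<kappa> / 2 * \<rho> * N = T / 2" "- \<rho> * \<kappa> * N = - T" "- (\<kappa> / 2) * \<rho> * N = - (T / 2)"
        "(M + 1) * (l + \<xi>\<^sup>2 * b) = M * (l + \<xi>\<^sup>2 * b) + l + \<xi>\<^sup>2 * b"
        by (simp_all add: T_def distrib_right)
      have "r * ?G = r * (- \<xi> * (?a q + ?a p)) + r * ?X"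
        unfolding G by (rule distrib_left)
      then show ?thesis using rX \<rho>lb main unfolding e mult_1 by linarith
    qed
    have "2 * ?E \<xi> p q p' q' = - 2 * (l + \<xi>\<^sup>2 * b) + \<delta> * (r * ?G)"
      unfolding energy_form_def r_def[symmetric] E0[symmetric] by (simp add: algebra_simps)
    also have "\<dots> \<le> - 2 * (l + \<xi>\<^sup>2 * b) + \<delta> * (- (\<kappa> / 2) * \<rho> * N + (M + 1) * (l + \<xi>\<^sup>2 * b))"
      using rG \<delta> by (intro add_left_mono mult_left_mono) auto
    also have "\<dots> = (\<delta> * (M + 1) - 2) * (l + \<xi>\<^sup>2 * b) - (\<delta> * \<kappa> / 2) * \<rho> * N"
      by (simp add: algebra_simps)
    also have "\<dots> \<le> 0 - (\<delta> * \<kappa> / 2) * \<rho> * N"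
      using \<delta> l0 b0 by (intro diff_right_mono mult_nonpos_nonneg) auto
    finally show ?thesis by (simp add: \<rho>_def N_def)
  qed
  show ?thesis
  \<comment> \<open>The rate is divided by the upper constant C0 + c0 / 2 in order to replace the
    squared norm by the energy itself.\<close>
  proof (rule that[of "c0 / 2" "C0 + c0 / 2" "\<delta> * \<kappa> / 2 / (C0 + c0 / 2)" \<delta>, OF _ _ _ lo hi])
    fix \<xi> p q p' q'
    assume "A0 *v p' = \<xi> *\<^sub>R (A1 *v q) - L *v p - \<xi>\<^sup>2 *\<^sub>R (B *v p)"
       "A0 *v q' = - \<xi> *\<^sub>R (A1 *v p) - L *v q - \<xi>\<^sup>2 *\<^sub>R (B *v q)"
    note diss[OF this]
    also have "- (\<delta> * \<kappa> / 2) * (\<xi>\<^sup>2 / (1 + \<xi>\<^sup>2)) * (?n p q)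
      \<le> - (\<delta> * \<kappa> / 2 / (C0 + c0 / 2)) * (\<xi>\<^sup>2 / (1 + \<xi>\<^sup>2)) * ?E \<xi> p q p q"
    proof -
      have gen: "- a * \<rho> * N \<le> - (a / C) * \<rho> * E" if "0 \<le> a" "0 \<le> \<rho>" "0 < C" "E \<le> C * N" for a \<rho> N C E :: real
      proof -
        have "a / C * \<rho> * E \<le> a / C * \<rho> * (C * N)" using that by (intro mult_left_mono) auto
        then show ?thesis using that by simp
      qed
      show ?thesis
        by (rule gen[OF _ _ _ hi]) (use \<delta> \<kappa> C0 c0 in \<open>auto intro: add_pos_pos\<close>)
    qed
    finally show "2 * ?E \<xi> p q p' q' \<le> - (\<delta> * \<kappa> / 2 / (C0 + c0 / 2)) * (\<xi>\<^sup>2 / (1 + \<xi>\<^sup>2)) * ?E \<xi> p q p q" .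
  qed (use c0 C0 \<delta> \<kappa> in \<open>auto intro!: divide_pos_pos add_pos_pos\<close>)
qed

section \<open>Decay of the Fourier transform\<close>

definition re_vec :: "complex^'n \<Rightarrow> real^'n" where "re_vec z = (\<chi> k. Re (z $ k))"
definition im_vec :: "complex^'n \<Rightarrow> real^'n" where "im_vec z = (\<chi> k. Im (z $ k))"

lemma re_im_vec_linear:
  "re_vec (a *\<^sub>R y + b *\<^sub>R z) = a *\<^sub>R re_vec y + b *\<^sub>R re_vec z"
  "im_vec (a *\<^sub>R y + b *\<^sub>R z) = a *\<^sub>R im_vec y + b *\<^sub>R im_vec z"
  by (simp_all add: re_vec_def im_vec_def vec_eq_iff)

lemma re_im_vec_add:
  "re_vec (y + z) = re_vec y + re_vec z" "im_vec (y + z) = im_vec y + im_vec z"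
  by (simp_all add: re_vec_def im_vec_def vec_eq_iff)

lemma re_im_vec_cmatvec: "re_vec (cmatvec M z) = M *v re_vec z" "im_vec (cmatvec M z) = M *v im_vec z"
  by (simp_all add: re_vec_def im_vec_def cmatvec_def matrix_vector_mult_def vec_eq_iff Re_sum Im_sum)

lemma norm_re_im_vec_sq: "(norm (re_vec z))\<^sup>2 + (norm (im_vec z))\<^sup>2 = (norm z)\<^sup>2"
  by (simp add: norm_vec_sq re_vec_def im_vec_def cmod_power2 sum.distrib)

lemma norm_re_im_vec_le: "norm (re_vec z) \<le> norm z" "norm (im_vec z) \<le> norm z"
proof -
  have "(norm (re_vec z))\<^sup>2 \<le> (norm z)\<^sup>2" "(norm (im_vec z))\<^sup>2 \<le> (norm z)\<^sup>2"
    using norm_re_im_vec_sq[of z] zero_le_power2[of "norm (re_vec z)"] zero_le_power2[of "norm (im_vec z)"] by linarith+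
  then show "norm (re_vec z) \<le> norm z" "norm (im_vec z) \<le> norm z"
    by (auto intro: power2_le_imp_le)
qed

lemma borel_measurable_re_im_vec [measurable (raw)]:
  fixes f :: "'b \<Rightarrow> complex^'n"
  assumes [measurable]: "f \<in> borel_measurable M"
  shows "(\<lambda>x. re_vec (f x)) \<in> borel_measurable M" "(\<lambda>x. im_vec (f x)) \<in> borel_measurable M"
  unfolding re_vec_def im_vec_def by measurable

lemma borel_measurable_matrix_vector [measurable (raw)]:
  fixes f :: "'b \<Rightarrow> real^'n" and A :: "real^'n^'n"
  assumes "f \<in> borel_measurable M"
  shows "(\<lambda>x. A *v f x) \<in> borel_measurable M"
  by (rule measurable_compose[OF assms])
     (intro borel_measurable_continuous_onI linear_continuous_on matrix_vector_mul_bounded_linear)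

text \<open>The polarised energy as a real bilinear form on complex vectors: along a curve, the
  derivative of the energy is twice its value at velocity and state.\<close>

definition energy_bilinear :: "real^'n^'n \<Rightarrow> real^'n^'n \<Rightarrow> real \<Rightarrow> real \<Rightarrow> complex^'n \<Rightarrow> complex^'n \<Rightarrow> real" where
  "energy_bilinear A0 K \<delta> \<xi> y z = energy_form A0 K \<delta> \<xi> (re_vec y) (im_vec y) (re_vec z) (im_vec z)"

lemma energy_bilinear_linear:
  "energy_bilinear A0 K \<delta> \<xi> (a *\<^sub>R x + b *\<^sub>R y) z = a * energy_bilinear A0 K \<delta> \<xi> x z + b * energy_bilinear A0 K \<delta> \<xi> y z"
proof -
  define c where "c = \<delta> * (\<xi> / (1 + \<xi>\<^sup>2)) / 2"
  show ?thesis
    unfolding energy_bilinear_def energy_form_def re_im_vec_linear c_def[symmetric]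
    by (simp only: inner_add_left inner_add_right inner_scaleR_left inner_scaleR_right
        matrix_vector_right_distrib matrix_vector_mult_scaleR distrib_left) (simp add: mult_ac)
qed

lemma energy_bilinear_commute:
  assumes "symmetric_matrix A0"
  shows "energy_bilinear A0 K \<delta> \<xi> y z = energy_bilinear A0 K \<delta> \<xi> z y"
proof -
  define c where "c = \<delta> * (\<xi> / (1 + \<xi>\<^sup>2)) / 2"
  show ?thesis
    unfolding energy_bilinear_def energy_form_def c_def[symmetric]
    by (simp only: symmetric_inner[OF assms, of "re_vec y" "re_vec z"] symmetric_inner[OF assms, of "im_vec y" "im_vec z"]
        add.commute[of "re_vec z \<bullet> ((K ** A0) *v im_vec y)"])
qed

text \<open>The constant is uniform in \<xi> because the weight \<xi> / (1 + \<xi>^2) is at most 1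
  in modulus; integrated over frequencies, the form is therefore bounded on L2.\<close>

lemma energy_bilinear_bound:
  fixes A0 K :: "real^'n^'n"
  obtains C where "0 \<le> C" "\<And>\<xi> y z. \<bar>energy_bilinear A0 K \<delta> \<xi> y z\<bar> \<le> C * (norm y * norm z)"
proof -
  obtain C0 where C0: "0 < C0" "\<And>x. norm (A0 *v x) \<le> C0 * norm x" using matrix_bound[of A0] by blast
  obtain k0 where k0: "0 < k0" "\<And>x. norm ((K ** A0) *v x) \<le> k0 * norm x" using matrix_bound[of "K ** A0"] by blast
  have gen: "\<bar>p \<bullet> (M *v q)\<bar> \<le> c * (a * b)"
    if "0 < c" "\<And>x. norm (M *v x) \<le> c * norm x" "norm p \<le> a" "norm q \<le> b" for M :: "real^'n^'n" and p q a b c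
  proof -
    have "\<bar>p \<bullet> (M *v q)\<bar> \<le> norm p * norm (M *v q)" by (rule Cauchy_Schwarz_ineq2)
    also have "\<dots> \<le> a * (c * b)"
      using that order_trans[OF that(2) mult_left_mono[OF that(4)]] order_trans[OF norm_ge_zero that(3)]
      by (intro mult_mono) auto
    finally show ?thesis by (simp add: mult_ac)
  qed
  have "\<bar>energy_bilinear A0 K \<delta> \<xi> y z\<bar> \<le> (2 * C0 + \<bar>\<delta>\<bar> * k0) * (norm y * norm z)" for \<xi> y z
  proof -
    define r where "r = \<xi> / (1 + \<xi>\<^sup>2)"
    define X where "X = re_vec z \<bullet> ((K ** A0) *v im_vec y) + re_vec y \<bullet> ((K ** A0) *v im_vec z)"
    have 1: "\<bar>re_vec y \<bullet> (A0 *v re_vec z)\<bar> \<le> C0 * (norm y * norm z)" "\<bar>im_vec y \<bullet> (A0 *v im_vec z)\<bar> \<le> C0 * (norm y * norm z)"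
      by (intro gen C0 norm_re_im_vec_le)+
    have "\<bar>re_vec z \<bullet> ((K ** A0) *v im_vec y)\<bar> \<le> k0 * (norm z * norm y)" "\<bar>re_vec y \<bullet> ((K ** A0) *v im_vec z)\<bar> \<le> k0 * (norm y * norm z)"
      by (intro gen k0 norm_re_im_vec_le)+
    then have X: "\<bar>X\<bar> \<le> 2 * (k0 * (norm y * norm z))" unfolding X_def by (simp add: mult.commute[of "norm z"])
    have "\<bar>\<delta>\<bar> * (\<bar>r\<bar> * \<bar>X\<bar>) \<le> \<bar>\<delta>\<bar> * (1 * (2 * (k0 * (norm y * norm z))))"
      using abs_xi_div_le_1[of \<xi>] X unfolding r_def by (intro mult_left_mono mult_mono) auto
    then have "\<bar>\<delta> * r / 2 * X\<bar> \<le> \<bar>\<delta>\<bar> * k0 * (norm y * norm z)" by (simp add: abs_mult)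
    then show ?thesis using 1 unfolding energy_bilinear_def energy_form_def r_def[symmetric] X_def[symmetric]
      by (simp add: distrib_right)
  qed
  moreover have "0 \<le> 2 * C0 + \<bar>\<delta>\<bar> * k0" using C0 k0 by simp
  ultimately show ?thesis using that by blast
qed

lemma borel_measurable_energy_bilinear [measurable (raw)]:
  fixes f g :: "real \<Rightarrow> complex^'n"
  assumes [measurable]: "f \<in> borel_measurable borel" "g \<in> borel_measurable borel"
  shows "(\<lambda>\<xi>. energy_bilinear A0 K \<delta> \<xi> (f \<xi>) (g \<xi>)) \<in> borel_measurable borel"
  unfolding energy_bilinear_def energy_form_def by measurable

lemma integrable_energy_bilinear:
  fixes f g :: "real \<Rightarrow> complex^'n"
  assumes f: "sq_integrable f" and g: "sq_integrable g"
  shows "integrable lborel (\<lambda>\<xi>. energy_bilinear A0 K \<delta> \<xi> (f \<xi>) (g \<xi>))"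
proof -
  obtain C where C: "0 \<le> C" "\<And>\<xi> y z. \<bar>energy_bilinear A0 K \<delta> \<xi> y z\<bar> \<le> C * (norm y * norm z)"
    using energy_bilinear_bound[of A0 K \<delta>] by blast
  note [measurable] = sq_integrable_borel[OF f] sq_integrable_borel[OF g]
  show ?thesis
  proof (rule Bochner_Integration.integrable_bound)
    show "integrable lborel (\<lambda>\<xi>. C * (norm (f \<xi>) * norm (g \<xi>)))"
      by (intro integrable_mult_right integrable_norm_mult_norm f g)
    show "AE \<xi> in lborel. norm (energy_bilinear A0 K \<delta> \<xi> (f \<xi>) (g \<xi>)) \<le> norm (C * (norm (f \<xi>) * norm (g \<xi>)))"
      using C by (auto intro!: AE_I2 order_trans[OF C(2)])
  qed measurable
qed

text \<open>The product rule for a bounded symmetric bilinear form on L2, for derivatives within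
  \<open>T\<close> so that the one-sided derivative at time 0 is included. \<open>D\<close> is the
  error of the difference quotient, and \<open>h\<close> bounds the norm of the increment of the
  curve.\<close>

lemma bilinear_form_has_derivative:
  fixes G :: "real \<Rightarrow> real \<Rightarrow> complex^'n" and Q :: "(real \<Rightarrow> complex^'n) \<Rightarrow> (real \<Rightarrow> complex^'n) \<Rightarrow> real"
  assumes G: "\<And>\<tau>. \<tau> \<in> T \<Longrightarrow> sq_integrable (G \<tau>)" and M: "sq_integrable M" and t: "t \<in> T"
    and lin: "\<And>a b u v w. sq_integrable u \<Longrightarrow> sq_integrable v \<Longrightarrow> sq_integrable w \<Longrightarrow>
       Q (\<lambda>\<xi>. a *\<^sub>R u \<xi> + b *\<^sub>R v \<xi>) w = a * Q u w + b * Q v w"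
    and sym: "\<And>u v. Q u v = Q v u"
    and bound: "\<And>u v. sq_integrable u \<Longrightarrow> sq_integrable v \<Longrightarrow> \<bar>Q u v\<bar> \<le> C * (L2_norm u * L2_norm v)"
    and lim: "((\<lambda>\<tau>. L2_norm (\<lambda>\<xi>. (G \<tau> \<xi> - G t \<xi>) /\<^sub>R (\<tau> - t) - M \<xi>)) \<longlongrightarrow> 0) (at t within T)"
  shows "((\<lambda>\<tau>. Q (G \<tau>) (G \<tau>)) has_real_derivative 2 * Q M (G t)) (at t within T)"
proof -
  define D where "D \<tau> \<xi> = (G \<tau> \<xi> - G t \<xi>) /\<^sub>R (\<tau> - t) - M \<xi>" for \<tau> \<xi>
  define n where "n \<tau> = L2_norm (D \<tau>)" for \<tau>
  define h where "h \<tau> = \<bar>\<tau> - t\<bar> * (n \<tau> + L2_norm M)" for \<tau>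
  have nlim: "(n \<longlongrightarrow> 0) (at t within T)" using lim by (simp add: n_def[abs_def] D_def[abs_def])
  have tlim: "((\<lambda>\<tau>. \<bar>\<tau> - t\<bar>) \<longlongrightarrow> 0) (at t within T)"
  proof -
    have "((\<lambda>\<tau>. \<bar>\<tau> - t\<bar>) \<longlongrightarrow> \<bar>t - t\<bar>) (at t within T)" by (intro tendsto_intros)
    then show ?thesis by simp
  qed
  have hlim: "(h \<longlongrightarrow> 0) (at t within T)"
    unfolding h_def using tendsto_mult[OF tlim tendsto_add[OF nlim tendsto_const[of "L2_norm M"]]] by simp
  have Gt: "sq_integrable (G t)" using G t by blast
  have key: "\<bar>(Q (G \<tau>) (G \<tau>) - Q (G t) (G t)) / (\<tau> - t) - 2 * Q M (G t)\<bar>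
      \<le> \<bar>C\<bar> * (n \<tau> * (h \<tau> + 2 * L2_norm (G t))) + \<bar>C\<bar> * (L2_norm M * h \<tau>)" if \<tau>: "\<tau> \<in> T" "\<tau> \<noteq> t" for \<tau>
  proof -
    have G\<tau>: "sq_integrable (G \<tau>)" using G \<tau> by blast
    have dq: "sq_integrable (\<lambda>\<xi>. (G \<tau> \<xi> - G t \<xi>) /\<^sub>R (\<tau> - t))"
      by (intro sq_integrable_scaleR sq_integrable_diff G\<tau> Gt)
    have D: "sq_integrable (D \<tau>)" unfolding D_def by (intro sq_integrable_diff dq M)
    have diff: "sq_integrable (\<lambda>\<xi>. G \<tau> \<xi> - G t \<xi>)" by (intro sq_integrable_diff G\<tau> Gt)
    have scale: "L2_norm (\<lambda>\<xi>. a *\<^sub>R f \<xi>) = \<bar>a\<bar> * L2_norm f" for a and f :: "real \<Rightarrow> complex^'n"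
      by (simp add: L2_norm_def power_mult_distrib real_sqrt_mult)
    have Geq: "(\<lambda>\<xi>. G \<tau> \<xi> - G t \<xi>) = (\<lambda>\<xi>. (\<tau> - t) *\<^sub>R (D \<tau> \<xi> + M \<xi>))"
      by (rule ext) (use \<tau> in \<open>simp add: D_def\<close>)
    have nG: "L2_norm (\<lambda>\<xi>. G \<tau> \<xi> - G t \<xi>) \<le> h \<tau>"
      unfolding Geq scale h_def n_def by (intro mult_left_mono L2_norm_triangle D M) simp
    have sum: "sq_integrable (\<lambda>\<xi>. G \<tau> \<xi> + G t \<xi>)" by (intro sq_integrable_add G\<tau> Gt)
    have nsum: "L2_norm (\<lambda>\<xi>. G \<tau> \<xi> + G t \<xi>) \<le> h \<tau> + 2 * L2_norm (G t)"
    proof -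
      have "L2_norm (\<lambda>\<xi>. (G \<tau> \<xi> - G t \<xi>) + 2 *\<^sub>R G t \<xi>) \<le> L2_norm (\<lambda>\<xi>. G \<tau> \<xi> - G t \<xi>) + L2_norm (\<lambda>\<xi>. 2 *\<^sub>R G t \<xi>)"
        by (intro L2_norm_triangle diff sq_integrable_scaleR Gt)
      moreover have "(\<lambda>\<xi>. (G \<tau> \<xi> - G t \<xi>) + 2 *\<^sub>R G t \<xi>) = (\<lambda>\<xi>. G \<tau> \<xi> + G t \<xi>)" by (simp add: scaleR_2 fun_eq_iff)
      ultimately show ?thesis using nG by (simp add: scale)
    qed
    have lin1: "Q (\<lambda>\<xi>. u \<xi> + v \<xi>) w = Q u w + Q v w" "Q (\<lambda>\<xi>. u \<xi> - v \<xi>) w = Q u w - Q v w"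
      if "sq_integrable u" "sq_integrable v" "sq_integrable w" for u v w
      using lin[OF that, of 1 1] lin[OF that, of 1 "-1"] by simp_all
    \<comment> \<open>Difference of two squares; dividing the first factor by \<tau> - t turns it
      into the difference quotient \<open>D + M\<close>.\<close>
    have "Q (\<lambda>\<xi>. G \<tau> \<xi> - G t \<xi>) (\<lambda>\<xi>. G \<tau> \<xi> + G t \<xi>) = Q (G \<tau>) (G \<tau>) - Q (G t) (G t)"
      using lin1[OF G\<tau> Gt sum] lin1[OF G\<tau> Gt G\<tau>] lin1[OF G\<tau> Gt Gt] 
      by (simp add: sym[of "G \<tau>" "\<lambda>\<xi>. G \<tau> \<xi> + G t \<xi>"] sym[of "G t" "\<lambda>\<xi>. G \<tau> \<xi> + G t \<xi>"] sym[of "G t" "G \<tau>"])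
    moreover have "Q (\<lambda>\<xi>. G \<tau> \<xi> - G t \<xi>) (\<lambda>\<xi>. G \<tau> \<xi> + G t \<xi>) = (\<tau> - t) * Q (\<lambda>\<xi>. D \<tau> \<xi> + M \<xi>) (\<lambda>\<xi>. G \<tau> \<xi> + G t \<xi>)"
      unfolding Geq using lin[OF sq_integrable_add[OF D M] M sum, of "\<tau> - t" 0] by simp
    ultimately have "Q (G \<tau>) (G \<tau>) - Q (G t) (G t) = (\<tau> - t) * Q (\<lambda>\<xi>. D \<tau> \<xi> + M \<xi>) (\<lambda>\<xi>. G \<tau> \<xi> + G t \<xi>)"
      by linarith
    then have "(Q (G \<tau>) (G \<tau>) - Q (G t) (G t)) / (\<tau> - t) = Q (\<lambda>\<xi>. D \<tau> \<xi> + M \<xi>) (\<lambda>\<xi>. G \<tau> \<xi> + G t \<xi>)"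
      using \<tau> by simp
    also have "\<dots> = Q (D \<tau>) (\<lambda>\<xi>. G \<tau> \<xi> + G t \<xi>) + Q M (\<lambda>\<xi>. G \<tau> \<xi> + G t \<xi>)"
      by (rule lin1(1)[OF D M sum])
    also have "Q M (\<lambda>\<xi>. G \<tau> \<xi> + G t \<xi>) = Q M (\<lambda>\<xi>. G \<tau> \<xi> - G t \<xi>) + 2 * Q M (G t)"
      unfolding sym[of M "G t"] sym[of M "\<lambda>\<xi>. G \<tau> \<xi> + G t \<xi>"] sym[of M "\<lambda>\<xi>. G \<tau> \<xi> - G t \<xi>"]
      using lin1[OF G\<tau> Gt M] by simp
    finally have "(Q (G \<tau>) (G \<tau>) - Q (G t) (G t)) / (\<tau> - t) - 2 * Q M (G t)
       = Q (D \<tau>) (\<lambda>\<xi>. G \<tau> \<xi> + G t \<xi>) + Q M (\<lambda>\<xi>. G \<tau> \<xi> - G t \<xi>)" by simp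
    moreover have "\<bar>Q (D \<tau>) (\<lambda>\<xi>. G \<tau> \<xi> + G t \<xi>)\<bar> \<le> \<bar>C\<bar> * (n \<tau> * (h \<tau> + 2 * L2_norm (G t)))"
      using bound[OF D sum] nsum unfolding n_def
      by (intro order_trans[OF bound[OF D sum]] mult_mono mult_left_mono) auto
    moreover have "\<bar>Q M (\<lambda>\<xi>. G \<tau> \<xi> - G t \<xi>)\<bar> \<le> \<bar>C\<bar> * (L2_norm M * h \<tau>)"
      using nG by (intro order_trans[OF bound[OF M diff]] mult_mono mult_left_mono) auto
    ultimately show ?thesis by linarith
  qed
  have "((\<lambda>\<tau>. (Q (G \<tau>) (G \<tau>) - Q (G t) (G t)) / (\<tau> - t) - 2 * Q M (G t)) \<longlongrightarrow> 0) (at t within T)"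
  proof (rule Lim_null_comparison)
    have "((\<lambda>\<tau>. \<bar>C\<bar> * (n \<tau> * (h \<tau> + 2 * L2_norm (G t))) + \<bar>C\<bar> * (L2_norm M * h \<tau>)) \<longlongrightarrow>
        \<bar>C\<bar> * (0 * (0 + 2 * L2_norm (G t))) + \<bar>C\<bar> * (L2_norm M * 0)) (at t within T)"
      by (intro tendsto_intros nlim hlim)
    then show "((\<lambda>\<tau>. \<bar>C\<bar> * (n \<tau> * (h \<tau> + 2 * L2_norm (G t))) + \<bar>C\<bar> * (L2_norm M * h \<tau>)) \<longlongrightarrow> 0) (at t within T)"
      by simp
    show "\<forall>\<^sub>F \<tau> in at t within T. norm ((Q (G \<tau>) (G \<tau>) - Q (G t) (G t)) / (\<tau> - t) - 2 * Q M (G t))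
       \<le> \<bar>C\<bar> * (n \<tau> * (h \<tau> + 2 * L2_norm (G t))) + \<bar>C\<bar> * (L2_norm M * h \<tau>)"
      unfolding eventually_at_filter using key by (auto intro!: always_eventually)
  qed
  then show ?thesis
    unfolding has_field_derivative_iff by (simp add: LIM_zero_iff)
qed

section \<open>Time derivatives on the Fourier side\<close>

definition sobolev_weight_integrable :: "real \<Rightarrow> (real \<Rightarrow> complex^'n) \<Rightarrow> bool" where
  "sobolev_weight_integrable s g \<longleftrightarrow> integrable lborel (\<lambda>\<xi>. (1 + \<xi>\<^sup>2) powr s * (norm (g \<xi>))\<^sup>2)"

lemma sobolev_weight_integrable_linear:
  assumes g: "sq_integrable g" "sobolev_weight_integrable s g" and h: "sq_integrable h" "sobolev_weight_integrable s h"
  shows "sobolev_weight_integrable s (\<lambda>\<xi>. a *\<^sub>R g \<xi> + b *\<^sub>R h \<xi>)"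
  unfolding sobolev_weight_integrable_def
proof (rule Bochner_Integration.integrable_bound)
  note [measurable] = sq_integrable_borel[OF g(1)] sq_integrable_borel[OF h(1)]
  show "(\<lambda>\<xi>. (1 + \<xi>\<^sup>2) powr s * (norm (a *\<^sub>R g \<xi> + b *\<^sub>R h \<xi>))\<^sup>2) \<in> borel_measurable lborel" by measurable
  show "integrable lborel (\<lambda>\<xi>. 2 * a\<^sup>2 * ((1 + \<xi>\<^sup>2) powr s * (norm (g \<xi>))\<^sup>2) + 2 * b\<^sup>2 * ((1 + \<xi>\<^sup>2) powr s * (norm (h \<xi>))\<^sup>2))"
    using g(2) h(2) unfolding sobolev_weight_integrable_def by (intro Bochner_Integration.integrable_add integrable_mult_right)
  show "AE \<xi> in lborel. norm ((1 + \<xi>\<^sup>2) powr s * (norm (a *\<^sub>R g \<xi> + b *\<^sub>R h \<xi>))\<^sup>2)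
     \<le> norm (2 * a\<^sup>2 * ((1 + \<xi>\<^sup>2) powr s * (norm (g \<xi>))\<^sup>2) + 2 * b\<^sup>2 * ((1 + \<xi>\<^sup>2) powr s * (norm (h \<xi>))\<^sup>2))" (is "AE x in _. ?P x")
  proof (rule AE_I2)
    fix \<xi> :: real
    have "(norm (a *\<^sub>R g \<xi> + b *\<^sub>R h \<xi>))\<^sup>2 \<le> 2 * (norm (a *\<^sub>R g \<xi>))\<^sup>2 + 2 * (norm (b *\<^sub>R h \<xi>))\<^sup>2"
      by (rule norm_add_sq_le)
    also have "\<dots> = 2 * a\<^sup>2 * (norm (g \<xi>))\<^sup>2 + 2 * b\<^sup>2 * (norm (h \<xi>))\<^sup>2" by (simp add: power_mult_distrib)
    finally have "(1 + \<xi>\<^sup>2) powr s * (norm (a *\<^sub>R g \<xi> + b *\<^sub>R h \<xi>))\<^sup>2 \<le> (1 + \<xi>\<^sup>2) powr s * (2 * a\<^sup>2 * (norm (g \<xi>))\<^sup>2 + 2 * b\<^sup>2 * (norm (h \<xi>))\<^sup>2)"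
      by (intro mult_left_mono) auto
    then show "?P \<xi>"
      by (simp add: distrib_left mult_ac)
  qed
qed

lemma L2_norm_le_sobolev_norm:
  assumes g: "is_fourier_L2 u g" and w: "sobolev_weight_integrable s g" and s: "0 \<le> s"
  shows "L2_norm g \<le> sobolev_norm s u"
proof -
  have gsq: "sq_integrable g" using g by (simp add: is_fourier_L2_def)
  have fsq: "sq_integrable (fourier_L2 u)" using is_fourier_L2_fourier_L2[OF g] by (simp add: is_fourier_L2_def)
  note [measurable] = sq_integrable_borel[OF gsq] sq_integrable_borel[OF fsq]
  have "(LBINT \<xi>. (norm (g \<xi>))\<^sup>2) \<le> (LBINT \<xi>. (1 + \<xi>\<^sup>2) powr s * (norm (g \<xi>))\<^sup>2)"
  proof (rule integral_mono)
    show "integrable lborel (\<lambda>\<xi>. (norm (g \<xi>))\<^sup>2)" using gsq by (simp add: sq_integrable_def)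
    show "integrable lborel (\<lambda>\<xi>. (1 + \<xi>\<^sup>2) powr s * (norm (g \<xi>))\<^sup>2)" using w by (simp add: sobolev_weight_integrable_def)
    show "(norm (g \<xi>))\<^sup>2 \<le> (1 + \<xi>\<^sup>2) powr s * (norm (g \<xi>))\<^sup>2" for \<xi>
      using mult_right_mono[of 1 "(1 + \<xi>\<^sup>2) powr s" "(norm (g \<xi>))\<^sup>2"] s by (simp add: ge_one_powr_ge_zero)
  qed
  also have "\<dots> = (LBINT \<xi>. (1 + \<xi>\<^sup>2) powr s * (norm (fourier_L2 u \<xi>))\<^sup>2)"
    by (rule integral_cong_AE) (use fourier_L2_AE_eq[OF g] in auto)
  finally show ?thesis unfolding L2_norm_def sobolev_norm_def by (rule real_sqrt_le_mono)
qed

text \<open>The Sobolev norm is a weighted L2 norm of the transform with weight at least 1 for s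
  \<ge> 0, and the transform of a difference quotient is the difference quotient of the transforms
  by linearity.\<close>

lemma fourier_curve_derivative:
  assumes d: "sobolev_has_deriv s U V" and s: "0 \<le> s"
    and G: "\<And>\<tau>. 0 \<le> \<tau> \<Longrightarrow> is_fourier_L2 (U \<tau>) (G \<tau>)" "\<And>\<tau>. 0 \<le> \<tau> \<Longrightarrow> sobolev_weight_integrable s (G \<tau>)"
    and M: "is_fourier_L2 (V t) M" "sobolev_weight_integrable s M" and t: "0 \<le> t"
  shows "((\<lambda>\<tau>. L2_norm (\<lambda>\<xi>. (G \<tau> \<xi> - G t \<xi>) /\<^sub>R (\<tau> - t) - M \<xi>)) \<longlongrightarrow> 0) (at t within {0..})"
proof (rule tendsto_sandwich[OF _ _ tendsto_const])
  show "((\<lambda>\<tau>. sobolev_norm s (\<lambda>x. (U \<tau> x - U t x) /\<^sub>R (\<tau> - t) - V t x)) \<longlongrightarrow> 0) (at t within {0..})"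
    using d t by (simp add: sobolev_has_deriv_def)
  have le: "L2_norm (\<lambda>\<xi>. (G \<tau> \<xi> - G t \<xi>) /\<^sub>R (\<tau> - t) - M \<xi>)
      \<le> sobolev_norm s (\<lambda>x. (U \<tau> x - U t x) /\<^sub>R (\<tau> - t) - V t x)" if \<tau>: "0 \<le> \<tau>" for \<tau>
  proof (rule L2_norm_le_sobolev_norm[OF _ _ s])
    define a where "a = inverse (\<tau> - t)"
    have e: "(\<lambda>\<xi>. (f \<xi> - g \<xi>) /\<^sub>R (\<tau> - t) - h \<xi>) = (\<lambda>\<xi>. 1 *\<^sub>R (a *\<^sub>R f \<xi> + (- a) *\<^sub>R g \<xi>) + (- 1) *\<^sub>R h \<xi>)"
      for f g h :: "real \<Rightarrow> 'b::real_vector"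
      by (simp add: a_def scaleR_diff_right)
    have l1: "is_fourier_L2 (\<lambda>x. a *\<^sub>R U \<tau> x + (- a) *\<^sub>R U t x) (\<lambda>\<xi>. a *\<^sub>R G \<tau> \<xi> + (- a) *\<^sub>R G t \<xi>)"
      by (rule is_fourier_L2_linear[OF G(1)[OF \<tau>] G(1)[OF t]])
    show "is_fourier_L2 (\<lambda>x. (U \<tau> x - U t x) /\<^sub>R (\<tau> - t) - V t x) (\<lambda>\<xi>. (G \<tau> \<xi> - G t \<xi>) /\<^sub>R (\<tau> - t) - M \<xi>)"
      unfolding e by (rule is_fourier_L2_linear[OF l1 M(1)])
    have sq: "sq_integrable (G \<tau>)" "sq_integrable (G t)" "sq_integrable M"
      using G(1)[OF \<tau>] G(1)[OF t] M(1) by (auto simp: is_fourier_L2_def)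
    show "sobolev_weight_integrable s (\<lambda>\<xi>. (G \<tau> \<xi> - G t \<xi>) /\<^sub>R (\<tau> - t) - M \<xi>)"
      unfolding e
      by (intro sobolev_weight_integrable_linear sq_integrable_add sq_integrable_scaleR sq G(2) M(2) \<tau> t)
  qed
  show "\<forall>\<^sub>F \<tau> in at t within {0..}. L2_norm (\<lambda>\<xi>. (G \<tau> \<xi> - G t \<xi>) /\<^sub>R (\<tau> - t) - M \<xi>)
      \<le> sobolev_norm s (\<lambda>x. (U \<tau> x - U t x) /\<^sub>R (\<tau> - t) - V t x)"
    unfolding eventually_at_filter using le by (auto intro!: always_eventually)
qed simp

text \<open>Gronwall's inequality for the energy integrated over a time-independent set
  \<open>S\<close> of frequencies on which the rate is at least \<open>r\<close>. The integrated
  energy is a bounded bilinear form on L2, so it is differentiable in time whenever the curve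
  is.\<close>

lemma weighted_energy_decay:
  fixes G M :: "real \<Rightarrow> real \<Rightarrow> complex^'n" and A0 K :: "real^'n^'n" and \<delta> :: real
  defines "E \<equiv> energy_bilinear A0 K \<delta>"
  assumes A0: "symmetric_matrix A0"
    and G: "\<And>\<tau>. 0 \<le> \<tau> \<Longrightarrow> sq_integrable (G \<tau>)" and M: "\<And>\<tau>. 0 \<le> \<tau> \<Longrightarrow> sq_integrable (M \<tau>)"
    and deriv: "\<And>t. 0 \<le> t \<Longrightarrow> ((\<lambda>\<tau>. L2_norm (\<lambda>\<xi>. (G \<tau> \<xi> - G t \<xi>) /\<^sub>R (\<tau> - t) - M t \<xi>)) \<longlongrightarrow> 0) (at t within {0..})"
    and pos: "\<And>\<xi> z. 0 \<le> E \<xi> z z"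
    and diss: "\<And>t. 0 < t \<Longrightarrow> AE \<xi> in lborel. 2 * E \<xi> (M t \<xi>) (G t \<xi>) \<le> - (\<rho> \<xi>) * E \<xi> (G t \<xi>) (G t \<xi>)"
    and S: "S \<in> sets borel" "\<And>\<xi>. \<xi> \<in> S \<Longrightarrow> r \<le> \<rho> \<xi>"
    and t: "0 \<le> t"
  shows "(LBINT \<xi>. indicator S \<xi> * E \<xi> (G t \<xi>) (G t \<xi>))
    \<le> exp (- (r * t)) * (LBINT \<xi>. indicator S \<xi> * E \<xi> (G 0 \<xi>) (G 0 \<xi>))"
proof -
  define Q where "Q u v = (LBINT \<xi>. indicator S \<xi> * E \<xi> (u \<xi>) (v \<xi>))" for u v
  have int: "integrable lborel (\<lambda>\<xi>. indicator S \<xi> * E \<xi> (u \<xi>) (v \<xi>))" if "sq_integrable u" "sq_integrable v" for u v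
    using integrable_real_mult_indicator[OF _ integrable_energy_bilinear[OF that, of A0 K \<delta>], of S] S(1)
    by (simp add: E_def mult.commute)
  obtain C where C: "0 \<le> C" "\<And>\<xi> y z. \<bar>E \<xi> y z\<bar> \<le> C * (norm y * norm z)"
    unfolding E_def using energy_bilinear_bound[of A0 K \<delta>] by blast
  have Qlin: "Q (\<lambda>\<xi>. a *\<^sub>R u \<xi> + b *\<^sub>R v \<xi>) w = a * Q u w + b * Q v w"
    if u: "sq_integrable u" and v: "sq_integrable v" and w: "sq_integrable w" for a b u v w
  proof -
    have "Q (\<lambda>\<xi>. a *\<^sub>R u \<xi> + b *\<^sub>R v \<xi>) w =
       (LBINT \<xi>. a * (indicator S \<xi> * E \<xi> (u \<xi>) (w \<xi>)) + b * (indicator S \<xi> * E \<xi> (v \<xi>) (w \<xi>)))"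
      unfolding Q_def E_def energy_bilinear_linear by (simp only: distrib_left mult.left_commute)
    then show ?thesis unfolding Q_def using int[OF u w] int[OF v w] by simp
  qed
  have Qsym: "Q u v = Q v u" for u v
    unfolding Q_def E_def by (subst energy_bilinear_commute[OF A0]) (rule refl)
  have Qbound: "\<bar>Q u v\<bar> \<le> C * (L2_norm u * L2_norm v)" if u: "sq_integrable u" and v: "sq_integrable v" for u v
  proof -
    have "\<bar>Q u v\<bar> \<le> (LBINT \<xi>. C * (norm (u \<xi>) * norm (v \<xi>)))"
      unfolding Q_def
    proof (rule order_trans[OF integral_abs_bound integral_mono])
      show "integrable lborel (\<lambda>\<xi>. \<bar>indicator S \<xi> * E \<xi> (u \<xi>) (v \<xi>)\<bar>)" using int[OF u v] by simp
      show "integrable lborel (\<lambda>\<xi>. C * (norm (u \<xi>) * norm (v \<xi>)))"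
        by (intro integrable_mult_right integrable_norm_mult_norm u v)
      fix \<xi>
      show "\<bar>indicator S \<xi> * E \<xi> (u \<xi>) (v \<xi>)\<bar> \<le> C * (norm (u \<xi>) * norm (v \<xi>))"
        using C(2)[of \<xi> "u \<xi>" "v \<xi>"] C(1) by (auto simp: indicator_def)
    qed
    also have "\<dots> \<le> C * (L2_norm u * L2_norm v)"
      using L2_Cauchy_Schwarz[OF u v] C(1) by (simp add: mult_left_mono)
    finally show ?thesis .
  qed
  define F where "F \<tau> = Q (G \<tau>) (G \<tau>)" for \<tau>
  have dF: "(F has_real_derivative 2 * Q (M \<tau>) (G \<tau>)) (at \<tau> within {0..})" if "0 \<le> \<tau>" for \<tau>
    unfolding F_def
    by (rule bilinear_form_has_derivative[where C=C])
       (use that G M deriv Qlin Qsym Qbound in auto)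
  have dle: "2 * Q (M \<tau>) (G \<tau>) \<le> - r * F \<tau>" if "0 < \<tau>" for \<tau>
  proof -
    have sq: "sq_integrable (M \<tau>)" "sq_integrable (G \<tau>)" using that G M by auto
    have "2 * Q (M \<tau>) (G \<tau>) = (LBINT \<xi>. 2 * (indicator S \<xi> * E \<xi> (M \<tau> \<xi>) (G \<tau> \<xi>)))"
      by (simp add: Q_def)
    also have "\<dots> \<le> (LBINT \<xi>. - r * (indicator S \<xi> * E \<xi> (G \<tau> \<xi>) (G \<tau> \<xi>)))"
    proof (rule integral_mono_AE)
      show "integrable lborel (\<lambda>\<xi>. 2 * (indicator S \<xi> * E \<xi> (M \<tau> \<xi>) (G \<tau> \<xi>)))"
        "integrable lborel (\<lambda>\<xi>. - r * (indicator S \<xi> * E \<xi> (G \<tau> \<xi>) (G \<tau> \<xi>)))"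
        by (intro integrable_mult_right int sq)+
      show "AE \<xi> in lborel. 2 * (indicator S \<xi> * E \<xi> (M \<tau> \<xi>) (G \<tau> \<xi>)) \<le> - r * (indicator S \<xi> * E \<xi> (G \<tau> \<xi>) (G \<tau> \<xi>))"
        using diss[OF that]
      proof eventually_elim
        case (elim \<xi>)
        show ?case
        proof (cases "\<xi> \<in> S")
          case True
          have "r * E \<xi> (G \<tau> \<xi>) (G \<tau> \<xi>) \<le> \<rho> \<xi> * E \<xi> (G \<tau> \<xi>) (G \<tau> \<xi>)"
            by (intro mult_right_mono S(2) True pos)
          then show ?thesis using elim True by simp
        qed simp
      qed
    qed
    also have "\<dots> = - r * F \<tau>" unfolding F_def Q_def by (rule integral_mult_right_zero)
    finally show ?thesis .
  qed
  define \<phi> where "\<phi> \<tau> = exp (r * \<tau>) * F \<tau>" for \<tau>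
  \<comment> \<open>The dissipation inequality is known only for positive times, so monotonicity is
    derived on the open interval and continuity of \<open>F\<close> covers the endpoint 0.\<close>
  have "\<phi> t \<le> \<phi> 0"
  proof (rule DERIV_nonpos_imp_decreasing_open[OF t])
    fix x assume x: "0 < x" "x < t"
    have "at x within {0..} = at x" by (rule at_within_interior) (use x in simp)
    then have "(F has_real_derivative 2 * Q (M x) (G x)) (at x)" using dF[of x] x by simp
    then have "(\<phi> has_real_derivative (r * exp (r * x)) * F x + exp (r * x) * (2 * Q (M x) (G x))) (at x)"
      unfolding \<phi>_def by (auto intro!: derivative_eq_intros)
    moreover have "(r * exp (r * x)) * F x + exp (r * x) * (2 * Q (M x) (G x)) \<le> 0"
    proof -
      have "exp (r * x) * (2 * Q (M x) (G x)) \<le> exp (r * x) * (- r * F x)"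
        by (intro mult_left_mono dle x) simp
      then show ?thesis by (simp add: mult_ac)
    qed
    ultimately show "\<exists>y. (\<phi> has_real_derivative y) (at x) \<and> y \<le> 0" by (intro exI conjI)
  next
    have "continuous_on {0..} F"
      unfolding continuous_on_eq_continuous_within using dF by (auto intro: DERIV_continuous)
    then have "continuous_on {0..t} F" by (rule continuous_on_subset) auto
    then show "continuous_on {0..t} \<phi>" unfolding \<phi>_def by (intro continuous_intros)
  qed
  then have "exp (r * t) * F t \<le> F 0" by (simp add: \<phi>_def)
  then have "exp (- (r * t)) * (exp (r * t) * F t) \<le> exp (- (r * t)) * F 0"
    by (intro mult_left_mono) auto
  moreover have "exp (- (r * t)) * (exp (r * t) * F t) = F t"
    by (simp add: exp_minus)
  ultimately show ?thesis unfolding F_def Q_def by simp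
qed

text \<open>The integrated estimate is applied to the sets on which the pointwise one fails, with rational rates.
  This avoids differentiating \<open>U\<close> in time at a fixed frequency, where its Fourier transform is only
  defined up to null sets; passing to rational rates costs half of the rate.\<close>

lemma pointwise_energy_decay:
  fixes G M :: "real \<Rightarrow> real \<Rightarrow> complex^'n" and A0 K :: "real^'n^'n" and \<delta> :: real
  defines "E \<equiv> energy_bilinear A0 K \<delta>"
  assumes A0: "symmetric_matrix A0"
    and G: "\<And>\<tau>. 0 \<le> \<tau> \<Longrightarrow> sq_integrable (G \<tau>)" and M: "\<And>\<tau>. 0 \<le> \<tau> \<Longrightarrow> sq_integrable (M \<tau>)"
    and deriv: "\<And>t. 0 \<le> t \<Longrightarrow> ((\<lambda>\<tau>. L2_norm (\<lambda>\<xi>. (G \<tau> \<xi> - G t \<xi>) /\<^sub>R (\<tau> - t) - M t \<xi>)) \<longlongrightarrow> 0) (at t within {0..})"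
    and pos: "\<And>\<xi> z. 0 \<le> E \<xi> z z"
    and diss: "\<And>t. 0 < t \<Longrightarrow> AE \<xi> in lborel. 2 * E \<xi> (M t \<xi>) (G t \<xi>) \<le> - (\<rho> \<xi>) * E \<xi> (G t \<xi>) (G t \<xi>)"
    and \<rho> [measurable]: "\<rho> \<in> borel_measurable borel" and \<rho>pos: "AE \<xi> in lborel. 0 < \<rho> \<xi>"
    and t: "0 \<le> t"
  shows "AE \<xi> in lborel. E \<xi> (G t \<xi>) (G t \<xi>) \<le> exp (- (\<rho> \<xi> / 2 * t)) * E \<xi> (G 0 \<xi>) (G 0 \<xi>)"
proof -
  note [measurable] = sq_integrable_borel[OF G[OF t]] sq_integrable_borel[OF G[OF order_refl]]
  have r: "AE \<xi> in lborel. r \<le> \<rho> \<xi> \<longrightarrow> E \<xi> (G t \<xi>) (G t \<xi>) \<le> exp (- (r * t)) * E \<xi> (G 0 \<xi>) (G 0 \<xi>)" for r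
  proof -
    define f where "f \<xi> = E \<xi> (G t \<xi>) (G t \<xi>) - exp (- (r * t)) * E \<xi> (G 0 \<xi>) (G 0 \<xi>)" for \<xi>
    define S where "S = {\<xi>. r \<le> \<rho> \<xi> \<and> 0 < f \<xi>}"
    have [measurable]: "f \<in> borel_measurable borel" unfolding f_def E_def by measurable
    have S [measurable]: "S \<in> sets borel" unfolding S_def by measurable
    have int: "integrable lborel (\<lambda>\<xi>. indicator S \<xi> * E \<xi> (G \<tau> \<xi>) (G \<tau> \<xi>))" if "0 \<le> \<tau>" for \<tau>
      using integrable_real_mult_indicator[OF _ integrable_energy_bilinear[OF G[OF that] G[OF that], of A0 K \<delta>], of S] S
      by (simp add: E_def mult.commute)
    have eq: "indicator S \<xi> * f \<xi> = indicator S \<xi> * E \<xi> (G t \<xi>) (G t \<xi>) - exp (- (r * t)) * (indicator S \<xi> * E \<xi> (G 0 \<xi>) (G 0 \<xi>))" for \<xi>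
      by (simp add: f_def right_diff_distrib)
    have intf: "integrable lborel (\<lambda>\<xi>. indicator S \<xi> * f \<xi>)"
      unfolding eq using int[OF t] int[of 0] by simp
    have "(LBINT \<xi>. indicator S \<xi> * f \<xi>) \<le> 0"
      unfolding eq using int[OF t] int[of 0]
        weighted_energy_decay[of A0 G M K \<delta> \<rho> S r t, folded E_def, OF A0 G M deriv pos diss S _ t]
      by (simp add: S_def)
    moreover have nn: "0 \<le> indicator S \<xi> * f \<xi>" for \<xi> by (auto simp: S_def indicator_def)
    ultimately have "(LBINT \<xi>. indicator S \<xi> * f \<xi>) = 0"
      by (intro antisym integral_nonneg_AE) auto
    then have "AE \<xi> in lborel. indicator S \<xi> * f \<xi> = 0"
      using intf nn by (subst (asm) integral_nonneg_eq_0_iff_AE) auto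
    then show ?thesis
    proof eventually_elim
      case (elim \<xi>)
      show ?case
      proof
        assume "r \<le> \<rho> \<xi>"
        then have "\<not> 0 < f \<xi>" using elim by (auto simp: S_def indicator_def)
        then show "E \<xi> (G t \<xi>) (G t \<xi>) \<le> exp (- (r * t)) * E \<xi> (G 0 \<xi>) (G 0 \<xi>)" by (simp add: f_def)
      qed
    qed
  qed
  have "AE \<xi> in lborel. \<forall>r\<in>\<rat>. r \<le> \<rho> \<xi> \<longrightarrow> E \<xi> (G t \<xi>) (G t \<xi>) \<le> exp (- (r * t)) * E \<xi> (G 0 \<xi>) (G 0 \<xi>)"
    by (subst AE_ball_countable) (use r countable_rat in auto)
  then show ?thesis
    using \<rho>pos
  proof eventually_elim
    case (elim \<xi>)
    obtain r where "r \<in> \<rat>" "\<rho> \<xi> / 2 < r" "r < \<rho> \<xi>"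
      using Rats_dense_in_real[of "\<rho> \<xi> / 2" "\<rho> \<xi>"] elim(2) by auto
    then have "E \<xi> (G t \<xi>) (G t \<xi>) \<le> exp (- (r * t)) * E \<xi> (G 0 \<xi>) (G 0 \<xi>)" using elim(1) by auto
    also have "\<dots> \<le> exp (- (\<rho> \<xi> / 2 * t)) * E \<xi> (G 0 \<xi>) (G 0 \<xi>)"
      using mult_right_mono[of "\<rho> \<xi> / 2" r t] \<open>\<rho> \<xi> / 2 < r\<close> t by (intro mult_right_mono pos) simp
    finally show ?case .
  qed
qed

lemma sobolev_weight_mono:
  assumes g: "sq_integrable g" "sobolev_weight_integrable s g" and "s' \<le> s"
  shows "sobolev_weight_integrable s' g"
  unfolding sobolev_weight_integrable_def
proof (rule Bochner_Integration.integrable_bound)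
  note [measurable] = sq_integrable_borel[OF g(1)]
  show "integrable lborel (\<lambda>\<xi>. (1 + \<xi>\<^sup>2) powr s * (norm (g \<xi>))\<^sup>2)"
    using g(2) by (simp add: sobolev_weight_integrable_def)
  show "(\<lambda>\<xi>. (1 + \<xi>\<^sup>2) powr s' * (norm (g \<xi>))\<^sup>2) \<in> borel_measurable lborel" by measurable
  show "AE \<xi> in lborel. norm ((1 + \<xi>\<^sup>2) powr s' * (norm (g \<xi>))\<^sup>2) \<le> norm ((1 + \<xi>\<^sup>2) powr s * (norm (g \<xi>))\<^sup>2)"
    using assms(3) by (auto intro!: AE_I2 mult_right_mono powr_mono)
qed

lemma sobolev_fourier:
  assumes "u \<in> sobolev s"
  shows "is_fourier_L2 u (fourier_L2 u)" "sobolev_weight_integrable s (fourier_L2 u)"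
proof -
  obtain g where g: "is_fourier_L2 u g" "sobolev_weight_integrable s g"
    using assms by (auto simp: sobolev_def sobolev_weight_integrable_def)
  show f: "is_fourier_L2 u (fourier_L2 u)" by (rule is_fourier_L2_fourier_L2[OF g(1)])
  have [measurable]: "g \<in> borel_measurable borel" "fourier_L2 u \<in> borel_measurable borel"
    using g f by (auto simp: is_fourier_L2_def sq_integrable_borel)
  show "sobolev_weight_integrable s (fourier_L2 u)"
    unfolding sobolev_weight_integrable_def
    by (rule integrable_cong_AE_imp[OF g(2)[unfolded sobolev_weight_integrable_def]])
       (use fourier_L2_AE_eq[OF g(1)] in auto)
qed

text \<open>The constants are fixed before the solution and the time, since they come from the
  matrices alone; the exceptional null set may depend on the time.\<close>

theorem fourier_decay:
  fixes A0 A1 L B :: "real^'n^'n"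
  assumes A0: "pos_def A0" and A1: "symmetric_matrix A1" and L: "pos_semidef L" and B: "pos_semidef B"
    and K: "compensating_function A0 A1 L B K" and s: "2 \<le> s"
  obtains C k where "0 < C" "0 < k"
    "\<And>U0 U t. cauchy_solution A0 A1 L B s U0 U \<Longrightarrow> 0 \<le> t \<Longrightarrow>
       AE \<xi> in lborel. (norm (fourier_L2 (U t) \<xi>))\<^sup>2
         \<le> C * exp (- (k * (\<xi>\<^sup>2 / (1 + \<xi>\<^sup>2)) * t)) * (norm (fourier_L2 (U 0) \<xi>))\<^sup>2"
proof -
  obtain \<delta> c1 c2 c3 where c: "0 < c1" "0 < c2" "0 < c3"
    and lo: "\<And>\<xi> p q. c1 * ((norm p)\<^sup>2 + (norm q)\<^sup>2) \<le> energy_form A0 K \<delta> \<xi> p q p q"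
    and hi: "\<And>\<xi> p q. energy_form A0 K \<delta> \<xi> p q p q \<le> c2 * ((norm p)\<^sup>2 + (norm q)\<^sup>2)"
    and diss: "\<And>\<xi> p q p' q'. A0 *v p' = \<xi> *\<^sub>R (A1 *v q) - L *v p - \<xi>\<^sup>2 *\<^sub>R (B *v p) \<Longrightarrow>
       A0 *v q' = - \<xi> *\<^sub>R (A1 *v p) - L *v q - \<xi>\<^sup>2 *\<^sub>R (B *v q) \<Longrightarrow>
       2 * energy_form A0 K \<delta> \<xi> p q p' q' \<le> - c3 * (\<xi>\<^sup>2 / (1 + \<xi>\<^sup>2)) * energy_form A0 K \<delta> \<xi> p q p q"
    by (rule energy_estimates[OF A0 A1 L B K]) (rule that; assumption)
  have symA0: "symmetric_matrix A0" using A0 by (simp add: pos_def_def)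
  define E where "E = energy_bilinear A0 K \<delta>"
  have Elo: "c1 * (norm z)\<^sup>2 \<le> E \<xi> z z" and Ehi: "E \<xi> z z \<le> c2 * (norm z)\<^sup>2" for \<xi> z
    using lo[of "re_vec z" "im_vec z" \<xi>] hi[of \<xi> "re_vec z" "im_vec z"]
    by (simp_all add: E_def energy_bilinear_def norm_re_im_vec_sq)
  have Epos: "0 \<le> E \<xi> z z" for \<xi> z
    using order_trans[OF _ Elo[of z \<xi>], of 0] c by simp
  define \<rho> where "\<rho> \<xi> = c3 * (\<xi>\<^sup>2 / (1 + \<xi>\<^sup>2))" for \<xi> :: real
  show ?thesis
  \<comment> \<open>c2 / c1 is the price of passing from the norm to the energy and back; c3 / 2 is
    half of the energy rate, the loss incurred in the pointwise decay.\<close>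
  proof (rule that[of "c2 / c1" "c3 / 2"])
    show "0 < c2 / c1" "0 < c3 / 2" using c by auto
    fix U0 U t
    assume sol: "cauchy_solution A0 A1 L B s U0 U" and t: "0 \<le> (t::real)"
    obtain Ut Ux Uxx where d: "sobolev_has_deriv (s - 2) U Ut"
      and pde: "\<And>t. 0 < t \<Longrightarrow> has_weak_deriv 1 (U t) (Ux t) \<and> has_weak_deriv 2 (U t) (Uxx t) \<and>
           (AE x in lborel. A0 *v Ut t x + A1 *v Ux t x + L *v U t x = B *v Uxx t x)"
      using sol by (auto simp: cauchy_solution_def)
    have Us: "U \<tau> \<in> sobolev s" "Ut \<tau> \<in> sobolev (s - 2)" if "0 \<le> \<tau>" for \<tau>
      using sol d that by (auto simp: cauchy_solution_def sobolev_continuous_def sobolev_has_deriv_def)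
    define G where "G \<tau> = fourier_L2 (U \<tau>)" for \<tau>
    define M where "M \<tau> = fourier_L2 (Ut \<tau>)" for \<tau>
    have G: "is_fourier_L2 (U \<tau>) (G \<tau>)" "sobolev_weight_integrable s (G \<tau>)" if "0 \<le> \<tau>" for \<tau>
      unfolding G_def using sobolev_fourier[OF Us(1)[OF that]] by auto
    have M: "is_fourier_L2 (Ut \<tau>) (M \<tau>)" "sobolev_weight_integrable (s - 2) (M \<tau>)" if "0 \<le> \<tau>" for \<tau>
      unfolding M_def using sobolev_fourier[OF Us(2)[OF that]] by auto
    have sq: "sq_integrable (G \<tau>)" "sq_integrable (M \<tau>)" if "0 \<le> \<tau>" for \<tau>
      using G(1)[OF that] M(1)[OF that] by (auto simp: is_fourier_L2_def)
    have G2: "sobolev_weight_integrable (s - 2) (G \<tau>)" if "0 \<le> \<tau>" for \<tau>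
      by (rule sobolev_weight_mono[OF sq(1)[OF that] G(2)[OF that]]) simp
    have deriv: "((\<lambda>\<tau>. L2_norm (\<lambda>\<xi>. (G \<tau> \<xi> - G x \<xi>) /\<^sub>R (\<tau> - x) - M x \<xi>)) \<longlongrightarrow> 0) (at x within {0..})" if "0 \<le> x" for x
      by (rule fourier_curve_derivative[OF d _ G(1) G2 M[OF that] that]) (use s in auto)
    have dissE: "AE \<xi> in lborel. 2 * E \<xi> (M x \<xi>) (G x \<xi>) \<le> - (\<rho> \<xi>) * E \<xi> (G x \<xi>) (G x \<xi>)" if x: "0 < x" for x
    proof -
      have "AE \<xi> in lborel. cmatvec A0 (M x \<xi>) + cmatvec A1 (\<chi> k. \<i> * of_real \<xi> * G x \<xi> $ k)
         + cmatvec L (G x \<xi>) = cmatvec B (\<chi> k. (\<i> * of_real \<xi>)\<^sup>2 * G x \<xi> $ k)"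
        by (rule fourier_system[where s=s and ut="Ut x" and u="U x" and ux="Ux x" and uxx="Uxx x"])
           (use pde[OF x] G[of x] M[of x] x s in \<open>auto simp: sobolev_weight_integrable_def\<close>)
      then show ?thesis
      proof eventually_elim
        case (elim \<xi>)
        define p where "p = re_vec (G x \<xi>)"
        define q where "q = im_vec (G x \<xi>)"
        define p' where "p' = re_vec (M x \<xi>)"
        define q' where "q' = im_vec (M x \<xi>)"
        have v: "re_vec (\<chi> k. \<i> * of_real \<xi> * G x \<xi> $ k) = - \<xi> *\<^sub>R q" "im_vec (\<chi> k. \<i> * of_real \<xi> * G x \<xi> $ k) = \<xi> *\<^sub>R p"
          "re_vec (\<chi> k. (\<i> * of_real \<xi>)\<^sup>2 * G x \<xi> $ k) = - (\<xi>\<^sup>2) *\<^sub>R p" "im_vec (\<chi> k. (\<i> * of_real \<xi>)\<^sup>2 * G x \<xi> $ k) = - (\<xi>\<^sup>2) *\<^sub>R q"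
          by (simp_all add: re_vec_def im_vec_def p_def q_def vec_eq_iff power_mult_distrib flip: of_real_power)
        have e1: "A0 *v p' + A1 *v (- \<xi> *\<^sub>R q) + L *v p = B *v (- (\<xi>\<^sup>2) *\<^sub>R p)"
          using arg_cong[OF elim, of re_vec] unfolding re_im_vec_add re_im_vec_cmatvec v by (simp only: p_def p'_def)
        have e2: "A0 *v q' + A1 *v (\<xi> *\<^sub>R p) + L *v q = B *v (- (\<xi>\<^sup>2) *\<^sub>R q)"
          using arg_cong[OF elim, of im_vec] unfolding re_im_vec_add re_im_vec_cmatvec v by (simp only: q_def q'_def)
        have "A0 *v p' = \<xi> *\<^sub>R (A1 *v q) - L *v p - \<xi>\<^sup>2 *\<^sub>R (B *v p)"
          using e1 unfolding matrix_vector_mult_scaleR by (simp add: algebra_simps eq_neg_iff_add_eq_0)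
        moreover have "A0 *v q' = - \<xi> *\<^sub>R (A1 *v p) - L *v q - \<xi>\<^sup>2 *\<^sub>R (B *v q)"
          using e2 unfolding matrix_vector_mult_scaleR by (simp add: algebra_simps eq_neg_iff_add_eq_0)
        ultimately have "2 * energy_form A0 K \<delta> \<xi> p q p' q' \<le> - c3 * (\<xi>\<^sup>2 / (1 + \<xi>\<^sup>2)) * energy_form A0 K \<delta> \<xi> p q p q"
          by (rule diss)
        then have "2 * E \<xi> (G x \<xi>) (M x \<xi>) \<le> - (\<rho> \<xi>) * E \<xi> (G x \<xi>) (G x \<xi>)"
          unfolding E_def energy_bilinear_def \<rho>_def p_def q_def p'_def q'_def by simp
        then show ?case unfolding E_def by (simp only: energy_bilinear_commute[OF symA0, of _ _ _ "M x \<xi>" "G x \<xi>"])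
      qed
    qed
    have \<rho>m: "\<rho> \<in> borel_measurable borel" unfolding \<rho>_def by measurable
    \<comment> \<open>The rate vanishes at \<xi> = 0 and only there, a null set.\<close>
    have "AE \<xi> in lborel. \<xi> \<noteq> (0::real)" by (rule AE_lborel_singleton)
    then have \<rho>pos: "AE \<xi> in lborel. 0 < \<rho> \<xi>"
      by eventually_elim (use c in \<open>auto simp: \<rho>_def add_pos_nonneg\<close>)
    have "AE \<xi> in lborel. E \<xi> (G t \<xi>) (G t \<xi>) \<le> exp (- (\<rho> \<xi> / 2 * t)) * E \<xi> (G 0 \<xi>) (G 0 \<xi>)"
      unfolding E_def
      by (rule pointwise_energy_decay[where M=M and \<rho>=\<rho>, OF symA0 sq deriv _ _ \<rho>m \<rho>pos t])
         (use Epos dissE in \<open>auto simp: E_def\<close>)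
    then show "AE \<xi> in lborel. (norm (fourier_L2 (U t) \<xi>))\<^sup>2
         \<le> c2 / c1 * exp (- (c3 / 2 * (\<xi>\<^sup>2 / (1 + \<xi>\<^sup>2)) * t)) * (norm (fourier_L2 (U 0) \<xi>))\<^sup>2"
    proof eventually_elim
      case (elim \<xi>)
      have "c1 * (norm (G t \<xi>))\<^sup>2 \<le> exp (- (\<rho> \<xi> / 2 * t)) * (c2 * (norm (G 0 \<xi>))\<^sup>2)"
        using order_trans[OF Elo elim] Ehi[of \<xi> "G 0 \<xi>"] by (meson exp_ge_zero mult_left_mono order_trans)
      then have "(norm (G t \<xi>))\<^sup>2 \<le> exp (- (\<rho> \<xi> / 2 * t)) * (c2 * (norm (G 0 \<xi>))\<^sup>2) / c1"
        using c by (simp add: pos_le_divide_eq mult.commute)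
      then show ?case by (simp add: G_def \<rho>_def mult_ac)
    qed
  qed
qed

section \<open>Decay rates\<close>

text \<open>Substituting y = sqrt a * x in the moment of the standard normal density: the monomial
  contributes a^(-l) and the Jacobian a^(-1/2), which is the algebraic decay rate.\<close>

lemma gaussian_moment:
  fixes a :: real assumes a: "0 < a"
  shows "integrable lborel (\<lambda>x. x ^ (2 * l) * exp (- (a / 2 * x\<^sup>2)))"
    "(LBINT x. x ^ (2 * l) * exp (- (a / 2 * x\<^sup>2)))
      = sqrt (2 * pi) * (LBINT y. std_normal_density y * y ^ (2 * l)) * a powr (- (real l + 1/2))"
proof -
  let ?f = "\<lambda>y::real. std_normal_density y * y ^ (2 * l)"
  have eq: "?f (0 + sqrt a * x) = (a ^ l / sqrt (2 * pi)) * (x ^ (2 * l) * exp (- (a / 2 * x\<^sup>2)))" for x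
    using a by (simp add: std_normal_density_def power_mult power_mult_distrib)
  have "integrable lborel (\<lambda>x. ?f (0 + sqrt a * x))"
    by (intro lborel_integrable_real_affine integrable_std_normal_moment) (use a in simp)
  then have "a ^ l / sqrt (2 * pi) = 0 \<or> integrable lborel (\<lambda>x. x ^ (2 * l) * exp (- (a / 2 * x\<^sup>2)))"
    unfolding eq integrable_mult_left_iff .
  then show "integrable lborel (\<lambda>x. x ^ (2 * l) * exp (- (a / 2 * x\<^sup>2)))"
    using a by simp
  have "(LBINT y. ?f y) = \<bar>sqrt a\<bar> *\<^sub>R (LBINT x. ?f (0 + sqrt a * x))"
    by (rule lborel_integral_real_affine) (use a in simp)
  also have "\<dots> = sqrt a * a ^ l / sqrt (2 * pi) * (LBINT x. x ^ (2 * l) * exp (- (a / 2 * x\<^sup>2)))"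
    unfolding eq using a by simp
  also have "sqrt a * a ^ l = a powr (real l + 1/2)"
    using a by (simp add: powr_add powr_realpow powr_half_sqrt mult.commute)
  finally show "(LBINT x. x ^ (2 * l) * exp (- (a / 2 * x\<^sup>2)))
      = sqrt (2 * pi) * (LBINT y. ?f y) * a powr (- (real l + 1/2))"
    using a by (simp add: powr_minus field_simps)
qed

theorem theorem5p2:
  fixes A0 A1 L B :: "real^'n^'n" and s :: real
  assumes "pos_def A0" and "symmetric_matrix A1" and "pos_semidef L" and "pos_semidef B"
    and "\<exists>K. compensating_function A0 A1 L B K"
    and "s \<ge> 2"
  shows "\<exists>C>0. \<exists>k>0. \<forall>U0 U.
           U0 \<in> sobolev s \<longrightarrow> integrable lborel U0 \<longrightarrow> cauchy_solution A0 A1 L B s U0 U \<longrightarrow>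
           (\<forall>l::nat. real l \<le> s - 1 \<longrightarrow> (\<forall>t\<ge>0.
              (L2_norm (weak_deriv l (U t)))\<^sup>2
                \<le> C * (exp (- k * t) * (L2_norm (weak_deriv l U0))\<^sup>2
                       + (1 + t) powr (- (real l + 1/2)) * (L1_norm U0)\<^sup>2)))"
proof -
  obtain K where K: "compensating_function A0 A1 L B K" using assms(5) by blast
  obtain C k where C: "0 < C" and k: "0 < k"
    and decay: "\<And>U0 U t. cauchy_solution A0 A1 L B s U0 U \<Longrightarrow> 0 \<le> t \<Longrightarrow>
       AE \<xi> in lborel. (norm (fourier_L2 (U t) \<xi>))\<^sup>2
         \<le> C * exp (- (k * (\<xi>\<^sup>2 / (1 + \<xi>\<^sup>2)) * t)) * (norm (fourier_L2 (U 0) \<xi>))\<^sup>2"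
    by (rule fourier_decay[OF assms(1-4) K assms(6)]) (rule that; assumption)
  \<comment> \<open>The dimension comes from the bound of the transform by the L1 norm, and exp (k /
    2) pays for replacing t by 1 + t in the Gaussian.\<close>
  define D where "D = C * real CARD('n) * exp (k / 2)"
  define m where "m l = sqrt (2 * pi) * (LBINT y. std_normal_density y * y ^ (2 * l)) * k powr (- (real l + 1/2))" for l
  have D: "0 \<le> D" using C by (simp add: D_def)
  have m0: "0 \<le> m l" for l
    unfolding m_def by (intro mult_nonneg_nonneg integral_nonneg_AE) (auto simp: power_mult)
  \<comment> \<open>Only finitely many orders l are admissible; summing their nonnegative constants
    over all l up to the integer part of s gives one constant independent of l.\<close>
  define C' where "C' = C + (\<Sum>l\<le>nat \<lfloor>s\<rfloor>. D * m l)"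
  have "0 < C'" unfolding C'_def using C D m0 by (intro add_pos_nonneg sum_nonneg mult_nonneg_nonneg) auto
  moreover have "0 < k / 2" using k by simp
  moreover have "(L2_norm (weak_deriv l (U t)))\<^sup>2
       \<le> C' * (exp (- (k / 2) * t) * (L2_norm (weak_deriv l U0))\<^sup>2 + (1 + t) powr (- (real l + 1/2)) * (L1_norm U0)\<^sup>2)"
    if U01: "integrable lborel U0" and sol: "cauchy_solution A0 A1 L B s U0 U"
      and l: "real l \<le> s - 1" and t: "0 \<le> t" for U0 U l t
  proof -
    define G where "G \<tau> = fourier_L2 (U \<tau>)" for \<tau>
    let ?d = "\<lambda>\<tau> \<xi>. \<xi> ^ (2 * l) * (norm (G \<tau> \<xi>))\<^sup>2" and ?h = "\<lambda>\<xi>. exp (- (k * (1 + t) / 2 * \<xi>\<^sup>2))"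
      and ?N = "real CARD('n) * (L1_norm U0)\<^sup>2" and ?e = "exp (- (k / 2) * t)" and ?p = "(1 + t) powr (- (real l + 1/2))"
    have Us: "U \<tau> \<in> sobolev s" if "0 \<le> \<tau>" for \<tau>
      using sol that by (auto simp: cauchy_solution_def sobolev_continuous_def)
    have G: "is_fourier_L2 (U \<tau>) (G \<tau>)" "integrable lborel (\<lambda>\<xi>. (1 + \<xi>\<^sup>2) powr s * (norm (G \<tau> \<xi>))\<^sup>2)" if "0 \<le> \<tau>" for \<tau>
      unfolding G_def using sobolev_fourier[OF Us[OF that]] by (auto simp: sobolev_weight_integrable_def)
    have [measurable]: "G t \<in> borel_measurable borel" "G 0 \<in> borel_measurable borel"
      using G(1)[OF t] G(1)[of 0] by (auto simp: is_fourier_L2_def sq_integrable_borel)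
    have F0: "is_fourier_L2 U0 (G 0)"
      by (rule is_fourier_L2_cong_AE[OF G(1)]) (use sol U01 in \<open>auto simp: cauchy_solution_def\<close>)
    have int: "integrable lborel (\<lambda>\<xi>. ?d \<tau> \<xi>)" if "0 \<le> \<tau>" for \<tau>
    proof (rule Bochner_Integration.integrable_bound[OF G(2)[OF that]])
      have [measurable]: "G \<tau> \<in> borel_measurable borel"
        using G(1)[OF that] by (auto simp: is_fourier_L2_def sq_integrable_borel)
      show "(\<lambda>\<xi>. ?d \<tau> \<xi>) \<in> borel_measurable lborel" by measurable
      show "AE \<xi> in lborel. norm (?d \<tau> \<xi>) \<le> norm ((1 + \<xi>\<^sup>2) powr s * (norm (G \<tau> \<xi>))\<^sup>2)"
        using power_le_sobolev_weight[of l s] l by (auto intro!: AE_I2 mult_right_mono simp: abs_mult power_even_abs)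
    qed
    have k1: "0 < k * (1 + t)" using k t by simp
    have "AE \<xi> in lborel. (norm (G 0 \<xi>))\<^sup>2 \<le> ?N"
      using fourier_L2_eq_fourier_L1[OF F0 U01]
      by eventually_elim (simp add: norm_fourier_L1_sq_le[OF U01])
    then have "AE \<xi> in lborel. ?d t \<xi> \<le>
        C * ?e * (?d 0 \<xi>)
        + D * (L1_norm U0)\<^sup>2 * (\<xi> ^ (2 * l) * ?h \<xi>)"
      using decay[OF sol t]
    proof eventually_elim
      case (elim \<xi>)
      define \<rho> where "\<rho> = \<xi>\<^sup>2 / (1 + \<xi>\<^sup>2)"
      have pos: "0 < 1 + \<xi>\<^sup>2" by (simp add: add_pos_nonneg)
      have x0: "0 \<le> \<xi> ^ (2 * l)" by (simp add: power_mult)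
      have G2: "(norm (G t \<xi>))\<^sup>2 \<le> C * (exp (- (k * \<rho> * t)) * (norm (G 0 \<xi>))\<^sup>2)"
        using elim(2) by (simp add: G_def \<rho>_def)
      have "exp (- (k * \<rho> * t)) * (norm (G 0 \<xi>))\<^sup>2 \<le> ?e * (norm (G 0 \<xi>))\<^sup>2
         + exp (k / 2) * ?h \<xi> * (?N)"
      proof (cases "1 \<le> \<xi>\<^sup>2")
        case True
        then have "1 / 2 \<le> \<rho>" using pos by (simp add: \<rho>_def field_simps)
        then have "k * (1/2) * t \<le> k * \<rho> * t" using k t by (intro mult_right_mono mult_left_mono) auto
        then have "exp (- (k * \<rho> * t)) * (norm (G 0 \<xi>))\<^sup>2 \<le> ?e * (norm (G 0 \<xi>))\<^sup>2"
          by (intro mult_right_mono) auto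
        moreover have "0 \<le> exp (k / 2) * ?h \<xi> * (?N)" by simp
        ultimately show ?thesis by linarith
      next
        case False
        then have "\<xi>\<^sup>2 / 2 \<le> \<rho>" unfolding \<rho>_def using pos by (intro divide_left_mono) auto
        then have "k * (\<xi>\<^sup>2 / 2) * t \<le> k * \<rho> * t" using k t by (intro mult_right_mono mult_left_mono) auto
        moreover have "k * \<xi>\<^sup>2 \<le> k * 1" using False k by (intro mult_left_mono) auto
        moreover have "k * (1 + t) / 2 * \<xi>\<^sup>2 = k * \<xi>\<^sup>2 / 2 + k * (\<xi>\<^sup>2 / 2) * t" by (simp add: field_simps)
        \<comment> \<open>For |\<xi>| < 1 the term k \<xi>^2 / 2 is at most k / 2, so adding it to
          the exponent costs a fixed factor. The Gaussian then has parameter k (1 + t), which stays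
          positive at t = 0.\<close>
        ultimately have "- (k * \<rho> * t) \<le> k / 2 + - (k * (1 + t) / 2 * \<xi>\<^sup>2)" by linarith
        then have "exp (- (k * \<rho> * t)) \<le> exp (k / 2) * ?h \<xi>"
          by (simp flip: exp_add)
        then have "exp (- (k * \<rho> * t)) * (norm (G 0 \<xi>))\<^sup>2 \<le> exp (k / 2) * ?h \<xi> * (?N)"
          using elim(1) by (intro mult_mono) auto
        moreover have "0 \<le> ?e * (norm (G 0 \<xi>))\<^sup>2" by simp
        ultimately show ?thesis by linarith
      qed
      from order_trans[OF G2 mult_left_mono[OF this less_imp_le[OF C]]]
      have "?d t \<xi> \<le> \<xi> ^ (2 * l) * (C * (?e * (norm (G 0 \<xi>))\<^sup>2
         + exp (k / 2) * ?h \<xi> * (?N)))"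
        by (rule mult_left_mono) (rule x0)
      also have "\<dots> = C * ?e * (?d 0 \<xi>)
        + D * (L1_norm U0)\<^sup>2 * (\<xi> ^ (2 * l) * ?h \<xi>)"
        unfolding D_def distrib_left by (simp only: mult_ac)
      finally show ?case .
    qed
    then have "(LBINT \<xi>. ?d t \<xi>) \<le>
       (LBINT \<xi>. C * ?e * (?d 0 \<xi>)
        + D * (L1_norm U0)\<^sup>2 * (\<xi> ^ (2 * l) * ?h \<xi>))"
      by (intro integral_mono_AE Bochner_Integration.integrable_add integrable_mult_right int gaussian_moment(1)[OF k1] t order_refl)
    also have "\<dots> = C * ?e * (LBINT \<xi>. ?d 0 \<xi>)
        + D * (L1_norm U0)\<^sup>2 * (LBINT \<xi>. \<xi> ^ (2 * l) * ?h \<xi>)"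
      by (subst Bochner_Integration.integral_add)
         (intro integrable_mult_right int gaussian_moment(1)[OF k1] order_refl | simp only: integral_mult_right_zero)+
    \<comment> \<open>With a = k (1 + t) the power of \<open>a\<close> splits: the power of k goes
      into \<open>m l\<close>, the power of 1 + t is the decay factor.\<close>
    also have "(LBINT \<xi>. \<xi> ^ (2 * l) * ?h \<xi>) = m l * ?p"
      unfolding gaussian_moment(2)[OF k1] m_def using k t by (simp add: powr_mult)
    finally have "(L2_norm (weak_deriv l (U t)))\<^sup>2 \<le> C * (?e * (L2_norm (weak_deriv l U0))\<^sup>2)
       + (D * m l) * (?p * (L1_norm U0)\<^sup>2)"
      unfolding L2_norm_weak_deriv[OF G(1)[OF t] G(2)[OF t] l] L2_norm_weak_deriv[OF F0 G(2)[OF order_refl] l]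
      by (simp add: mult_ac)
    also have "\<dots> \<le> C' * (?e * (L2_norm (weak_deriv l U0))\<^sup>2)
       + C' * (?p * (L1_norm U0)\<^sup>2)"
    proof (intro add_mono mult_right_mono)
      have sum0: "0 \<le> (\<Sum>l\<le>nat \<lfloor>s\<rfloor>. D * m l)" using D m0 by (intro sum_nonneg) simp
      then show "C \<le> C'" by (simp add: C'_def)
      have "l \<le> nat \<lfloor>s\<rfloor>" using l by (simp add: le_nat_floor)
      then have "D * m l \<le> (\<Sum>l\<le>nat \<lfloor>s\<rfloor>. D * m l)"
        using D m0 by (intro member_le_sum) auto
      then show "D * m l \<le> C'" using C by (simp add: C'_def)
    qed auto
    finally show ?thesis by (simp only: distrib_left)
  qed
  ultimately show ?thesis by blast
qed

end
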